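(* Let $g:(0,\infty)^n\to\mathbb{R}$ be a continuous symmetric function and let $h:\mathbb{R}^n\to\mathbb{R}$, $h(x_1,\dots,x_n)=g(\exp x_1,\dots,\exp x_n)$. Suppose that $h$ is convex and that the function $p$ associated to $h$ (defined by $p\big(x^\downarrow_1,\ x^\downarrow_1+x^\downarrow_2,\ \dots,\ x^\downarrow_1+\dots+x^\downarrow_n\big)=h(x)$ for $x\in\mathbb{R}^n$) is nonincreasing in each argument. Define $$w:GL(n,\mathbb{R})^+\to\mathbb{R},\qquad w(F)=g(\sigma(F)).$$ Let $\Omega\subset\mathbb{R}^n$ be a bounded open set with piecewise smooth boundary and let $\phi_k:\Omega\to\mathbb{R}^n$, $k\in\mathbb{N}$, be a sequence of Lipschitz functions with uniformly bounded Lipschitz constants such that (i) for every $k$, $D\phi_k(x)\in GL(n,\mathbb{R})^+$ for almost every $x\in\Omega$; (ii) the sequence $\phi_k$ converges uniformly to a bi-Lipschitz function $u:\Omega\to\Omega$. Then $$\liminf_{k\to\infty}\int_\Omega w(D\phi_k(x))\,dx\ \ge\ \int_\Omega w(Du(x))\,dx .$$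
   Context: $GL(n,\mathbb{R})^+$ is the group of real $n\times n$ matrices with positive determinant. For a matrix $F$, $\sigma(F)=(\sigma_1(F),\dots,\sigma_n(F))$ is the vector of singular values of $F$ (the order is irrelevant since $g$ is symmetric). A function on $(0,\infty)^n$ or $\mathbb{R}^n$ is symmetric if it is invariant under permutations of the coordinates. For $x\in\mathbb{R}^n$, $x^\downarrow=(x^\downarrow_1,\dots,x^\downarrow_n)$ is the vector obtained by rearranging the components of $x$ in decreasing order. Given a symmetric function $h:\mathbb{R}^n\to\mathbb{R}$, the associated function $p$ is the unique function defined on the set of vectors of partial sums $\{(x^\downarrow_1,\ x^\downarrow_1+x^\downarrow_2,\ \dots,\ x^\downarrow_1+\dots+x^\downarrow_n): x\in\mathbb{R}^n\}$ by $p\big(x^\downarrow_1,\ x^\downarrow_1+x^\downarrow_2,\ \dots,\ \sum_{i=1}^n x^\downarrow_i\big)=h(x)$; "nonincreasing in each argument" refers to this domain. *)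

theory Defs
  imports "HOL-Analysis.Analysis"
begin

section \<open>Symmetric functions and partial sums of ordered coordinates\<close>

definition pos_orthant :: "(real^'n) set" where
  "pos_orthant = {x. \<forall>i. 0 < x $ i}"

definition symmetric_on :: "(real^'n) set \<Rightarrow> (real^'n \<Rightarrow> 'b) \<Rightarrow> bool" where
  "symmetric_on X f \<longleftrightarrow>
     (\<forall>\<pi>. \<pi> permutes UNIV \<longrightarrow> (\<forall>x\<in>X. f (\<chi> i. x $ \<pi> i) = f x))"

text \<open>The index type \<open>'n\<close> carries no order, so \<open>x\<^sup>\<down>\<close> and its partial sums are lists of
  length \<open>CARD('n)\<close>; the entry at list position \<open>k\<close> is the \<open>(k + 1)\<close>-st coordinate.\<close>

definition decreasing_rearrangement :: "real^'n \<Rightarrow> real list" where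
  "decreasing_rearrangement x =
     rev (sorted_list_of_multiset (image_mset (\<lambda>i. x $ i) (mset_set UNIV)))"

definition partial_sums :: "real^'n \<Rightarrow> real list" where
  "partial_sums x =
     map (\<lambda>k. sum_list (take k (decreasing_rearrangement x))) [1..<Suc CARD('n)]"

text \<open>Only pairs of points of \<open>D\<close> that differ in a single coordinate are compared.\<close>

definition nonincreasing_in_each_argument_on :: "real list set \<Rightarrow> (real list \<Rightarrow> real) \<Rightarrow> bool" where
  "nonincreasing_in_each_argument_on D p \<longleftrightarrow>
     (\<forall>y\<in>D. \<forall>i<length y. \<forall>t. y[i := t] \<in> D \<and> y ! i \<le> t \<longrightarrow> p (y[i := t]) \<le> p y)"


section \<open>Singular values\<close>

definition GL_pos :: "(real^'n^'n) set" where
  "GL_pos = {F. 0 < det F}"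

text \<open>The entries of \<open>s\<close> are the nonnegative square roots of the eigenvalues of
  \<open>F\<^sup>T F\<close>, counted with multiplicity as roots of the characteristic polynomial.
  This determines \<open>s\<close> up to the order of its entries.\<close>

definition is_singular_values :: "real^'n^'n \<Rightarrow> real^'n \<Rightarrow> bool" where
  "is_singular_values F s \<longleftrightarrow>
     (\<forall>i. 0 \<le> s $ i) \<and>
     (\<forall>t. det (mat t - transpose F ** F) = (\<Prod>i\<in>UNIV. t - (s $ i)\<^sup>2))"

definition singular_values :: "real^'n^'n \<Rightarrow> real^'n" where
  "singular_values F = (SOME s. is_singular_values F s)"


section \<open>Piecewise smooth boundary and bi-Lipschitz maps\<close>

text \<open>The parameter domain of a boundary piece is the face \<open>x\<^sub>i = 0\<close> of the unit cube, a
  copy of \<open>[0,1]\<close> to the power \<open>n - 1\<close>; for \<open>n = 1\<close> it is a point. Here \<open>1\<close> is the vector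
  all of whose coordinates are \<open>1\<close>.\<close>

definition cube_face :: "'n \<Rightarrow> (real^'n) set" where
  "cube_face i = {x \<in> cbox 0 1. x $ i = 0}"

definition cube_face_interior :: "'n \<Rightarrow> (real^'n) set" where
  "cube_face_interior i = {x. x $ i = 0 \<and> (\<forall>j. j \<noteq> i \<longrightarrow> 0 < x $ j \<and> x $ j < 1)}"

text \<open>A smooth piece of hypersurface is the image of the closed face under a map that is
  continuously differentiable up to the boundary of the face and that is injective and an
  immersion in its relative interior (as usual for piecewise smooth surfaces, the
  parametrization may degenerate at the edges, as at the tip of a cone). Smooth means
  \<open>C\<^sup>1\<close>, so pieces of any higher regularity are included. Pieces may overlap, so that a
  compact smooth hypersurface is covered by finitely many of them.\<close>

definition smooth_hypersurface_piece :: "(real^'n) set \<Rightarrow> bool" where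
  "smooth_hypersurface_piece S \<longleftrightarrow>
     (\<exists>U \<Phi> \<Phi>' i.
        open U \<and> cube_face i \<subseteq> U \<and>
        (\<forall>x\<in>U. (\<Phi> has_derivative (\<lambda>v. \<Phi>' x *v v)) (at x)) \<and>
        continuous_on U (\<Phi>' :: real^'n \<Rightarrow> real^'n^'n) \<and>
        inj_on \<Phi> (cube_face_interior i) \<and>
        (\<forall>x\<in>cube_face_interior i. \<forall>v. v $ i = 0 \<and> \<Phi>' x *v v = 0 \<longrightarrow> v = 0) \<and>
        S = \<Phi> ` cube_face i)"

definition piecewise_smooth_boundary :: "(real^'n) set \<Rightarrow> bool" where
  "piecewise_smooth_boundary \<Omega> \<longleftrightarrow>
     (\<exists>\<S>. finite \<S> \<and> (\<forall>S\<in>\<S>. smooth_hypersurface_piece S) \<and> frontier \<Omega> = \<Union>\<S>)"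

definition bi_lipschitz_on ::
    "'a::metric_space set \<Rightarrow> ('a \<Rightarrow> 'b::metric_space) \<Rightarrow> bool" where
  "bi_lipschitz_on X f \<longleftrightarrow>
     (\<exists>c C. 0 < c \<and>
        (\<forall>x\<in>X. \<forall>y\<in>X. c * dist x y \<le> dist (f x) (f y) \<and> dist (f x) (f y) \<le> C * dist x y))"


section \<open>Extended real valued integral\<close>

text \<open>The integral of a function that is bounded below on a set of finite measure is an
  element of \<open>(-\<infinity>, \<infinity>]\<close>. The Bochner integral is \<open>0\<close> where this one is \<open>\<infinity>\<close>.
  The difference \<open>\<infinity> - \<infinity>\<close> is \<open>\<infinity>\<close> in \<open>ereal\<close>; under the hypotheses used here the
  negative part has a finite integral.\<close>

definition ereal_integral :: "'a measure \<Rightarrow> ('a \<Rightarrow> real) \<Rightarrow> ereal" where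
  "ereal_integral M f =
     enn2ereal (\<integral>\<^sup>+x. ennreal (f x) \<partial>M) - enn2ereal (\<integral>\<^sup>+x. ennreal (- f x) \<partial>M)"

end

theory Submission
  imports Defs
begin

text \<open>
The hypotheses on \<open>h\<close> force \<open>w\<close> to be a function of the determinant alone. A convex
symmetric function does not decrease when one of the first \<open>n - 1\<close> partial sums of the ordered
coordinates is raised and the total is kept, whereas \<open>p\<close> does not increase in these arguments, so
only the total, which is the logarithm of the determinant, can matter. In terms of a subgradient
\<open>s\<close> of \<open>h\<close> at a point with distinct coordinates: invariance under transpositions makes \<open>s\<close>
ordered like the coordinates, monotonicity of \<open>p\<close> makes it ordered oppositely, and so
\<open>s = (c, \<dots>, c)\<close> with \<open>c \<le> 0\<close>. Hence \<open>h x = f (\<Sum>i. x $ i)\<close> with \<open>f\<close> convex and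
nonincreasing (\<open>symmetric_convex_function_of_coordinate_sum\<close>). The product of the singular values
is the determinant (\<open>prod_singular_values\<close>), so \<open>w F = \<psi> (det F)\<close> with \<open>\<psi> d = f (ln d)\<close>, and
\<open>\<psi>\<close> is convex and nonincreasing because \<open>ln\<close> is concave.

A supporting line of \<open>\<psi>\<close> at \<open>det Du\<close>, with slope \<open>a\<close>, gives the pointwise bound
\<open>\<psi> (det D\<phi>\<^sub>k) \<ge> \<psi> (det Du) + a * (det D\<phi>\<^sub>k - det Du)\<close>. Since \<open>u\<close> is bi-Lipschitz,
\<open>det Du\<close> stays away from \<open>0\<close> and the weight \<open>a\<close> is bounded. It therefore suffices that
\<open>det D\<phi>\<^sub>k\<close> converges to \<open>det Du\<close> when integrated against bounded measurable functions
(\<open>jacobian_determinants_converge_weakly\<close>); this convergence also shows \<open>det Du \<ge> 0\<close>.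

The weak convergence expresses that the determinant is a null Lagrangian. It is linear in each row
of the Jacobian, so the components of \<open>u\<close> can be exchanged for those of \<open>\<phi>\<^sub>k\<close> one at a time.
Each exchange changes \<open>\<integral> \<eta> det Dv\<close> by an integral in which one component of \<open>v\<close> is uniformly
small, and \<open>integral_by_parts_det\<close> moves the derivative from this component to the test function
\<open>\<eta>\<close>. Integration by parts in turn is the product rule together with \<open>\<integral> det Dw = 0\<close> for a
compactly supported Lipschitz map \<open>w\<close>. To see the latter, note that for large \<open>t\<close> the map
\<open>x \<mapsto> t x + w x\<close> is a bijection from a large ball \<open>B\<close> onto \<open>t B\<close>; the change of variables
formula yields \<open>\<integral>\<^sub>B det (t I + Dw) = t\<^sup>n |B|\<close>, both sides are polynomials in \<open>t\<close>, and \<open>t = 0\<close>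
gives the claim.

All of this needs derivatives almost everywhere, of \<open>u\<close> and of auxiliary maps, that is, Rademacher's
theorem (\<open>lipschitz_real_valued_ae_differentiable\<close>). On a line, a Lipschitz function is the integral
of its difference quotient limit, by the Radon-Nikodym theorem. In several dimensions, the
directional derivatives along the coordinate axes are bounded Borel functions, and at a point where
all of them have a Lebesgue point, moving along the axes and averaging over a small cube shows that
the function is close to its linear approximation.
\<close>

section \<open>Symmetric convex functions of partial sums\<close>

text \<open>The point \<open>(x, h x)\<close> can be separated from the strict epigraph. The separating hyperplane is
not vertical because \<open>h\<close> is finite everywhere.\<close>

lemma convex_on_UNIV_subgradient:
  fixes h :: "'a::euclidean_space \<Rightarrow> real"
  assumes "convex_on UNIV h"
  shows "\<exists>s. \<forall>y. h y \<ge> h x + s \<bullet> (y - x)"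
proof -
  let ?T = "{z::'a \<times> real. h (fst z) < snd z}"
  have "convex ?T"
    unfolding convex_def
  proof (intro ballI allI impI)
    fix z z' :: "'a \<times> real" and u v :: real
    assume z: "z \<in> ?T" "z' \<in> ?T" and uv: "0 \<le> u" "0 \<le> v" "u + v = 1"
    have "h (u *\<^sub>R fst z + v *\<^sub>R fst z') \<le> u * h (fst z) + v * h (fst z')"
      using assms uv unfolding convex_on_def by auto
    also have "\<dots> < u * snd z + v * snd z'"
    proof (cases "u = 0")
      case False
      have "u * h (fst z) < u * snd z" using z False uv by simp
      moreover have "v * h (fst z') \<le> v * snd z'" using z uv by (simp add: mult_left_mono)
      ultimately show ?thesis by simp
    qed (use z uv in simp)
    finally show "u *\<^sub>R z + v *\<^sub>R z' \<in> ?T" by simp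
  qed
  moreover have "(x, h x + 1) \<in> ?T" by simp
  ultimately obtain c b where c: "c \<noteq> 0" "c \<bullet> (x, h x) \<le> b" "\<forall>z\<in>?T. b \<le> c \<bullet> z"
    using separating_hyperplane_sets[of "{(x, h x)}" ?T] by fastforce
  obtain a \<alpha> where ca: "c = (a, \<alpha>)" by force
  have le: "a \<bullet> x + \<alpha> * h x \<le> a \<bullet> y + \<alpha> * r" if "h y < r" for y r
    using c that by (fastforce simp: ca)
  have "0 \<le> \<alpha>"
    using le[of x "h x + 1"] by (simp add: algebra_simps)
  moreover have "\<alpha> \<noteq> 0"
  proof
    assume "\<alpha> = 0"
    then have "a \<bullet> x \<le> a \<bullet> (x - a)" using le[of "x - a" "h (x - a) + 1"] by simp
    then have "a \<bullet> a \<le> 0" by (simp add: inner_diff_right)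
    then have "a = 0" by (metis inner_ge_zero inner_eq_zero_iff order_antisym)
    then show False using \<open>c \<noteq> 0\<close> \<open>\<alpha> = 0\<close> ca by (simp add: zero_prod_def)
  qed
  ultimately have \<alpha>: "\<alpha> > 0" by simp
  have "h y \<ge> h x + (- (1/\<alpha>) *\<^sub>R a) \<bullet> (y - x)" for y
  proof (rule field_le_epsilon)
    fix e :: real assume "e > 0"
    then have "a \<bullet> x + \<alpha> * h x \<le> a \<bullet> y + \<alpha> * (h y + e)" by (intro le) simp
    then show "h x + (- (1/\<alpha>) *\<^sub>R a) \<bullet> (y - x) \<le> h y + e"
      using \<alpha> by (simp add: field_simps inner_diff_right)
  qed
  then show ?thesis by blast
qed

lemma distinct_coordinates_enumeration:
  fixes x :: "real^'n"
  assumes "inj (\<lambda>i. x $ i)"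
  obtains b where "bij_betw b {..<CARD('n)} UNIV" "\<And>i j. i < j \<Longrightarrow> j < CARD('n) \<Longrightarrow> x $ b j < x $ b i"
proof -
  let ?X = "range (\<lambda>i. x $ i)"
  let ?l = "decreasing_rearrangement x"
  have l: "?l = rev (sorted_list_of_set ?X)"
    unfolding decreasing_rearrangement_def
    by (subst image_mset_mset_set[OF assms]) (simp add: sorted_list_of_mset_set)
  have len: "length ?l = CARD('n)" using assms by (simp add: l card_image)
  have set: "set ?l = ?X" by (simp add: l)
  have dec: "?l ! j < ?l ! i" if "i < j" "j < CARD('n)" for i j
  proof -
    let ?s = "sorted_list_of_set ?X"
    have ls: "length ?s = CARD('n)" using len l by simp
    have "?s ! (CARD('n) - Suc j) < ?s ! (CARD('n) - Suc i)"
      by (rule sorted_wrt_nth_less[OF strict_sorted_list_of_set]) (use that ls in auto)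
    then show ?thesis using that ls by (simp add: l rev_nth)
  qed
  define b where "b k = the_inv (\<lambda>i. x $ i) (?l ! k)" for k
  have xb: "x $ b k = ?l ! k" if "k < CARD('n)" for k
    unfolding b_def using that len set nth_mem[of k ?l]
    by (intro f_the_inv_into_f[OF assms]) auto
  show ?thesis
  proof
    show gt: "x $ b j < x $ b i" if "i < j" "j < CARD('n)" for i j
      using that xb[of i] xb[of j] dec by simp
    have "inj_on b {..<CARD('n)}"
      by (rule linorder_inj_onI) (use gt in fastforce)+
    then show "bij_betw b {..<CARD('n)} UNIV"
      unfolding bij_betw_def by (metis card_image card_lessThan card_subset_eq finite_UNIV_card_ge_0 card_ge_0_finite subset_UNIV finite)
  qed
qed

lemma partial_sums_enumeration:
  fixes x :: "real^'n"
  assumes "bij_betw b {..<CARD('n)} UNIV" "\<And>i j. i < j \<Longrightarrow> j < CARD('n) \<Longrightarrow> x $ b j < x $ b i"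
  shows "partial_sums x = map (\<lambda>k. \<Sum>i\<le>k. x $ b i) [0..<CARD('n)]"
proof -
  let ?n = "CARD('n)"
  have inj: "inj_on (\<lambda>k. x $ b k) {..<?n}"
    by (rule linorder_inj_onI) (use assms(2) in fastforce)+
  have "image_mset (\<lambda>i. x $ i) (mset_set UNIV) = image_mset (\<lambda>k. x $ b k) (mset_set {..<?n})"
    using assms(1) image_mset_mset_set[of b "{..<?n}"]
    by (simp add: bij_betw_def flip: multiset.map_comp[unfolded o_def])
  also have "\<dots> = mset (map (\<lambda>k. x $ b k) [0..<?n])"
    by (simp add: mset_upt atLeast0LessThan)
  also have "\<dots> = mset (rev (map (\<lambda>k. x $ b k) [0..<?n]))" by simp
  finally have *: "sorted_list_of_multiset (image_mset (\<lambda>i. x $ i) (mset_set UNIV)) = sort (rev (map (\<lambda>k. x $ b k) [0..<?n]))"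
    by (metis sorted_list_of_multiset_mset)
  have "sorted (rev (map (\<lambda>k. x $ b k) [0..<?n]))"
    unfolding sorted_rev_iff_nth_mono
    using assms(2) by (auto simp: le_less)
  then have d: "decreasing_rearrangement x = map (\<lambda>k. x $ b k) [0..<?n]"
    unfolding decreasing_rearrangement_def * by (metis sorted_sort_id rev_rev_ident)
  show ?thesis
  proof (rule nth_equalityI)
    fix k assume "k < length (partial_sums x)"
    then have k: "k < ?n" by (simp add: partial_sums_def del: upt_Suc)
    have "partial_sums x ! k = sum_list (take (Suc k) (map (\<lambda>k. x $ b k) [0..<?n]))"
      using k by (simp add: partial_sums_def d del: upt_Suc)
    also have "\<dots> = sum_list (map (\<lambda>k. x $ b k) [0..<Suc k])"
      using k by (simp add: take_map del: upt_Suc)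
    also have "\<dots> = (\<Sum>i\<in>{0..<Suc k}. x $ b i)"
      by (simp only: interv_sum_list_conv_sum_set_nat set_upt)
    also have "\<dots> = (\<Sum>i\<le>k. x $ b i)"
      by (simp only: atLeast0LessThan lessThan_Suc_atMost)
    finally show "partial_sums x ! k = map (\<lambda>k. \<Sum>i\<le>k. x $ b i) [0..<CARD('n)] ! k" using k by simp
  qed (simp add: partial_sums_def del: upt_Suc)
qed


text \<open>Raising the partial sum with index \<open>k\<close> alone means moving mass \<open>t\<close> from the next smaller
coordinate to coordinate \<open>b k\<close>, or, for the last index, adding \<open>t\<close> to the smallest coordinate.
If the coordinates are distinct, a small \<open>t\<close> preserves their order, so the shifted point is again
compared by \<open>p\<close>.\<close>

lemma small_shift_lowers_value:
  fixes x :: "real^'n" and h :: "real^'n \<Rightarrow> real"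
  assumes p: "\<And>x :: real^'n. p (partial_sums x) = h x"
    and mono: "nonincreasing_in_each_argument_on (range (partial_sums :: real^'n \<Rightarrow> real list)) p"
    and b: "bij_betw b {..<CARD('n)} UNIV" "\<And>i j. i < j \<Longrightarrow> j < CARD('n) \<Longrightarrow> x $ b j < x $ b i"
    and k: "k < CARD('n)"
  defines "v \<equiv> (\<chi> j. (if j = b k then 1 else 0) - (if Suc k < CARD('n) \<and> j = b (Suc k) then 1 else 0))"
  shows "\<exists>t>0. h (x + t *\<^sub>R v) \<le> h x"
proof -
  let ?n = "CARD('n)"
  have inj: "b i = b j \<longleftrightarrow> i = j" if "i < ?n" "j < ?n" for i j
    using b(1) that by (auto simp: bij_betw_def inj_on_def)
  have v: "v $ b i = (if i = k then 1 else 0) - (if i = Suc k then 1 else 0)" if "i < ?n" for i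
    using that k inj by (auto simp: v_def)
  have "eventually (\<lambda>t. (x + t *\<^sub>R v) $ b j < (x + t *\<^sub>R v) $ b i) (at_right 0)"
    if "i < j" "j < ?n" for i j
  proof -
    have "((\<lambda>t. (x + t *\<^sub>R v) $ b i - (x + t *\<^sub>R v) $ b j) \<longlongrightarrow> (x + 0 *\<^sub>R v) $ b i - (x + 0 *\<^sub>R v) $ b j) (at_right 0)"
      by (intro tendsto_intros)
    then have "\<forall>\<^sub>F t in at_right 0. 0 < (x + t *\<^sub>R v) $ b i - (x + t *\<^sub>R v) $ b j"
      by (rule order_tendstoD) (use b(2)[OF that] in simp)
    then show ?thesis by (rule eventually_mono) simp
  qed
  then have "\<forall>\<^sub>F t in at_right 0. \<forall>i\<in>{..<?n}. \<forall>j\<in>{..<?n}. i < j \<longrightarrow> (x + t *\<^sub>R v) $ b j < (x + t *\<^sub>R v) $ b i"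
    by (auto intro!: eventually_ball_finite)
  then obtain t where t: "t > 0"
    and ord: "\<And>i j. i < j \<Longrightarrow> j < ?n \<Longrightarrow> (x + t *\<^sub>R v) $ b j < (x + t *\<^sub>R v) $ b i"
    unfolding eventually_at_right_field
    by (metis (no_types, lifting) dense lessThan_iff order.strict_trans)
  let ?y = "partial_sums x"
  have y: "?y = map (\<lambda>k. \<Sum>i\<le>k. x $ b i) [0..<?n]"
    by (rule partial_sums_enumeration[OF b])
  have sv: "(\<Sum>i\<le>m. v $ b i) = (if m = k then 1 else 0)" if "m < ?n" for m
  proof -
    have "(\<Sum>i\<le>m. v $ b i) = (\<Sum>i\<le>m. (if i = k then 1 else 0) - (if i = Suc k then 1 else 0))"
      using that by (intro sum.cong) (auto simp: v)
    then show ?thesis by (simp add: sum_subtractf)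
  qed
  have "partial_sums (x + t *\<^sub>R v) = map (\<lambda>k. \<Sum>i\<le>k. (x + t *\<^sub>R v) $ b i) [0..<?n]"
    by (rule partial_sums_enumeration[OF b(1) ord])
  also have "\<dots> = ?y[k := ?y ! k + t]"
    by (rule nth_equalityI) (use k sv in \<open>auto simp: y sum.distrib nth_list_update simp flip: sum_distrib_left\<close>)
  finally have eq: "partial_sums (x + t *\<^sub>R v) = ?y[k := ?y ! k + t]" .
  have "?y \<in> range (partial_sums :: real^'n \<Rightarrow> real list)" by blast
  moreover have "k < length ?y" "?y ! k \<le> ?y ! k + t" using k t by (auto simp: y)
  moreover have "?y[k := ?y ! k + t] \<in> range (partial_sums :: real^'n \<Rightarrow> real list)" using eq by (metis rangeI)
  ultimately have "p (?y[k := ?y ! k + t]) \<le> p ?y"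
    using mono unfolding nonincreasing_in_each_argument_on_def by blast
  then show ?thesis using t eq p by metis
qed

text \<open>The shifts of \<open>small_shift_lowers_value\<close> make \<open>s\<close> nondecreasing along the decreasing order of
the coordinates, ending with a nonpositive value. Exchanging two neighbouring coordinates leaves
\<open>h\<close> unchanged, which gives the opposite monotonicity.\<close>

lemma subgradient_is_nonpositive_multiple_of_one:
  fixes x s :: "real^'n" and h :: "real^'n \<Rightarrow> real"
  assumes p: "\<And>x :: real^'n. p (partial_sums x) = h x"
    and mono: "nonincreasing_in_each_argument_on (range (partial_sums :: real^'n \<Rightarrow> real list)) p"
    and sym: "symmetric_on UNIV h"
    and inj: "inj (\<lambda>i. x $ i)"
    and s: "\<And>y. h y \<ge> h x + s \<bullet> (y - x)"
  shows "\<exists>c\<le>0. s = (\<chi> i. c)"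
proof -
  let ?n = "CARD('n)"
  obtain b where b: "bij_betw b {..<?n} UNIV" "\<And>i j. i < j \<Longrightarrow> j < ?n \<Longrightarrow> x $ b j < x $ b i"
    using distinct_coordinates_enumeration[OF inj] by blast
  have up: "s $ b k \<le> (if Suc k < ?n then s $ b (Suc k) else 0)" if k: "k < ?n" for k
  proof -
    let ?v = "\<chi> j. (if j = b k then 1 else 0) - (if Suc k < ?n \<and> j = b (Suc k) then 1 else (0::real))"
    obtain t where t: "t > 0" "h (x + t *\<^sub>R ?v) \<le> h x"
      using small_shift_lowers_value[OF p mono b k] by blast
    have "h x + s \<bullet> (x + t *\<^sub>R ?v - x) \<le> h (x + t *\<^sub>R ?v)" by (rule s)
    then have "t * (s \<bullet> ?v) \<le> 0" using t by simp
    then have "s \<bullet> ?v \<le> 0" using t by (simp add: mult_le_0_iff)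
    moreover have "s \<bullet> ?v = s $ b k - (if Suc k < ?n then s $ b (Suc k) else 0)"
      by (auto simp: inner_vec_def right_diff_distrib sum_subtractf mult_delta_right)
    ultimately show ?thesis by simp
  qed
  have down: "s $ b (Suc k) \<le> s $ b k" if k: "Suc k < ?n" for k
  proof -
    let ?i = "b k" and ?j = "b (Suc k)"
    have lt: "x $ ?j < x $ ?i" using b(2) k by blast
    let ?y = "\<chi> l. x $ (Transposition.transpose ?i ?j l)"
    have "h ?y = h x"
      using sym permutes_swap_id[of ?i UNIV ?j] unfolding symmetric_on_def by auto
    then have "s \<bullet> (?y - x) \<le> 0" using s[of ?y] by simp
    moreover have "?y - x = (\<chi> l. (if l = ?i then x $ ?j - x $ ?i else 0) + (if l = ?j then x $ ?i - x $ ?j else 0))"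
      using lt by (auto simp: vec_eq_iff Transposition.transpose_def)
    then have "s \<bullet> (?y - x) = (s $ ?i - s $ ?j) * (x $ ?j - x $ ?i)"
      by (simp add: inner_vec_def distrib_left sum.distrib mult_delta_right) (simp add: algebra_simps)
    ultimately show ?thesis using lt by (simp add: mult_le_0_iff)
  qed
  have eq: "s $ b k = s $ b 0" if "k < ?n" for k
    using that
  proof (induction k)
    case (Suc k)
    then show ?case using up[of k] down[of k] by simp
  qed simp
  have "s $ b 0 \<le> 0" using up[of "?n - 1"] eq[of "?n - 1"] by simp
  moreover have "s = (\<chi> i. s $ b 0)"
    unfolding vec_eq_iff
  proof
    fix i
    obtain k where "k < ?n" "i = b k" using b(1) by (auto simp: bij_betw_def)
    then show "s $ i = (\<chi> i. s $ b 0) $ i" using eq[of k] by simp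
  qed
  ultimately show ?thesis by (intro exI[of _ "s $ b 0"] conjI)
qed

text \<open>Two coordinates of \<open>x + t v\<close> agree for at most one value of \<open>t\<close>.\<close>

lemma eventually_distinct_coordinates:
  fixes x v :: "real^'n"
  assumes "inj (\<lambda>i. v $ i)"
  shows "eventually (\<lambda>t. inj (\<lambda>i. (x + t *\<^sub>R v) $ i)) (at_right 0)"
proof -
  have "eventually (\<lambda>t. (x + t *\<^sub>R v) $ i \<noteq> (x + t *\<^sub>R v) $ j) (at_right 0)" if "i \<noteq> j" for i j
  proof -
    have "v $ i \<noteq> v $ j" using assms that by (auto dest: injD)
    then have "(x + t *\<^sub>R v) $ i = (x + t *\<^sub>R v) $ j \<longleftrightarrow> t = (x $ j - x $ i) / (v $ i - v $ j)" for t
      by (auto simp: field_simps)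
    then show ?thesis
      using eventually_neq_at_within[of "(x $ j - x $ i) / (v $ i - v $ j)" 0 "{0<..}"] by simp
  qed
  then have "eventually (\<lambda>t. \<forall>i\<in>UNIV. \<forall>j\<in>UNIV. i \<noteq> j \<longrightarrow> (x + t *\<^sub>R v) $ i \<noteq> (x + t *\<^sub>R v) $ j) (at_right 0)"
    by (intro eventually_ball_finite ballI) auto
  then show ?thesis by (rule eventually_mono) (auto simp: inj_def)
qed

text \<open>If \<open>x\<close> has distinct coordinates, this is the subgradient inequality at \<open>x\<close>. Such points are
dense, even among those of larger coordinate sum, and \<open>h\<close> is continuous.\<close>

lemma symmetric_convex_antitone_in_coordinate_sum:
  fixes x y :: "real^'n" and h :: "real^'n \<Rightarrow> real"
  assumes p: "\<And>x :: real^'n. p (partial_sums x) = h x"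
    and mono: "nonincreasing_in_each_argument_on (range (partial_sums :: real^'n \<Rightarrow> real list)) p"
    and sym: "symmetric_on UNIV h" and conv: "convex_on UNIV h"
    and le: "(\<Sum>i\<in>UNIV. y $ i) \<le> (\<Sum>i\<in>UNIV. x $ i)"
  shows "h x \<le> h y"
proof -
  have main: "h x \<le> h y" if inj: "inj (\<lambda>i. x $ i)" and le: "(\<Sum>i\<in>UNIV. y $ i) \<le> (\<Sum>i\<in>UNIV. x $ i)" for x
  proof -
    obtain s where s: "\<And>z. h z \<ge> h x + s \<bullet> (z - x)"
      using convex_on_UNIV_subgradient[OF conv] by blast
    obtain c where c: "c \<le> 0" "s = (\<chi> i. c)"
      using subgradient_is_nonpositive_multiple_of_one[OF p mono sym inj s] by auto
    have "s \<bullet> (y - x) = c * ((\<Sum>i\<in>UNIV. y $ i) - (\<Sum>i\<in>UNIV. x $ i))"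
      by (simp add: c inner_vec_def sum_subtractf flip: sum_distrib_left)
    also have "\<dots> \<ge> 0" using c le by (intro mult_nonpos_nonpos) auto
    finally show ?thesis using s[of y] by simp
  qed
  obtain e :: "'n \<Rightarrow> nat" where e: "inj e"
    using finite_imp_inj_to_nat_seg[of "UNIV :: 'n set"] by auto
  \<comment> \<open>a direction with distinct nonnegative entries, so that \<open>x + t v\<close> has coordinate sum at least that of \<open>x\<close>\<close>
  define v :: "real^'n" where "v = (\<chi> i. real (e i))"
  have v: "inj (\<lambda>i. v $ i)" using e by (simp add: v_def inj_def)
  have "continuous_on UNIV h" by (rule convex_on_continuous[OF open_UNIV conv])
  then have "((\<lambda>t. h (x + t *\<^sub>R v)) \<longlongrightarrow> h (x + 0 *\<^sub>R v)) (at_right 0)"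
    by (intro tendsto_intros continuous_on_tendsto_compose[where f = h]) auto
  moreover have "eventually (\<lambda>t. h (x + t *\<^sub>R v) \<le> h y) (at_right 0)"
    using eventually_distinct_coordinates[OF v, of x] eventually_at_right_less[of 0]
  proof eventually_elim
    case (elim t)
    have "0 \<le> t * (\<Sum>i\<in>UNIV. v $ i)" using elim by (intro mult_nonneg_nonneg sum_nonneg) (auto simp: v_def)
    then show ?case
      using elim le by (intro main) (auto simp: sum.distrib simp flip: sum_distrib_left)
  qed
  ultimately have "h (x + 0 *\<^sub>R v) \<le> h y"
    by (intro tendsto_upperbound) auto
  then show ?thesis by simp
qed

lemma symmetric_convex_function_of_coordinate_sum:
  fixes h :: "real^'n \<Rightarrow> real"
  assumes p: "\<And>x :: real^'n. p (partial_sums x) = h x"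
    and mono: "nonincreasing_in_each_argument_on (range (partial_sums :: real^'n \<Rightarrow> real list)) p"
    and sym: "symmetric_on UNIV h" and conv: "convex_on UNIV h"
  obtains f where "\<And>x. h x = f (\<Sum>i\<in>UNIV. x $ i)" "convex_on UNIV f" "antimono f"
proof -
  define m :: "real \<Rightarrow> real^'n" where "m t = (\<chi> i. t / CARD('n))" for t
  define f where "f t = h (m t)" for t
  have m: "(\<Sum>i\<in>UNIV. m t $ i) = t" for t by (simp add: m_def)
  note anti = symmetric_convex_antitone_in_coordinate_sum[OF p mono sym conv]
  have "h x = f (\<Sum>i\<in>UNIV. x $ i)" for x
    unfolding f_def by (rule antisym; rule anti) (simp_all add: m)
  moreover have "antimono f" unfolding f_def by (rule antimonoI, rule anti) (simp add: m)
  moreover have "convex_on UNIV f"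
  proof (rule convex_onI)
    fix t a b :: real assume t: "0 < t" "t < 1"
    have "m ((1 - t) *\<^sub>R a + t *\<^sub>R b) = (1 - t) *\<^sub>R m a + t *\<^sub>R m b"
      by (simp add: m_def vec_eq_iff field_simps)
    then show "f ((1 - t) *\<^sub>R a + t *\<^sub>R b) \<le> (1 - t) * f a + t * f b"
      unfolding f_def using convex_onD[OF conv, of t "m a" "m b"] t by simp
  qed simp
  ultimately show ?thesis using that by blast
qed

lemma convex_antimono_comp_ln:
  fixes f :: "real \<Rightarrow> real"
  assumes f: "convex_on UNIV f" "antimono f"
  shows "convex_on {0<..} (\<lambda>d. f (ln d))"
proof (rule convex_onI)
  fix t a b :: real assume t: "0 < t" "t < 1" and ab: "a \<in> {0<..}" "b \<in> {0<..}"
  have "(1 - t) * ln a + t * ln b \<le> ln ((1 - t) *\<^sub>R a + t *\<^sub>R b)"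
    using concave_onD[OF ln_concave, of t a b] t ab by simp
  then have "f (ln ((1 - t) *\<^sub>R a + t *\<^sub>R b)) \<le> f ((1 - t) * ln a + t * ln b)"
    using f(2) by (auto dest: antimonoD)
  also have "\<dots> \<le> (1 - t) * f (ln a) + t * f (ln b)"
    using convex_onD[OF f(1), of t "ln a" "ln b"] t by simp
  finally show "f (ln ((1 - t) *\<^sub>R a + t *\<^sub>R b)) \<le> (1 - t) * f (ln a) + t * f (ln b)" .
qed simp

text \<open>Any two subgradients at different points are ordered, so every choice of them is monotone and
thereby Borel measurable.\<close>

lemma convex_antimono_slope:
  fixes \<psi> :: "real \<Rightarrow> real"
  assumes conv: "convex_on {0<..} \<psi>" and anti: "\<And>a b. 0 < a \<Longrightarrow> a \<le> b \<Longrightarrow> \<psi> b \<le> \<psi> a"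
  obtains s where "\<And>x y. 0 < x \<Longrightarrow> 0 < y \<Longrightarrow> \<psi> y \<ge> \<psi> x + s x * (y - x)"
    "mono_on {0<..} s" "\<And>x. 0 < x \<Longrightarrow> s x \<le> 0"
proof -
  have "\<exists>s. \<forall>x>0. \<forall>y>0. \<psi> y \<ge> \<psi> x + s x * (y - x)"
    using convex_le_Inf_differential[OF conv]
    by (intro exI[of _ "\<lambda>x. Inf ((\<lambda>t. (\<psi> x - \<psi> t) / (x - t)) ` ({x<..} \<inter> {0<..}))"]) (auto simp: interior_open)
  then obtain s where s: "\<And>x y. 0 < x \<Longrightarrow> 0 < y \<Longrightarrow> \<psi> y \<ge> \<psi> x + s x * (y - x)" by blast
  have "mono_on {0<..} s"
  proof (rule mono_onI)
    fix x y :: real assume xy: "x \<in> {0<..}" "y \<in> {0<..}" "x \<le> y"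
    show "s x \<le> s y"
    proof (cases "x = y")
      case False
      have "(s x - s y) * (y - x) \<le> 0"
        using s[of x y] s[of y x] xy by (simp add: algebra_simps)
      then show ?thesis using False xy by (simp add: mult_le_0_iff)
    qed simp
  qed
  moreover have "s x \<le> 0" if "0 < x" for x
    using s[of x "x + 1"] anti[of x "x + 1"] that by simp
  ultimately show ?thesis using s that by blast
qed

section \<open>Existence and product of singular values\<close>

text \<open>The orthogonal complement of a set of eigenvectors is invariant. A maximiser of the quadratic form
on its unit sphere is an eigenvector, as the first variation of the Rayleigh quotient vanishes.\<close>

lemma symmetric_matrix_eigenvector_in_orthogonal_complement:
  fixes A :: "real^'n^'n"
  assumes sym: "transpose A = A"
    and B: "finite B" "card B < CARD('n)" "\<And>b. b \<in> B \<Longrightarrow> \<exists>l. A *v b = l *\<^sub>R b"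
  obtains v l where "norm v = 1" "A *v v = l *\<^sub>R v" "\<And>b. b \<in> B \<Longrightarrow> b \<bullet> v = 0"
proof -
  define V where "V = {x. \<forall>b\<in>B. b \<bullet> x = 0}"
  have sub: "subspace V" unfolding V_def by (auto simp: subspace_def inner_right_distrib)
  have self: "x \<bullet> (A *v y) = (A *v x) \<bullet> y" for x y
    by (metis dot_lmul_matrix sym transpose_matrix_vector)
  have inv: "A *v x \<in> V" if "x \<in> V" for x
    unfolding V_def
  proof (intro CollectI ballI)
    fix b assume "b \<in> B"
    then obtain l where "A *v b = l *\<^sub>R b" using B(3) by blast
    then show "b \<bullet> (A *v x) = 0" using that \<open>b \<in> B\<close> by (simp add: self V_def)
  qed
  have "dim B < DIM(real^'n)"
    using dim_le_card'[OF B(1)] B(2) by simp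
  then obtain z where z: "z \<noteq> 0" "\<And>y. y \<in> span B \<Longrightarrow> orthogonal z y"
    using orthogonal_to_subspace_exists[of B] by (metis)
  then have "z \<in> V" by (auto simp: V_def orthogonal_def inner_commute span_base)
  then have "z /\<^sub>R norm z \<in> V \<inter> sphere 0 1" using z subspace_scale[OF sub] by simp
  then have ne: "V \<inter> sphere 0 1 \<noteq> {}" by blast
  have "closed V" by (rule closed_subspace[OF sub])
  then have "compact (V \<inter> sphere 0 1)" by (simp add: closed_Int_compact)
  moreover have "continuous_on (V \<inter> sphere 0 1) (\<lambda>x. x \<bullet> (A *v x))"
    by (intro continuous_intros linear_continuous_on_compose[OF _ matrix_vector_mul_linear] continuous_on_id)
  ultimately obtain v where v: "v \<in> V" "norm v = 1"
    and max: "\<And>x. x \<in> V \<Longrightarrow> norm x = 1 \<Longrightarrow> x \<bullet> (A *v x) \<le> v \<bullet> (A *v v)"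
    using continuous_attains_sup[OF _ ne, of "\<lambda>x. x \<bullet> (A *v x)"] by (metis IntD1 IntD2 IntI mem_sphere_0)
  define l where "l = v \<bullet> (A *v v)"
  have q: "x \<bullet> (A *v x) \<le> l * (x \<bullet> x)" if "x \<in> V" for x
  proof (cases "x = 0")
    case False
    have "(x /\<^sub>R norm x) \<bullet> (A *v (x /\<^sub>R norm x)) \<le> l"
      unfolding l_def using that False by (intro max subspace_scale[OF sub]) auto
    then show ?thesis using False
      by (simp add: matrix_vector_mult_scaleR field_simps power2_eq_square dot_square_norm)
  qed simp
  \<comment> \<open>the component of \<open>A *v v\<close> orthogonal to \<open>v\<close>; varying \<open>v\<close> in its direction shows that it vanishes\<close>
  define w where "w = A *v v - l *\<^sub>R v"
  have wV: "w \<in> V" unfolding w_def using inv v sub by (intro subspace_diff subspace_scale) auto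
  have vw: "v \<bullet> w = 0" using v by (simp add: w_def inner_diff_right l_def dot_square_norm)
  have vv: "v \<bullet> v = 1" and av: "v \<bullet> (A *v v) = l" using v by (auto simp: l_def dot_square_norm)
  have w1: "w \<bullet> (A *v v) = w \<bullet> w"
    using vw by (simp add: w_def inner_diff_right inner_diff_left inner_commute algebra_simps)
  have tle: "2 * (w \<bullet> w) \<le> t * (l * (w \<bullet> w) - w \<bullet> (A *v w))" if "t > 0" for t
  proof -
    have "v + t *\<^sub>R w \<in> V" using v wV sub by (intro subspace_add subspace_scale) auto
    from q[OF this] have "(v + t *\<^sub>R w) \<bullet> (A *v (v + t *\<^sub>R w)) \<le> l * ((v + t *\<^sub>R w) \<bullet> (v + t *\<^sub>R w))" .
    moreover have "v \<bullet> (A *v w) = w \<bullet> w" using self[of v w] w1 by (metis inner_commute)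
    then have "(v + t *\<^sub>R w) \<bullet> (A *v (v + t *\<^sub>R w)) = l + 2 * t * (w \<bullet> w) + t * t * (w \<bullet> (A *v w))"
      by (simp add: matrix_vector_right_distrib matrix_vector_mult_scaleR inner_add_left inner_add_right
          w1 av distrib_left mult.assoc del: dot_square_norm)
    moreover have "w \<bullet> v = 0" using vw by (simp add: inner_commute)
    then have "(v + t *\<^sub>R w) \<bullet> (v + t *\<^sub>R w) = 1 + t * t * (w \<bullet> w)"
      by (simp add: inner_add_left inner_add_right vv vw del: dot_square_norm)
    ultimately have "l + 2 * t * (w \<bullet> w) + t * t * (w \<bullet> (A *v w)) \<le> l * (1 + t * t * (w \<bullet> w))"
      by simp
    then have "t * (2 * (w \<bullet> w)) \<le> t * (t * (l * (w \<bullet> w) - w \<bullet> (A *v w)))"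
      by (simp add: algebra_simps)
    then show ?thesis using that by simp
  qed
  have "eventually (\<lambda>t. 2 * (w \<bullet> w) \<le> t * (l * (w \<bullet> w) - w \<bullet> (A *v w))) (at_right 0)"
    by (rule eventually_mono[OF eventually_at_right_less]) (rule tle)
  moreover have "((\<lambda>t. t * (l * (w \<bullet> w) - w \<bullet> (A *v w))) \<longlongrightarrow> 0 * (l * (w \<bullet> w) - w \<bullet> (A *v w))) (at_right 0)"
    by (intro tendsto_intros)
  ultimately have "2 * (w \<bullet> w) \<le> 0 * (l * (w \<bullet> w) - w \<bullet> (A *v w))"
    by (intro tendsto_lowerbound) auto
  then have "w \<bullet> w = 0" using inner_ge_zero[of w] by linarith
  then have "w = 0" by simp
  then have "A *v v = l *\<^sub>R v" by (simp add: w_def)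
  then show ?thesis using v that by (auto simp: V_def)
qed

lemma symmetric_matrix_orthonormal_eigenbasis:
  fixes A :: "real^'n^'n"
  assumes sym: "transpose A = A"
  shows "\<exists>b l. (\<forall>i j :: 'n. b i \<bullet> b j = (if i = j then 1 else (0::real))) \<and> (\<forall>i. A *v b i = l i *\<^sub>R b i)"
proof -
  have "\<exists>B. finite B \<and> card B = k \<and> (\<forall>b\<in>B. norm b = 1 \<and> (\<exists>l. A *v b = l *\<^sub>R b)) \<and>
      (\<forall>b\<in>B. \<forall>c\<in>B. b \<noteq> c \<longrightarrow> b \<bullet> c = 0)" if "k \<le> CARD('n)" for k
    using that
  proof (induction k)
    case 0
    show ?case by (rule exI[of _ "{}"]) simp
  next
    case (Suc k)
    then obtain B where B: "finite B" "card B = k" "\<forall>b\<in>B. norm b = 1 \<and> (\<exists>l. A *v b = l *\<^sub>R b)"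
      "\<forall>b\<in>B. \<forall>c\<in>B. b \<noteq> c \<longrightarrow> b \<bullet> c = 0" by auto
    obtain v l where v: "norm v = 1" "A *v v = l *\<^sub>R v" "\<And>b. b \<in> B \<Longrightarrow> b \<bullet> v = 0"
      using symmetric_matrix_eigenvector_in_orthogonal_complement[OF sym B(1)] B Suc.prems by auto
    have "v \<notin> B"
    proof
      assume "v \<in> B"
      then have "v \<bullet> v = 0" by (rule v(3))
      then show False using v(1) by simp
    qed
    then show ?case
      using B v by (intro exI[of _ "insert v B"]) (auto simp: inner_commute)
  qed
  then obtain B where B: "finite B" "card B = CARD('n)" "\<forall>b\<in>B. norm b = 1 \<and> (\<exists>l. A *v b = l *\<^sub>R b)"
      "\<forall>b\<in>B. \<forall>c\<in>B. b \<noteq> c \<longrightarrow> b \<bullet> c = 0" by blast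
  obtain b where b: "bij_betw b (UNIV :: 'n set) B"
    using finite_same_card_bij[of "UNIV :: 'n set" B] B by auto
  have bB: "b i \<in> B" for i using b by (auto simp: bij_betw_def)
  have "b i \<bullet> b j = (if i = j then 1 else 0)" for i j
  proof (cases "i = j")
    case True
    then show ?thesis using B(3) bB[of j] by (simp add: dot_square_norm)
  next
    case False
    then have "b i \<noteq> b j" using b by (auto simp: bij_betw_def dest: injD)
    then show ?thesis using False B(4) bB by simp
  qed
  moreover have "\<forall>i. \<exists>l. A *v b i = l *\<^sub>R b i" using B(3) bB by blast
  then obtain l where "\<And>i. A *v b i = l i *\<^sub>R b i" by metis
  ultimately show ?thesis by blast
qed

lemma matrix_mult_entry_eq_inner:
  fixes N :: "real^'n^'n"
  shows "((\<chi> i. b i) ** N ** transpose (\<chi> i. b i)) $ i $ j = b i \<bullet> (N *v b j)"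
proof -
  have "((\<chi> i. b i) ** N ** transpose (\<chi> i. b i)) $ i $ j = (\<Sum>k\<in>UNIV. (\<Sum>l\<in>UNIV. b i $ l * N $ l $ k) * b j $ k)"
    by (simp add: matrix_matrix_mult_def transpose_def)
  also have "\<dots> = (\<Sum>k\<in>UNIV. \<Sum>l\<in>UNIV. b i $ l * N $ l $ k * b j $ k)"
    by (simp add: sum_distrib_right)
  also have "\<dots> = (\<Sum>l\<in>UNIV. \<Sum>k\<in>UNIV. b i $ l * N $ l $ k * b j $ k)"
    by (rule sum.swap)
  also have "\<dots> = b i \<bullet> (N *v b j)"
    by (simp add: inner_vec_def matrix_vector_mult_def sum_distrib_left mult.assoc)
  finally show ?thesis .
qed

lemma singular_values_exist:
  fixes F :: "real^'n^'n"
  shows "\<exists>s. is_singular_values F s"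
proof -
  let ?A = "transpose F ** F"
  have "transpose ?A = ?A" by (simp add: matrix_transpose_mul)
  then obtain b :: "'n \<Rightarrow> real^'n" and l where b: "\<And>i j. b i \<bullet> b j = (if i = j then 1 else (0::real))"
    and l: "\<And>i. ?A *v b i = l i *\<^sub>R b i"
    using symmetric_matrix_orthonormal_eigenbasis[of ?A] by blast
  have l0: "0 \<le> l i" for i
  proof -
    have "l i = b i \<bullet> (?A *v b i)" using b[of i i] by (simp add: l)
    also have "\<dots> = (F *v b i) \<bullet> (F *v b i)"
      by (subst inner_commute)
        (simp only: transpose_matrix_vector dot_lmul_matrix flip: matrix_vector_mul_assoc)
    finally show ?thesis by simp
  qed
  let ?Q = "\<chi> i. b i"
  have "(?Q ** transpose ?Q) $ i $ j = (if i = j then 1 else 0)" for i j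
    using matrix_mult_entry_eq_inner[of b "mat 1" i j] b[of i j] by simp
  then have "?Q ** transpose ?Q = mat 1" by (simp add: vec_eq_iff mat_def)
  then have Q: "det ?Q * det ?Q = 1" by (metis det_mul det_transpose det_I)
  have "det (mat t - ?A) = (\<Prod>i\<in>UNIV. t - l i)" for t
  proof -
    let ?M = "?Q ** (mat t - ?A) ** transpose ?Q"
    have "mat t *v b j = t *\<^sub>R b j" for j
      by (simp add: vec_eq_iff mat_def matrix_vector_mult_def mult_delta_left)
    then have M: "?M $ i $ j = (if i = j then t - l i else 0)" for i j
      by (simp add: matrix_mult_entry_eq_inner matrix_vector_mult_diff_rdistrib l b inner_diff_right)
    have "det (mat t - ?A) = det ?M" using Q by (simp add: det_mul)
    also have "\<dots> = (\<Prod>i\<in>UNIV. ?M $ i $ i)" by (rule det_diagonal) (simp add: M)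
    finally show ?thesis by (simp add: M)
  qed
  then have "is_singular_values F (\<chi> i. sqrt (l i))" using l0 by (simp add: is_singular_values_def)
  then show ?thesis by blast
qed

text \<open>Evaluating the characteristic polynomial at \<open>0\<close> gives \<open>(det F)\<^sup>2\<close> up to the same sign on both
sides.\<close>

lemma prod_singular_values:
  fixes F :: "real^'n^'n"
  assumes "0 < det F"
  shows "(\<Prod>i\<in>UNIV. singular_values F $ i) = det F" and "0 < singular_values F $ i"
proof -
  let ?s = "singular_values F"
  have s: "is_singular_values F ?s"
    unfolding singular_values_def by (rule someI_ex[OF singular_values_exist])
  then have s0: "0 \<le> ?s $ i" for i by (simp add: is_singular_values_def)
  have "mat 0 - transpose F ** F = mat (-1) ** (transpose F ** F)"
    by (simp add: vec_eq_iff mat_def matrix_matrix_mult_def mult_delta_left sum_negf)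
  moreover have "det (mat (-1) :: real^'n^'n) = (-1) ^ CARD('n)"
    by (subst det_diagonal) (simp_all add: mat_def)
  ultimately have "det (mat 0 - transpose F ** F) = (-1) ^ CARD('n) * (det F)\<^sup>2"
    by (simp add: det_mul power2_eq_square)
  moreover have "det (mat 0 - transpose F ** F) = (\<Prod>i\<in>UNIV. 0 - (?s $ i)\<^sup>2)"
    using s unfolding is_singular_values_def by blast
  moreover have "(\<Prod>i\<in>UNIV. 0 - (?s $ i)\<^sup>2) = (-1) ^ CARD('n) * (\<Prod>i\<in>UNIV. ?s $ i)\<^sup>2"
    by (simp add: prod_uminus prod_power_distrib)
  ultimately have "(det F)\<^sup>2 = (\<Prod>i\<in>UNIV. ?s $ i)\<^sup>2" by simp
  then show p: "(\<Prod>i\<in>UNIV. ?s $ i) = det F"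
    using assms s0 by (metis less_imp_le power2_eq_iff_nonneg prod_nonneg)
  then have "(\<Prod>i\<in>UNIV. ?s $ i) \<noteq> 0" using assms by simp
  then have "?s $ i \<noteq> 0" by (auto simp: prod_zero_iff)
  then show "0 < ?s $ i" using s0 by (simp add: less_le)
qed

section \<open>Rademacher's theorem\<close>

text \<open>The limit of the difference quotients of step \<open>1 / (k + 1)\<close>, cut off at the Lipschitz constant so
that the function is bounded and Borel also where the limit does not exist.\<close>

definition dir_deriv :: "real \<Rightarrow> ('a::real_normed_vector \<Rightarrow> real) \<Rightarrow> 'a \<Rightarrow> 'a \<Rightarrow> real" where
  "dir_deriv L f v x =
     max (- L) (min L (lim (\<lambda>k. (f (x + v /\<^sub>R real (Suc k)) - f x) * real (Suc k))))"

lemma abs_dir_deriv_le: "0 \<le> L \<Longrightarrow> \<bar>dir_deriv L f v x\<bar> \<le> L"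
  by (auto simp: dir_deriv_def)

lemma borel_measurable_dir_deriv:
  fixes f :: "'a::euclidean_space \<Rightarrow> real"
  assumes "continuous_on UNIV f"
  shows "dir_deriv L f v \<in> borel_measurable borel"
proof -
  have [measurable]: "f \<in> borel_measurable borel" by (rule borel_measurable_continuous_onI[OF assms])
  show ?thesis unfolding dir_deriv_def[abs_def] by measurable
qed

lemma dir_deriv_along_line:
  "dir_deriv L (\<lambda>s. f (x + s *\<^sub>R v)) 1 s = dir_deriv L f v (x + s *\<^sub>R v)"
  by (simp add: dir_deriv_def algebra_simps)

lemma has_integral_indicator_iff:
  fixes k :: "'a::euclidean_space \<Rightarrow> real"
  shows "((\<lambda>x. indicator A x *\<^sub>R k x) has_integral I) UNIV \<longleftrightarrow> (k has_integral I) A"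
proof -
  have "(\<lambda>x. indicator A x *\<^sub>R k x) = (\<lambda>x. if x \<in> A then k x else 0)" by auto
  then show ?thesis by (simp only: has_integral_restrict_UNIV)
qed

text \<open>The pushforward of Lebesgue measure under the inverse of \<open>F\<close> maps \<open>A\<close> to the measure of
\<open>F ` A\<close>. It is absolutely continuous because Lipschitz maps preserve null sets, and its
Radon-Nikodym density is the required integrand.\<close>

lemma strictly_expanding_real_has_density:
  fixes F :: "real \<Rightarrow> real"
  assumes M: "0 < M" and low: "\<And>x y. x \<le> y \<Longrightarrow> M * (y - x) \<le> F y - F x"
    and up: "\<And>x y. x \<le> y \<Longrightarrow> F y - F x \<le> K * (y - x)"
  obtains g where "g \<in> borel_measurable borel"
    "\<And>a b. a \<le> b \<Longrightarrow> (g has_integral F b - F a) {a..b}"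
proof -
  have le_iff: "F x \<le> F y \<longleftrightarrow> x \<le> y" for x y
  proof
    assume "F x \<le> F y"
    show "x \<le> y"
    proof (rule ccontr)
      assume "\<not> x \<le> y"
      then have "0 < M * (x - y)" using M by simp
      then show False using low[of y x] \<open>\<not> x \<le> y\<close> \<open>F x \<le> F y\<close> by simp
    qed
  next
    assume "x \<le> y"
    then have "0 \<le> M * (y - x)" using M by simp
    then show "F x \<le> F y" using low[OF \<open>x \<le> y\<close>] by simp
  qed
  have K: "0 \<le> K" using low[of 0 1] up[of 0 1] M by simp
  have lip: "\<bar>F x - F y\<bar> \<le> K * \<bar>x - y\<bar>" for x y
    using up[of x y] up[of y x] le_iff[of x y] le_iff[of y x] by (cases "x \<le> y") auto
  have "K-lipschitz_on UNIV F" using lip K by (auto intro!: lipschitz_onI simp: dist_real_def)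
  then have cont: "continuous_on UNIV F" by (rule lipschitz_on_continuous_on)
  have "\<exists>x. F x = y" for y
  proof -
    define r where "r = \<bar>y - F 0\<bar> / M"
    have r: "0 \<le> r" "M * r = \<bar>y - F 0\<bar>" using M by (auto simp: r_def)
    have "F (- r) \<le> y" "y \<le> F r" using low[of "-r" 0] low[of 0 r] r by auto
    then show ?thesis
      using IVT'[of F "-r" y r] r continuous_on_subset[OF cont] by auto
  qed
  then have "surj F" by (metis surjI)
  define G where "G = inv F"
  have FG: "F (G x) = x" for x unfolding G_def by (rule surj_f_inv_f[OF \<open>surj F\<close>])
  have Gle: "G x \<le> G y \<longleftrightarrow> x \<le> y" for x y using le_iff[of "G x" "G y"] FG by simp
  have "mono G" using Gle by (simp add: mono_def)
  then have [measurable]: "G \<in> borel_measurable borel" by (rule borel_measurable_mono)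
  \<comment> \<open>the measure of the image: \<open>\<nu> A\<close> is the Lebesgue measure of \<open>F ` A\<close>\<close>
  define \<nu> where "\<nu> = distr lborel borel G"
  have em: "emeasure \<nu> A = emeasure lborel (G -` A)" if "A \<in> sets borel" for A
    using that unfolding \<nu>_def by (subst emeasure_distr) auto
  have img: "G -` A = F ` A" for A
  proof (intro equalityI subsetI)
    fix x assume "x \<in> G -` A" then show "x \<in> F ` A" using FG[of x] by (metis image_eqI vimageD)
  next
    fix x assume "x \<in> F ` A"
    then obtain a where a: "a \<in> A" "x = F a" by blast
    have "G (F a) = a" using FG[of "F a"] le_iff by (metis order_antisym order_refl)
    then show "x \<in> G -` A" using a by simp
  qed
  have "absolutely_continuous lborel \<nu>"
    unfolding absolutely_continuous_def
  proof
    fix A :: "real set" assume "A \<in> null_sets lborel"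
    then have A: "A \<in> sets borel" and "negligible A"
      by (auto simp: negligible_iff_null_sets null_sets_completionI)
    have "negligible (F ` A)"
      using lip by (intro negligible_locally_Lipschitz_image[OF _ \<open>negligible A\<close>]) (auto intro!: exI[of _ UNIV])
    then have "negligible (G -` A)" by (simp add: img)
    moreover have "G -` A \<in> sets borel" using A measurable_sets[of G borel borel A] by simp
    ultimately have "emeasure lborel (G -` A) = 0"
      by (auto simp: negligible_iff_null_sets null_sets_def)
    then show "A \<in> null_sets \<nu>" using A by (auto simp: null_sets_def em) (simp add: \<nu>_def)
  qed
  moreover have "sets \<nu> = sets lborel" by (simp add: \<nu>_def)
  ultimately obtain h where h: "h \<in> borel_measurable lborel" "density lborel h = \<nu>"
    using sigma_finite_measure.Radon_Nikodym[OF sigma_finite_lborel] by blast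
  have [measurable]: "h \<in> borel_measurable borel" using h by simp
  have hint: "(\<integral>\<^sup>+x. h x * indicator {a..b} x \<partial>lborel) = ennreal (F b - F a)" if "a \<le> b" for a b
  proof -
    have "(\<integral>\<^sup>+x. h x * indicator {a..b} x \<partial>lborel) = emeasure \<nu> {a..b}"
      unfolding h(2)[symmetric] by (subst emeasure_density) auto
    also have "\<dots> = emeasure lborel {F a..F b}"
    proof -
      have "G -` {a..b} = {F a..F b}"
        using le_iff FG by (auto) (metis FG le_iff)+
      then show ?thesis by (simp add: em)
    qed
    finally show ?thesis using that le_iff by simp
  qed
  have "AE x in lborel. h x \<noteq> \<infinity>"
  proof -
    have "AE x in lborel. h x * indicator {- real n..real n} x \<noteq> \<infinity>" for n
      by (rule nn_integral_PInf_AE) (use hint[of "- real n" "real n"] in auto)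
    then have "AE x in lborel. \<forall>n. h x * indicator {- real n..real n} x \<noteq> \<infinity>" by (simp add: AE_all_countable)
    then show ?thesis
    proof eventually_elim
      case (elim x)
      obtain n where "\<bar>x\<bar> \<le> real n" using real_arch_simple by blast
      then have "x \<in> {- real n..real n}" by auto
      then show ?case using elim[rule_format, of n] by simp
    qed
  qed
  then have fin: "AE x in lborel. ennreal (enn2real (h x)) = h x"
    by eventually_elim (simp add: top.not_eq_extremum)
  show ?thesis
  proof
    show "(\<lambda>x. enn2real (h x)) \<in> borel_measurable borel" by measurable
    fix a b :: real assume ab: "a \<le> b"
    have "(\<integral>\<^sup>+x. ennreal (enn2real (h x) * indicator {a..b} x) \<partial>lborel) = ennreal (F b - F a)"
    proof (subst hint[OF ab, symmetric], rule nn_integral_cong_AE)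
      show "AE x in lborel. ennreal (enn2real (h x) * indicator {a..b} x) = h x * indicator {a..b} x"
        using fin by eventually_elim (auto simp: indicator_def)
    qed
    then have "((\<lambda>x. enn2real (h x) * indicator {a..b} x) has_integral F b - F a) UNIV"
      using ab le_iff by (intro nn_integral_has_integral) auto
    then show "((\<lambda>x. enn2real (h x)) has_integral F b - F a) {a..b}"
      using has_integral_indicator_iff[of "{a..b}" "\<lambda>x. enn2real (h x)"] by (simp add: mult.commute)
  qed
qed

text \<open>Adding \<open>(L + 1) x\<close> makes \<open>f\<close> strictly expanding, so \<open>f\<close> is an indefinite integral. By
Lebesgue's differentiation theorem its difference quotients converge to the integrand almost
everywhere.\<close>

lemma lipschitz_real_eq_integral_dir_deriv:
  fixes f :: "real \<Rightarrow> real"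
  assumes lip: "L-lipschitz_on UNIV f" and ab: "a \<le> b"
  shows "(dir_deriv L f 1 has_integral f b - f a) {a..b}"
proof -
  have L: "0 \<le> L" by (rule lipschitz_on_nonneg[OF lip])
  have fl: "\<bar>f y - f x\<bar> \<le> L * \<bar>y - x\<bar>" for x y
    using lipschitz_onD[OF lip, of y x] by (simp add: dist_real_def)
  let ?F = "\<lambda>x. f x + (L + 1) * x"
  obtain g0 where g0: "\<And>a b. a \<le> b \<Longrightarrow> (g0 has_integral ?F b - ?F a) {a..b}"
  proof (rule strictly_expanding_real_has_density[of 1 ?F "2 * L + 1"])
    show "1 * (y - x) \<le> ?F y - ?F x" "?F y - ?F x \<le> (2 * L + 1) * (y - x)" if "x \<le> y" for x y
      using fl[of y x] that by (auto simp: algebra_simps abs_le_iff)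
  qed auto
  define g where "g x = g0 x - (L + 1)" for x
  have g: "(g has_integral f b - f a) {a..b}" if "a \<le> b" for a b
    using has_integral_diff[OF g0[OF that] has_integral_const_real[of "L + 1" a b]] that
    by (simp add: g_def[abs_def] algebra_simps)
  have "g integrable_on cbox a b" for a b
    using g[of a b] by (cases "a \<le> b") auto
  then obtain N where N: "negligible N"
    and lim: "\<And>x e. x \<notin> N \<Longrightarrow> 0 < e \<Longrightarrow> \<exists>d>0. \<forall>h. 0 < h \<and> h < d \<longrightarrow>
       norm (integral (cbox x (x + h *\<^sub>R One)) g /\<^sub>R h ^ DIM(real) - g x) < e"
    using integrable_ccontinuous_explicit[of g] by metis
  have eq: "dir_deriv L f 1 x = g x" if "x \<notin> N" for x
  proof -
    note xN = that
    let ?q = "\<lambda>k. (f (x + 1 /\<^sub>R real (Suc k)) - f x) * real (Suc k)"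
    have "?q \<longlonglongrightarrow> g x"
    proof (rule LIMSEQ_I)
      fix e :: real assume "0 < e"
      then obtain d where d: "d > 0" "\<And>h. 0 < h \<and> h < d \<Longrightarrow>
         norm (integral (cbox x (x + h *\<^sub>R One)) g /\<^sub>R h ^ DIM(real) - g x) < e"
        using lim[OF xN \<open>0 < e\<close>] by meson
      obtain n0 where n0: "inverse (real (Suc n0)) < d" using reals_Archimedean[OF d(1)] by blast
      have "norm (?q k - g x) < e" if "n0 \<le> k" for k
      proof -
        let ?h = "inverse (real (Suc k))"
        have "?h \<le> inverse (real (Suc n0))" using that by (intro le_imp_inverse_le) auto
        then have "?h < d" using n0 by (rule order.strict_trans1)
        then have h: "0 < ?h \<and> ?h < d" by simp
        have "integral {x..x + ?h} g = f (x + ?h) - f x"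
          by (rule integral_unique[OF g]) simp
        then show ?thesis using d(2)[OF h] by (simp add: mult.commute)
      qed
      then show "\<exists>no. \<forall>n\<ge>no. norm (?q n - g x) < e" by blast
    qed
    moreover have "\<bar>?q k\<bar> \<le> L" for k
    proof -
      have "\<bar>?q k\<bar> = \<bar>f (x + 1 /\<^sub>R real (Suc k)) - f x\<bar> * real (Suc k)" by (simp add: abs_mult)
      also have "\<dots> \<le> (L * \<bar>(x + 1 /\<^sub>R real (Suc k)) - x\<bar>) * real (Suc k)"
        by (rule mult_right_mono[OF fl]) simp
      also have "\<dots> = L" by simp
      finally show ?thesis .
    qed
    ultimately have "\<bar>g x\<bar> \<le> L"
      by (intro tendsto_upperbound[OF tendsto_rabs]) auto
    then show ?thesis using limI[OF \<open>?q \<longlonglongrightarrow> g x\<close>] unfolding dir_deriv_def by simp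
  qed
  show ?thesis
    by (rule has_integral_spike[OF N _ g[OF ab]]) (simp add: eq)
qed


text \<open>The one-dimensional fundamental theorem on the line through \<open>x\<close> in direction \<open>b\<close>. As
\<open>dir_deriv\<close> is defined at every point, this holds on every line and not just on almost all of
them.\<close>

lemma lipschitz_increment_le_nn_integral:
  fixes f :: "'a::euclidean_space \<Rightarrow> real"
  assumes lip: "L-lipschitz_on UNIV f" and b: "b \<in> Basis" and t: "0 \<le> t"
  shows "ennreal \<bar>f (x + t *\<^sub>R b) - f x - c * t\<bar>
    \<le> (\<integral>\<^sup>+s. ennreal \<bar>dir_deriv L f b (x + s *\<^sub>R b) - c\<bar> * indicator {0..t} s \<partial>lborel)"
proof -
  have L: "0 \<le> L" by (rule lipschitz_on_nonneg[OF lip])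
  let ?k = "\<lambda>s. dir_deriv L f b (x + s *\<^sub>R b) - c"
  have [measurable]: "dir_deriv L f b \<in> borel_measurable borel"
    by (intro borel_measurable_dir_deriv lipschitz_on_continuous_on[OF lip])
  have "L-lipschitz_on UNIV (\<lambda>s. f (x + s *\<^sub>R b))"
  proof (rule lipschitz_onI)
    fix s s' :: real
    have "dist (f (x + s *\<^sub>R b)) (f (x + s' *\<^sub>R b)) \<le> L * dist (x + s *\<^sub>R b) (x + s' *\<^sub>R b)"
      by (rule lipschitz_onD[OF lip]) auto
    also have "dist (x + s *\<^sub>R b) (x + s' *\<^sub>R b) = dist s s'"
      using b by (simp add: dist_norm flip: scaleR_diff_left)
    finally show "dist (f (x + s *\<^sub>R b)) (f (x + s' *\<^sub>R b)) \<le> L * dist s s'" .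
  qed (rule L)
  from lipschitz_real_eq_integral_dir_deriv[OF this t]
  have "((\<lambda>s. dir_deriv L f b (x + s *\<^sub>R b)) has_integral f (x + t *\<^sub>R b) - f x) {0..t}"
    by (subst (asm) has_integral_cong[OF dir_deriv_along_line]) simp
  from has_integral_diff[OF this has_integral_const_real[of c 0 t]]
  have "(?k has_integral f (x + t *\<^sub>R b) - f x - c * t) {0..t}" using t by (simp add: mult.commute)
  then have 1: "((\<lambda>s. indicator {0..t} s *\<^sub>R ?k s) has_integral f (x + t *\<^sub>R b) - f x - c * t) UNIV"
    by (simp only: has_integral_indicator_iff)
  have int: "integrable lborel (\<lambda>s. indicator {0..t} s *\<^sub>R ?k s)"
  proof (rule integrableI_bounded_set_indicator[where B = "L + \<bar>c\<bar>"])
    show "AE s in lborel. s \<in> {0..t} \<longrightarrow> norm (?k s) \<le> L + \<bar>c\<bar>"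
    proof (intro AE_I2 impI)
      fix s
      show "norm (?k s) \<le> L + \<bar>c\<bar>"
        using abs_dir_deriv_le[OF L, of f b "x + s *\<^sub>R b"] by (simp add: abs_le_iff) linarith
    qed
  qed (use t in auto)
  have "integral\<^sup>L lborel (\<lambda>s. indicator {0..t} s *\<^sub>R ?k s) = f (x + t *\<^sub>R b) - f x - c * t"
    by (rule has_integral_unique[OF has_integral_integral_lborel[OF int] 1])
  then have "ennreal \<bar>f (x + t *\<^sub>R b) - f x - c * t\<bar> \<le> (\<integral>\<^sup>+s. norm (indicator {0..t} s *\<^sub>R ?k s) \<partial>lborel)"
    using integral_norm_bound_ennreal[OF int] by simp
  also have "\<dots> = (\<integral>\<^sup>+s. ennreal \<bar>?k s\<bar> * indicator {0..t} s \<partial>lborel)"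
    by (intro nn_integral_cong) (auto simp: indicator_def)
  finally show ?thesis .
qed

abbreviation cube :: "'a::euclidean_space \<Rightarrow> real \<Rightarrow> 'a set" where
  "cube x h \<equiv> cbox (x - h *\<^sub>R One) (x + h *\<^sub>R One)"

abbreviation lebesgue_point :: "('a::euclidean_space \<Rightarrow> real) \<Rightarrow> 'a \<Rightarrow> bool" where
  "lebesgue_point g x \<equiv> \<forall>e>0. \<exists>d>0. \<forall>h. 0 < h \<and> h < d \<longrightarrow>
     (\<integral>\<^sup>+y. ennreal \<bar>g y - g x\<bar> * indicator (cube x h) y \<partial>lborel) \<le> ennreal (e * h ^ DIM('a))"

text \<open>Lebesgue's differentiation theorem for the cubes that have \<open>x\<close> as their lowest corner.\<close>

lemma bounded_borel_corner_cube_average: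
  fixes k :: "'a::euclidean_space \<Rightarrow> real"
  assumes [measurable]: "k \<in> borel_measurable borel" and k0: "\<And>x. 0 \<le> k x" and kB: "\<And>x. k x \<le> B"
  shows "AE x in lborel. \<forall>e>0. \<exists>d>0. \<forall>h. 0 < h \<and> h < d \<longrightarrow>
     (\<integral>\<^sup>+y. ennreal (k y) * indicator (cbox x (x + h *\<^sub>R One)) y \<partial>lborel) \<le> ennreal ((k x + e) * h ^ DIM('a))"
proof -
  have int: "set_integrable lborel (cbox a b) k" for a b
    unfolding set_integrable_def
    by (rule integrableI_bounded_set_indicator[where B = B])
       (use k0 kB in \<open>auto simp: emeasure_lborel_cbox_eq\<close>)
  have "k integrable_on cbox a b" for a b
    by (rule set_borel_integral_eq_integral(1)[OF int])
  then obtain N where N: "negligible N"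
    and lim: "\<And>x e. x \<notin> N \<Longrightarrow> 0 < e \<Longrightarrow> \<exists>d>0. \<forall>h. 0 < h \<and> h < d \<longrightarrow>
       norm (integral (cbox x (x + h *\<^sub>R One)) k /\<^sub>R h ^ DIM('a) - k x) < e"
    using integrable_ccontinuous_explicit[of k] by metis
  have nn: "(\<integral>\<^sup>+y. ennreal (k y) * indicator (cbox a b) y \<partial>lborel) = ennreal (integral (cbox a b) k)" for a b
  proof -
    have "(\<integral>\<^sup>+y. ennreal (k y) * indicator (cbox a b) y \<partial>lborel) = (\<integral>\<^sup>+y. ennreal (indicator (cbox a b) y *\<^sub>R k y) \<partial>lborel)"
      by (intro nn_integral_cong) (auto simp: indicator_def)
    also have "\<dots> = ennreal (LINT y:cbox a b|lborel. k y)"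
      unfolding set_lebesgue_integral_def
      by (rule nn_integral_eq_integral) (use int k0 in \<open>auto simp: set_integrable_def\<close>)
    finally show ?thesis by (simp add: set_borel_integral_eq_integral(2)[OF int])
  qed
  have "AE x in lebesgue. x \<notin> N" using N by (simp add: negligible_iff_null_sets AE_not_in)
  then have "AE x in lborel. x \<notin> N" by (simp add: AE_completion_iff)
  then show ?thesis
  proof eventually_elim
    case (elim x)
    show ?case
    proof (intro allI impI)
      fix e :: real assume "0 < e"
      from lim[OF elim this] obtain d where d: "d > 0" "\<forall>h. 0 < h \<and> h < d \<longrightarrow>
         norm (integral (cbox x (x + h *\<^sub>R One)) k /\<^sub>R h ^ DIM('a) - k x) < e" by blast
      show "\<exists>d>0. \<forall>h. 0 < h \<and> h < d \<longrightarrow>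
        (\<integral>\<^sup>+y. ennreal (k y) * indicator (cbox x (x + h *\<^sub>R One)) y \<partial>lborel) \<le> ennreal ((k x + e) * h ^ DIM('a))"
      proof (intro exI[of _ d] conjI allI impI d(1))
        fix h assume h: "0 < h \<and> h < d"
        then have "integral (cbox x (x + h *\<^sub>R One)) k /\<^sub>R h ^ DIM('a) < k x + e"
          using d(2)[rule_format, OF h] by (simp add: abs_less_iff)
        then have "integral (cbox x (x + h *\<^sub>R One)) k \<le> (k x + e) * h ^ DIM('a)"
          using h by (simp add: field_simps)
        then show "(\<integral>\<^sup>+y. ennreal (k y) * indicator (cbox x (x + h *\<^sub>R One)) y \<partial>lborel) \<le> ennreal ((k x + e) * h ^ DIM('a))"
          unfolding nn by (rule ennreal_leI)
      qed
    qed
  qed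
qed


lemma finite_positive_lower_bound:
  assumes "finite S" and "\<And>x. x \<in> S \<Longrightarrow> 0 < (d x :: real)"
  shows "\<exists>d0>0. \<forall>x\<in>S. d0 \<le> d x"
  using assms
proof (induction S)
  case (insert x S)
  then obtain d0 where "d0 > 0" "\<forall>y\<in>S. d0 \<le> d y" by auto
  then show ?case using insert.prems by (intro exI[of _ "min d0 (d x)"]) auto
qed (auto intro: exI[of _ 1])

text \<open>Reflections in coordinate hyperplanes turn the \<open>2\<^sup>n\<close> orthants at a point into the positive
one, and so carry the differentiation theorem from corner cubes over to centered cubes.\<close>

definition flip :: "('a \<Rightarrow> real) \<Rightarrow> 'a::euclidean_space \<Rightarrow> 'a" where
  "flip \<sigma> x = (\<Sum>j\<in>Basis. (\<sigma> j * (x \<bullet> j)) *\<^sub>R j)"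

definition signs :: "('a::euclidean_space \<Rightarrow> real) set" where
  "signs = Basis \<rightarrow>\<^sub>E {1, -1}"

lemma finite_signs: "finite (signs :: ('a::euclidean_space \<Rightarrow> real) set)"
  by (simp add: signs_def finite_PiE)

lemma card_signs: "card (signs :: ('a::euclidean_space \<Rightarrow> real) set) = 2 ^ DIM('a)"
  by (simp add: signs_def card_PiE numeral_2_eq_2)

lemma flip_inner: "j \<in> Basis \<Longrightarrow> flip \<sigma> x \<bullet> j = \<sigma> j * (x \<bullet> j)"
  by (simp add: flip_def inner_sum_left_Basis)

lemma signs_square: "\<sigma> \<in> signs \<Longrightarrow> j \<in> Basis \<Longrightarrow> \<sigma> j * \<sigma> j = 1"
  by (auto simp: signs_def PiE_iff)

lemma flip_flip: "\<sigma> \<in> signs \<Longrightarrow> flip \<sigma> (flip \<sigma> x) = x"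
  by (rule euclidean_eqI) (simp add: flip_inner signs_square flip: mult.assoc)

lemma borel_measurable_flip [measurable]: "flip \<sigma> \<in> borel \<rightarrow>\<^sub>M borel"
  unfolding flip_def by measurable

lemma lborel_distr_flip:
  assumes "\<sigma> \<in> signs"
  shows "distr lborel borel (flip \<sigma>) = (lborel :: 'a::euclidean_space measure)"
proof -
  have *: "\<sigma> j \<noteq> 0" "\<bar>\<sigma> j\<bar> = 1" if "j \<in> Basis" for j
    using signs_square[OF assms that] by (auto simp: square_eq_1_iff)
  show ?thesis
    using lborel_affine_euclidean[of \<sigma> 0] * by (simp add: flip_def[abs_def] density_1)
qed

lemma bounded_borel_centered_cube_average:
  fixes k :: "'a::euclidean_space \<Rightarrow> real"
  assumes [measurable]: "k \<in> borel_measurable borel" and k0: "\<And>x. 0 \<le> k x" and kB: "\<And>x. k x \<le> B"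
  shows "AE x in lborel. \<forall>e>0. \<exists>d>0. \<forall>h. 0 < h \<and> h < d \<longrightarrow>
     (\<integral>\<^sup>+y. ennreal (k y) * indicator (cube x h) y \<partial>lborel)
       \<le> ennreal (2 ^ DIM('a) * ((k x + e) * h ^ DIM('a)))"
proof -
  let ?i = "\<lambda>\<sigma> x h y. indicator (cbox (flip \<sigma> x) (flip \<sigma> x + h *\<^sub>R One)) (flip \<sigma> y) :: ennreal"
  let ?P = "\<lambda>\<sigma> x e h. (\<integral>\<^sup>+y. ennreal (k y) * ?i \<sigma> x h y \<partial>lborel)
     \<le> ennreal ((k x + e) * h ^ DIM('a))"
  have "AE x in lborel. \<forall>e>0. \<exists>d>0. \<forall>h. 0 < h \<and> h < d \<longrightarrow> ?P \<sigma> x e h" if \<sigma>: "\<sigma> \<in> signs" for \<sigma>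
  proof -
    let ?A = "\<lambda>x. \<forall>e>0. \<exists>d>0. \<forall>h. 0 < h \<and> h < d \<longrightarrow>
       (\<integral>\<^sup>+y. ennreal (k (flip \<sigma> y)) * indicator (cbox x (x + h *\<^sub>R One)) y \<partial>lborel) \<le> ennreal ((k (flip \<sigma> x) + e) * h ^ DIM('a))"
    have "AE x in lborel. ?A x"
      by (rule bounded_borel_corner_cube_average[where B = B]) (use k0 kB in auto)
    then have "AE x in distr lborel borel (flip \<sigma>). ?A x"
      by (simp only: lborel_distr_flip[OF \<sigma>])
    from AE_distrD[OF _ this] have "AE x in lborel. \<forall>e>0. \<exists>d>0. \<forall>h. 0 < h \<and> h < d \<longrightarrow>
       (\<integral>\<^sup>+y. ennreal (k (flip \<sigma> y)) * indicator (cbox (flip \<sigma> x) (flip \<sigma> x + h *\<^sub>R One)) y \<partial>lborel)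
         \<le> ennreal ((k x + e) * h ^ DIM('a))"
      by (simp add: flip_flip[OF \<sigma>])
    moreover have "(\<integral>\<^sup>+y. ennreal (k (flip \<sigma> y)) * indicator (cbox (flip \<sigma> x) (flip \<sigma> x + h *\<^sub>R One)) y \<partial>lborel)
       = (\<integral>\<^sup>+y. ennreal (k y) * ?i \<sigma> x h y \<partial>lborel)" for x h
      by (subst lborel_distr_flip[OF \<sigma>, symmetric], subst nn_integral_distr) (simp_all add: flip_flip[OF \<sigma>])
    ultimately show ?thesis by simp
  qed
  then have "AE x in lborel. \<forall>\<sigma>\<in>signs. \<forall>e>0. \<exists>d>0. \<forall>h. 0 < h \<and> h < d \<longrightarrow> ?P \<sigma> x e h"
    by (intro AE_finite_allI finite_signs)
  then show ?thesis
  proof eventually_elim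
    case (elim x)
    show ?case
    proof (intro allI impI)
      fix e :: real assume e: "0 < e"
      then have "\<forall>\<sigma>\<in>signs. \<exists>d>0. \<forall>h. 0 < h \<and> h < d \<longrightarrow> ?P \<sigma> x e h" using elim by blast
      from bchoice[OF this] obtain d where
        d': "\<forall>\<sigma>\<in>signs. 0 < d \<sigma> \<and> (\<forall>h. 0 < h \<and> h < d \<sigma> \<longrightarrow> ?P \<sigma> x e h)" ..
      note d = d'[rule_format, THEN conjunct1] d'[rule_format, THEN conjunct2, rule_format]
      obtain d0 where d0: "d0 > 0" "\<And>\<sigma>. \<sigma> \<in> signs \<Longrightarrow> d0 \<le> d \<sigma>"
        using finite_positive_lower_bound[OF finite_signs, of d] d(1) by blast
      show "\<exists>d>0. \<forall>h. 0 < h \<and> h < d \<longrightarrow>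
        (\<integral>\<^sup>+y. ennreal (k y) * indicator (cube x h) y \<partial>lborel)
          \<le> ennreal (2 ^ DIM('a) * ((k x + e) * h ^ DIM('a)))"
      proof (intro exI[of _ d0] conjI allI impI d0(1))
        fix h assume h: "0 < h \<and> h < d0"
        have "(\<integral>\<^sup>+y. ennreal (k y) * indicator (cube x h) y \<partial>lborel)
          \<le> (\<integral>\<^sup>+y. (\<Sum>\<sigma>\<in>signs. ennreal (k y) * ?i \<sigma> x h y) \<partial>lborel)"
        proof (intro nn_integral_mono)
          fix y :: 'a
          show "ennreal (k y) * indicator (cube x h) y
            \<le> (\<Sum>\<sigma>\<in>signs. ennreal (k y) * ?i \<sigma> x h y)"
          proof (cases "y \<in> cube x h")
            case True
            define \<sigma> where "\<sigma> = (\<lambda>j\<in>Basis. if x \<bullet> j \<le> y \<bullet> j then 1 else (-1::real))"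
            have \<sigma>: "\<sigma> \<in> signs" by (auto simp: \<sigma>_def signs_def)
            have in_box: "flip \<sigma> y \<in> cbox (flip \<sigma> x) (flip \<sigma> x + h *\<^sub>R One)"
              using True by (auto simp: mem_box flip_inner inner_add_left inner_diff_left \<sigma>_def)
            then have "ennreal (k y) * indicator (cube x h) y
              = ennreal (k y) * ?i \<sigma> x h y"
              using True by simp
            also have "\<dots> \<le> (\<Sum>\<sigma>\<in>signs. ennreal (k y) * ?i \<sigma> x h y)"
              by (rule member_le_sum[OF \<sigma> _ finite_signs]) simp
            finally show ?thesis .
          qed simp
        qed
        also have "\<dots> = (\<Sum>\<sigma>\<in>signs. (\<integral>\<^sup>+y. ennreal (k y) * ?i \<sigma> x h y \<partial>lborel))"
          by (rule nn_integral_sum) measurable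
        also have "\<dots> \<le> (\<Sum>\<sigma>\<in>(signs :: ('a \<Rightarrow> real) set). ennreal ((k x + e) * h ^ DIM('a)))"
        proof (rule sum_mono)
          fix \<sigma> :: "'a \<Rightarrow> real" assume "\<sigma> \<in> signs"
          then show "?P \<sigma> x e h" using h d0(2) by (intro d(2)) (auto intro: order.strict_trans2)
        qed
        also have "\<dots> = ennreal (2 ^ DIM('a) * ((k x + e) * h ^ DIM('a)))"
          by (simp only: sum_constant card_signs ennreal_of_nat_eq_real_of_nat of_nat_power of_nat_numeral)
            (rule ennreal_mult'[symmetric], simp)
        finally show "(\<integral>\<^sup>+y. ennreal (k y) * indicator (cube x h) y \<partial>lborel)
          \<le> ennreal (2 ^ DIM('a) * ((k x + e) * h ^ DIM('a)))" .
      qed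
    qed
  qed
qed

text \<open>Averages of \<open>\<bar>g - q\<bar>\<close> converge almost everywhere for all rational \<open>q\<close> at once, and \<open>g x\<close> can
be approximated by such \<open>q\<close>.\<close>

lemma bounded_borel_lebesgue_point:
  fixes g :: "'a::euclidean_space \<Rightarrow> real"
  assumes [measurable]: "g \<in> borel_measurable borel" and gB: "\<And>x. \<bar>g x\<bar> \<le> B"
  shows "AE x in lborel. lebesgue_point g x"
proof -
  have "AE x in lborel. \<forall>e>0. \<exists>d>0. \<forall>h. 0 < h \<and> h < d \<longrightarrow>
     (\<integral>\<^sup>+y. ennreal \<bar>g y - q\<bar> * indicator (cube x h) y \<partial>lborel)
       \<le> ennreal (2 ^ DIM('a) * ((\<bar>g x - q\<bar> + e) * h ^ DIM('a)))" for q :: real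
  proof (rule bounded_borel_centered_cube_average[where B = "B + \<bar>q\<bar>"])
    show "\<bar>g x - q\<bar> \<le> B + \<bar>q\<bar>" for x using gB[of x] by linarith
  qed auto
  then have "AE x in lborel. \<forall>q\<in>\<rat>. \<forall>e>0. \<exists>d>0. \<forall>h. 0 < h \<and> h < d \<longrightarrow>
     (\<integral>\<^sup>+y. ennreal \<bar>g y - q\<bar> * indicator (cube x h) y \<partial>lborel)
       \<le> ennreal (2 ^ DIM('a) * ((\<bar>g x - q\<bar> + e) * h ^ DIM('a)))"
    by (subst AE_ball_countable) (auto simp: countable_rat)
  then show ?thesis
  proof eventually_elim
    case (elim x)
    show ?case
    proof (intro allI impI)
      fix e0 :: real assume e0: "0 < e0"
      define e where "e = e0 / (3 * 2 ^ DIM('a))"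
      have e: "0 < e" "3 * 2 ^ DIM('a) * e = e0" using e0 by (auto simp: e_def)
      obtain q where q: "q \<in> \<rat>" "\<bar>g x - q\<bar> < e"
      proof -
        obtain r where "g x < of_rat r" "of_rat r < g x + e" using of_rat_dense[of "g x" "g x + e"] e by auto
        then show ?thesis using that[of "of_rat r"] by (auto simp: Rats_def)
      qed
      obtain d where d: "d > 0" and dh: "\<And>h. 0 < h \<and> h < d \<Longrightarrow>
        (\<integral>\<^sup>+y. ennreal \<bar>g y - q\<bar> * indicator (cube x h) y \<partial>lborel)
          \<le> ennreal (2 ^ DIM('a) * ((\<bar>g x - q\<bar> + e) * h ^ DIM('a)))"
        using elim[rule_format, OF q(1) e(1)] by blast
      show "\<exists>d>0. \<forall>h. 0 < h \<and> h < d \<longrightarrow>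
        (\<integral>\<^sup>+y. ennreal \<bar>g y - g x\<bar> * indicator (cube x h) y \<partial>lborel)
          \<le> ennreal (e0 * h ^ DIM('a))"
      proof (intro exI[of _ d] conjI allI impI d)
        fix h assume h: "0 < h \<and> h < d"
        let ?Q = "cube x h"
        have vol: "emeasure lborel ?Q = ennreal ((2 * h) ^ DIM('a))"
          using h by (simp add: emeasure_lborel_cbox_eq inner_add_left inner_diff_left prod_constant)
        have "(\<integral>\<^sup>+y. ennreal \<bar>g y - g x\<bar> * indicator ?Q y \<partial>lborel)
          \<le> (\<integral>\<^sup>+y. ennreal \<bar>g y - q\<bar> * indicator ?Q y + ennreal \<bar>g x - q\<bar> * indicator ?Q y \<partial>lborel)"
        proof (intro nn_integral_mono)
          fix y
          have "ennreal \<bar>g y - g x\<bar> \<le> ennreal (\<bar>g y - q\<bar> + \<bar>g x - q\<bar>)" by (intro ennreal_leI) linarith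
          then show "ennreal \<bar>g y - g x\<bar> * indicator ?Q y \<le> ennreal \<bar>g y - q\<bar> * indicator ?Q y + ennreal \<bar>g x - q\<bar> * indicator ?Q y"
            by (simp add: indicator_def)
        qed
        also have "\<dots> = (\<integral>\<^sup>+y. ennreal \<bar>g y - q\<bar> * indicator ?Q y \<partial>lborel) + (\<integral>\<^sup>+y. ennreal \<bar>g x - q\<bar> * indicator ?Q y \<partial>lborel)"
          by (rule nn_integral_add) measurable
        also have "(\<integral>\<^sup>+y. ennreal \<bar>g x - q\<bar> * indicator ?Q y \<partial>lborel) = ennreal (\<bar>g x - q\<bar> * (2 * h) ^ DIM('a))"
          using h by (subst nn_integral_cmult_indicator) (simp_all add: vol ennreal_mult)
        also have "(\<integral>\<^sup>+y. ennreal \<bar>g y - q\<bar> * indicator ?Q y \<partial>lborel) + ennreal (\<bar>g x - q\<bar> * (2 * h) ^ DIM('a))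
          \<le> ennreal (2 ^ DIM('a) * ((\<bar>g x - q\<bar> + e) * h ^ DIM('a))) + ennreal (\<bar>g x - q\<bar> * (2 * h) ^ DIM('a))"
          by (intro add_right_mono dh[OF h])
        also have "\<dots> = ennreal (2 ^ DIM('a) * ((\<bar>g x - q\<bar> + e) * h ^ DIM('a)) + \<bar>g x - q\<bar> * (2 * h) ^ DIM('a))"
          using h e by (intro ennreal_plus[symmetric]) auto
        also have "\<dots> \<le> ennreal (e0 * h ^ DIM('a))"
        proof (rule ennreal_leI)
          have "2 ^ DIM('a) * ((\<bar>g x - q\<bar> + e) * h ^ DIM('a)) + \<bar>g x - q\<bar> * (2 * h) ^ DIM('a)
            = (2 ^ DIM('a) * (2 * \<bar>g x - q\<bar> + e)) * h ^ DIM('a)" by (simp add: power_mult_distrib algebra_simps)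
          also have "\<dots> \<le> (2 ^ DIM('a) * (3 * e)) * h ^ DIM('a)"
            using h q by (intro mult_right_mono mult_left_mono) auto
          also have "\<dots> = e0 * h ^ DIM('a)" using e by (simp add: algebra_simps)
          finally show "2 ^ DIM('a) * ((\<bar>g x - q\<bar> + e) * h ^ DIM('a)) + \<bar>g x - q\<bar> * (2 * h) ^ DIM('a) \<le> e0 * h ^ DIM('a)" .
        qed
        finally show "(\<integral>\<^sup>+y. ennreal \<bar>g y - g x\<bar> * indicator ?Q y \<partial>lborel) \<le> ennreal (e0 * h ^ DIM('a))" .
      qed
    qed
  qed
qed


text \<open>Fubini: averaged over a cube of starting points, the error in a step of length \<open>t\<close> along an axis
is controlled by the oscillation of the partial derivative on a cube that contains all the paths.\<close>

lemma lipschitz_shift_average_le: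
  fixes f :: "'a::euclidean_space \<Rightarrow> real"
  assumes lip: "L-lipschitz_on UNIV f" and b: "b \<in> Basis" and r: "0 < r" and t: "\<bar>t\<bar> \<le> r"
    and \<rho>: "0 \<le> \<rho>" "\<rho> \<le> r" and w: "\<And>j. j \<in> Basis \<Longrightarrow> \<bar>w \<bullet> j\<bar> \<le> r" "w \<bullet> b = 0"
    and I: "(\<integral>\<^sup>+y. ennreal \<bar>dir_deriv L f b y - c\<bar> * indicator (cube x (2 * r)) y \<partial>lborel) \<le> ennreal I"
    and I0: "0 \<le> I"
  shows "(\<integral>\<^sup>+z. ennreal \<bar>f (z + (w + t *\<^sub>R b)) - f (z + w) - c * t\<bar> * indicator (cbox x (x + \<rho> *\<^sub>R One)) z \<partial>lborel) \<le> ennreal (r * I)"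
proof -
  have [measurable]: "dir_deriv L f b \<in> borel_measurable borel"
    by (intro borel_measurable_dir_deriv lipschitz_on_continuous_on[OF lip])
  have [measurable]: "f \<in> borel_measurable borel"
    by (intro borel_measurable_continuous_onI lipschitz_on_continuous_on[OF lip])
  let ?Z = "cbox x (x + \<rho> *\<^sub>R One)" and ?G = "\<lambda>y. ennreal \<bar>dir_deriv L f b y - c\<bar>"
  let ?Q = "cube x (2 * r)"
  let ?u = "\<lambda>s. w + (min t 0 + s) *\<^sub>R b"
  have point: "ennreal \<bar>f (z + (w + t *\<^sub>R b)) - f (z + w) - c * t\<bar>
     \<le> (\<integral>\<^sup>+s. ?G (z + ?u s) * indicator {0..\<bar>t\<bar>} s \<partial>lborel)" for z
  proof -
    have "\<bar>f (z + (w + t *\<^sub>R b)) - f (z + w) - c * t\<bar>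
      = \<bar>f ((z + w + min t 0 *\<^sub>R b) + \<bar>t\<bar> *\<^sub>R b) - f (z + w + min t 0 *\<^sub>R b) - c * \<bar>t\<bar>\<bar>"
      by (cases "0 \<le> t") (auto simp: add.assoc min_def abs_if)
    then show ?thesis
      using lipschitz_increment_le_nn_integral[OF lip b, of "\<bar>t\<bar>" "z + w + min t 0 *\<^sub>R b" c]
      by (simp add: algebra_simps)
  qed
  have shift: "(\<integral>\<^sup>+z. ?G (z + ?u s) * indicator ?Z z \<partial>lborel) \<le> ennreal I" if s: "s \<in> {0..\<bar>t\<bar>}" for s
  proof -
    have u: "\<bar>?u s \<bullet> j\<bar> \<le> r" if "j \<in> Basis" for j
      using w that b s t by (cases "j = b") (auto simp: inner_add_left inner_not_same_Basis min_def split: if_splits)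
    have "(\<integral>\<^sup>+z. ?G (z + ?u s) * indicator ?Z z \<partial>lborel) \<le> (\<integral>\<^sup>+z. ?G (?u s + z) * indicator ?Q (?u s + z) \<partial>lborel)"
    proof (intro nn_integral_mono)
      fix z
      have "?u s + z \<in> ?Q" if "z \<in> ?Z"
        unfolding mem_box
      proof
        fix j :: 'a assume j: "j \<in> Basis"
        then have "x \<bullet> j \<le> z \<bullet> j" "z \<bullet> j \<le> x \<bullet> j + \<rho>" using that by (auto simp: mem_box inner_add_left)
        then show "(x - (2 * r) *\<^sub>R One) \<bullet> j \<le> (?u s + z) \<bullet> j \<and> (?u s + z) \<bullet> j \<le> (x + (2 * r) *\<^sub>R One) \<bullet> j"
          using u[OF j] \<rho> r j by (simp add: inner_add_left[of "?u s"] inner_add_left[of x] inner_diff_left del: inner_add_left) linarith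
      qed
      then show "?G (z + ?u s) * indicator ?Z z \<le> ?G (?u s + z) * indicator ?Q (?u s + z)"
        by (auto simp: indicator_def add.commute)
    qed
    also have "\<dots> = (\<integral>\<^sup>+y. ?G y * indicator ?Q y \<partial>distr lborel borel ((+) (?u s)))"
      by (subst nn_integral_distr) auto
    also have "\<dots> = (\<integral>\<^sup>+y. ?G y * indicator ?Q y \<partial>lborel)" by (simp only: lborel_distr_plus)
    finally show ?thesis using I by (rule order_trans)
  qed
  have "(\<integral>\<^sup>+z. ennreal \<bar>f (z + (w + t *\<^sub>R b)) - f (z + w) - c * t\<bar> * indicator ?Z z \<partial>lborel)
     \<le> (\<integral>\<^sup>+z. (\<integral>\<^sup>+s. ?G (z + ?u s) * indicator {0..\<bar>t\<bar>} s \<partial>lborel) * indicator ?Z z \<partial>lborel)"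
    by (intro nn_integral_mono mult_right_mono point) simp
  also have "\<dots> = (\<integral>\<^sup>+z. (\<integral>\<^sup>+s. ?G (z + ?u s) * indicator {0..\<bar>t\<bar>} s * indicator ?Z z \<partial>lborel) \<partial>lborel)"
    by (intro nn_integral_cong, subst nn_integral_multc) auto
  also have "\<dots> = (\<integral>\<^sup>+s. (\<integral>\<^sup>+z. ?G (z + ?u s) * indicator {0..\<bar>t\<bar>} s * indicator ?Z z \<partial>lborel) \<partial>lborel)"
    by (rule lborel_pair.Fubini') measurable
  also have "\<dots> \<le> (\<integral>\<^sup>+s. ennreal I * indicator {0..\<bar>t\<bar>} s \<partial>lborel)"
  proof (intro nn_integral_mono)
    fix s :: real
    show "(\<integral>\<^sup>+z. ?G (z + ?u s) * indicator {0..\<bar>t\<bar>} s * indicator ?Z z \<partial>lborel) \<le> ennreal I * indicator {0..\<bar>t\<bar>} s"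
      using shift[of s] by (cases "s \<in> {0..\<bar>t\<bar>}") auto
  qed
  also have "\<dots> = ennreal I * ennreal \<bar>t\<bar>" by (subst nn_integral_cmult_indicator) auto
  also have "\<dots> \<le> ennreal (r * I)"
    using t I0 by (simp add: ennreal_mult'[symmetric] mult.commute[of I] mult_right_mono ennreal_leI)
  finally show ?thesis .
qed

text \<open>Let \<open>e\<close> be \<open>f\<close> minus its candidate linear approximation. Going from \<open>x\<close> to \<open>y\<close> along
the axes, the average of \<open>e (z + (y - x)) - e z\<close> over \<open>z\<close> in a cube of side \<open>\<kappa> * norm (y - x)\<close> at
\<open>x\<close> is small by the Lebesgue point property. Replacing \<open>z\<close> by \<open>x\<close> costs at most a multiple of
\<open>\<kappa> * norm (y - x)\<close>, as \<open>e\<close> is Lipschitz.\<close>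

lemma lipschitz_differentiable_at_lebesgue_point:
  fixes f :: "'a::euclidean_space \<Rightarrow> real"
  assumes lip: "L-lipschitz_on UNIV f"
    and leb: "\<And>b. b \<in> Basis \<Longrightarrow> lebesgue_point (dir_deriv L f b) x"
  shows "(f has_derivative (\<lambda>v. \<Sum>b\<in>Basis. dir_deriv L f b x * (v \<bullet> b))) (at x)"
proof -
  let ?n = "DIM('a)"
  let ?D = "\<lambda>v. \<Sum>b\<in>Basis. dir_deriv L f b x * (v \<bullet> b)"
  have L: "0 \<le> L" by (rule lipschitz_on_nonneg[OF lip])
  have [measurable]: "f \<in> borel_measurable borel"
    by (intro borel_measurable_continuous_onI lipschitz_on_continuous_on[OF lip])
  have lin: "bounded_linear ?D"
    by (intro bounded_linear_sum bounded_linear_mult_right bounded_linear_compose[OF bounded_linear_mult_right] bounded_linear_inner_left)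
  interpret D: bounded_linear ?D by (rule lin)
  define e where "e y = f y - ?D y" for y
  have [measurable]: "e \<in> borel_measurable borel" unfolding e_def by measurable
  define L1 where "L1 = L + real ?n * L"
  have L1: "0 \<le> L1" using L by (simp add: L1_def)
  have Dle: "\<bar>?D v\<bar> \<le> real ?n * L * norm v" for v
  proof -
    have "\<bar>?D v\<bar> \<le> (\<Sum>b\<in>(Basis::'a set). L * norm v)"
      by (rule sum_abs[THEN order_trans], rule sum_mono)
        (auto simp: abs_mult intro!: mult_mono abs_dir_deriv_le L Basis_le_norm)
    then show ?thesis by simp
  qed
  have elip: "\<bar>e y - e z\<bar> \<le> L1 * norm (y - z)" for y z
  proof -
    have "\<bar>f y - f z\<bar> \<le> L * norm (y - z)"
      using lipschitz_onD[OF lip, of y z] by (simp add: dist_norm)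
    moreover have "e y - e z = (f y - f z) - ?D (y - z)" by (simp add: e_def D.diff)
    ultimately show ?thesis using Dle[of "y - z"] by (simp add: L1_def distrib_right)
  qed
  have main: "\<exists>\<delta>>0. \<forall>y. norm (y - x) < \<delta> \<longrightarrow> \<bar>e y - e x\<bar> \<le> \<epsilon> * norm (y - x)" if \<epsilon>: "0 < \<epsilon>" for \<epsilon>
  proof -
    define \<kappa> where "\<kappa> = min 1 (\<epsilon> / (4 * L1 * real ?n + 1))"
    have \<kappa>: "0 < \<kappa>" "\<kappa> \<le> 1" using \<epsilon> L1 by (auto simp: \<kappa>_def intro!: divide_pos_pos add_nonneg_pos)
    have pos: "0 < 4 * L1 * real ?n + 1" using L1 by (simp add: add_nonneg_pos)
    have "\<kappa> \<le> \<epsilon> / (4 * L1 * real ?n + 1)" by (simp add: \<kappa>_def)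
    then have "\<kappa> * (4 * L1 * real ?n + 1) \<le> \<epsilon>" by (simp only: pos_le_divide_eq[OF pos])
    then have \<kappa>\<epsilon>: "2 * L1 * real ?n * \<kappa> \<le> \<epsilon> / 2" using \<kappa> by (simp add: algebra_simps)
    \<comment> \<open>\<open>\<kappa>\<close> is fixed first, to bound the cost of shifting the base point; \<open>\<eta>\<close> then pays for the small cube\<close>
    define \<eta> where "\<eta> = \<epsilon> * \<kappa> ^ ?n / (2 * real ?n * 2 ^ ?n)"
    have \<eta>: "0 < \<eta>" using \<epsilon> \<kappa> by (simp add: \<eta>_def)
    have "\<forall>b\<in>Basis. \<exists>d>0. \<forall>h. 0 < h \<and> h < d \<longrightarrow>
     (\<integral>\<^sup>+y. ennreal \<bar>dir_deriv L f b y - dir_deriv L f b x\<bar> * indicator (cube x h) y \<partial>lborel)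
       \<le> ennreal (\<eta> * h ^ ?n)" using leb \<eta> by blast
    from bchoice[OF this] obtain d where d: "\<forall>b\<in>Basis. 0 < d b \<and> (\<forall>h. 0 < h \<and> h < d b \<longrightarrow>
     (\<integral>\<^sup>+y. ennreal \<bar>dir_deriv L f b y - dir_deriv L f b x\<bar> * indicator (cube x h) y \<partial>lborel)
       \<le> ennreal (\<eta> * h ^ ?n))" ..
    obtain d0 where d0: "0 < d0" "\<And>b. b \<in> Basis \<Longrightarrow> d0 \<le> d b"
      using finite_positive_lower_bound[OF finite_Basis, of d] d by blast
    show ?thesis
    proof (intro exI[of _ "d0 / 2"] conjI allI impI)
      show "0 < d0 / 2" using d0 by simp
      fix y assume y: "norm (y - x) < d0 / 2"
      show "\<bar>e y - e x\<bar> \<le> \<epsilon> * norm (y - x)"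
      proof (cases "y = x")
        case False
        define v where "v = y - x"
        define r where "r = norm v"
        have r: "0 < r" using False by (simp add: r_def v_def)
        define \<rho> where "\<rho> = \<kappa> * r"
        have \<rho>: "0 < \<rho>" "\<rho> \<le> r" using r \<kappa> by (auto simp: \<rho>_def mult_le_cancel_right1)
        let ?Z = "cbox x (x + \<rho> *\<^sub>R One)"
        let ?I = "\<lambda>k. \<integral>\<^sup>+z. ennreal \<bar>k z\<bar> * indicator ?Z z \<partial>lborel"
        have vol: "emeasure lborel ?Z = ennreal (\<rho> ^ ?n)"
          using \<rho> by (simp add: emeasure_lborel_cbox_eq inner_add_left prod_constant)
        define I where "I = \<eta> * (2 * r) ^ ?n"
        have I0: "0 \<le> I" using \<eta> r by (simp add: I_def)
        have I: "(\<integral>\<^sup>+y. ennreal \<bar>dir_deriv L f b y - dir_deriv L f b x\<bar> * indicator (cube x (2 * r)) y \<partial>lborel) \<le> ennreal I"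
          if b: "b \<in> Basis" for b
        proof -
          have "0 < 2 * r \<and> 2 * r < d b" using r y d0(2)[OF b] by (simp add: r_def v_def)
          then show ?thesis using d b unfolding I_def by blast
        qed
        \<comment> \<open>the position after the steps along the axes in \<open>S\<close>\<close>
        define ws where "ws S = (\<Sum>b\<in>S. (v \<bullet> b) *\<^sub>R b)" for S
        have wsj: "ws S \<bullet> j = (if j \<in> S then v \<bullet> j else 0)" if "S \<subseteq> Basis" "j \<in> Basis" for S j
        proof -
          have fin: "finite S" using that finite_subset finite_Basis by blast
          have "ws S \<bullet> j = (\<Sum>b\<in>S. (v \<bullet> b) * (b \<bullet> j))" by (simp add: ws_def inner_sum_left)
          also have "\<dots> = (\<Sum>b\<in>S. if b = j then v \<bullet> j else 0)"
            using that by (intro sum.cong) (auto simp: inner_Basis)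
          finally show ?thesis using fin by simp
        qed
        have step: "?I (\<lambda>z. e (z + ws S) - e z) \<le> ennreal (real (card S) * (r * I))"
          if "S \<subseteq> Basis" for S
          using finite_subset[OF that finite_Basis] that
        proof (induction S)
          case empty
          then show ?case by (simp add: ws_def)
        next
          case (insert b S)
          then have b: "b \<in> Basis" and S: "S \<subseteq> Basis" by auto
          have ws: "ws (insert b S) = ws S + (v \<bullet> b) *\<^sub>R b" using insert by (simp add: ws_def add.commute)
          have Db: "?D (t *\<^sub>R b) = dir_deriv L f b x * t" for t
            using b by (simp add: inner_Basis if_distrib mult.commute cong: if_cong)
          have e_eq: "e (z + ws (insert b S)) - e (z + ws S) = f (z + (ws S + (v \<bullet> b) *\<^sub>R b)) - f (z + ws S) - dir_deriv L f b x * (v \<bullet> b)" for z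
            unfolding ws e_def D.add Db by simp
          have tr: "?I (\<lambda>z. e (z + ws (insert b S)) - e (z + ws S)) \<le> ennreal (r * I)"
            unfolding e_eq
          proof (rule lipschitz_shift_average_le[OF lip b r _ _ _ _ _ I[OF b] I0])
            show "\<bar>v \<bullet> b\<bar> \<le> r" unfolding r_def by (rule Basis_le_norm[OF b])
            show "\<bar>ws S \<bullet> j\<bar> \<le> r" if "j \<in> Basis" for j
              using wsj[OF S that] Basis_le_norm[OF that, of v] r by (simp add: r_def)
            show "ws S \<bullet> b = 0" using wsj[OF S b] insert by simp
          qed (use \<rho> in auto)
          have "?I (\<lambda>z. e (z + ws (insert b S)) - e z)
            \<le> (\<integral>\<^sup>+z. ennreal \<bar>e (z + ws (insert b S)) - e (z + ws S)\<bar> * indicator ?Z z + ennreal \<bar>e (z + ws S) - e z\<bar> * indicator ?Z z \<partial>lborel)"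
          proof (intro nn_integral_mono)
            fix z
            have "ennreal \<bar>e (z + ws (insert b S)) - e z\<bar> \<le> ennreal (\<bar>e (z + ws (insert b S)) - e (z + ws S)\<bar> + \<bar>e (z + ws S) - e z\<bar>)"
              by (intro ennreal_leI) linarith
            then show "ennreal \<bar>e (z + ws (insert b S)) - e z\<bar> * indicator ?Z z
              \<le> ennreal \<bar>e (z + ws (insert b S)) - e (z + ws S)\<bar> * indicator ?Z z + ennreal \<bar>e (z + ws S) - e z\<bar> * indicator ?Z z"
              by (simp add: indicator_def)
          qed
          also have "\<dots> = ?I (\<lambda>z. e (z + ws (insert b S)) - e (z + ws S))
             + ?I (\<lambda>z. e (z + ws S) - e z)"
            by (rule nn_integral_add) measurable
          also have "\<dots> \<le> ennreal (r * I) + ennreal (real (card S) * (r * I))"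
            by (intro add_mono tr insert.IH S)
          also have "\<dots> = ennreal (real (card (insert b S)) * (r * I))"
            using insert r I0 by (simp add: ennreal_plus[symmetric] distrib_right del: ennreal_plus)
          finally show ?case .
        qed
        have wv: "ws Basis = v" by (simp add: ws_def euclidean_representation)
        have "ennreal (\<bar>e y - e x\<bar> * \<rho> ^ ?n) = (\<integral>\<^sup>+z. ennreal \<bar>e y - e x\<bar> * indicator ?Z z \<partial>lborel)"
          by (subst nn_integral_cmult_indicator) (auto simp: vol ennreal_mult' )
        also have "\<dots> \<le> (\<integral>\<^sup>+z. ennreal \<bar>e (z + ws Basis) - e z\<bar> * indicator ?Z z + ennreal (2 * L1 * (real ?n * \<rho>)) * indicator ?Z z \<partial>lborel)"
        proof (intro nn_integral_mono)
          fix z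
          have "\<bar>e y - e x\<bar> \<le> \<bar>e (z + v) - e z\<bar> + 2 * L1 * (real ?n * \<rho>)" if z: "z \<in> ?Z"
          proof -
            have "norm (z - x) \<le> (\<Sum>b\<in>Basis. \<bar>(z - x) \<bullet> b\<bar>)" by (rule norm_le_l1)
            also have "\<dots> \<le> (\<Sum>b\<in>(Basis::'a set). \<rho>)"
              using z by (intro sum_mono) (auto simp: mem_box inner_add_left inner_diff_left abs_le_iff)
            finally have nz: "norm (z - x) \<le> real ?n * \<rho>" by simp
            have "\<bar>e y - e (z + v)\<bar> \<le> L1 * norm (y - (z + v))" by (rule elip)
            also have "y - (z + v) = x - z" by (simp add: v_def)
            also have "L1 * norm (x - z) \<le> L1 * (real ?n * \<rho>)" using nz L1 by (intro mult_left_mono) (simp_all add: norm_minus_commute)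
            finally have 1: "\<bar>e y - e (z + v)\<bar> \<le> L1 * (real ?n * \<rho>)" .
            have "\<bar>e z - e x\<bar> \<le> L1 * norm (z - x)" by (rule elip)
            also have "\<dots> \<le> L1 * (real ?n * \<rho>)" using nz L1 by (intro mult_left_mono)
            finally show ?thesis using 1 by linarith
          qed
          then show "ennreal \<bar>e y - e x\<bar> * indicator ?Z z \<le> ennreal \<bar>e (z + ws Basis) - e z\<bar> * indicator ?Z z + ennreal (2 * L1 * (real ?n * \<rho>)) * indicator ?Z z"
            using L1 \<rho> unfolding wv by (auto simp: indicator_def ennreal_plus[symmetric] simp del: ennreal_plus intro!: ennreal_leI)
        qed
        also have "\<dots> = ?I (\<lambda>z. e (z + ws Basis) - e z) + (\<integral>\<^sup>+z. ennreal (2 * L1 * (real ?n * \<rho>)) * indicator ?Z z \<partial>lborel)"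
          by (rule nn_integral_add) measurable
        also have "(\<integral>\<^sup>+z. ennreal (2 * L1 * (real ?n * \<rho>)) * indicator ?Z z \<partial>lborel) = ennreal (2 * L1 * (real ?n * \<rho>) * \<rho> ^ ?n)"
          using L1 \<rho> by (subst nn_integral_cmult_indicator) (simp_all add: vol ennreal_mult)
        also have "?I (\<lambda>z. e (z + ws Basis) - e z) + ennreal (2 * L1 * (real ?n * \<rho>) * \<rho> ^ ?n)
          \<le> ennreal (real ?n * (r * I)) + ennreal (2 * L1 * (real ?n * \<rho>) * \<rho> ^ ?n)"
          by (intro add_right_mono step) simp
        also have "\<dots> = ennreal (real ?n * (r * I) + 2 * L1 * (real ?n * \<rho>) * \<rho> ^ ?n)"
          using r I0 L1 \<rho> by (intro ennreal_plus[symmetric]) auto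
        finally have "ennreal (\<bar>e y - e x\<bar> * \<rho> ^ ?n) \<le> ennreal (real ?n * (r * I) + 2 * L1 * (real ?n * \<rho>) * \<rho> ^ ?n)" .
        then have "\<bar>e y - e x\<bar> * \<rho> ^ ?n \<le> real ?n * (r * I) + 2 * L1 * (real ?n * \<rho>) * \<rho> ^ ?n"
          using r I0 L1 \<rho> by (subst (asm) ennreal_le_iff) auto
        also have "real ?n * (r * I) = \<epsilon> / 2 * r * \<rho> ^ ?n"
          by (simp add: I_def \<eta>_def \<rho>_def power_mult_distrib field_simps)
        also have "2 * L1 * (real ?n * \<rho>) * \<rho> ^ ?n = (2 * L1 * real ?n * \<kappa>) * r * \<rho> ^ ?n" by (simp add: \<rho>_def)
        also have "\<epsilon> / 2 * r * \<rho> ^ ?n + (2 * L1 * real ?n * \<kappa>) * r * \<rho> ^ ?n \<le> \<epsilon> / 2 * r * \<rho> ^ ?n + \<epsilon> / 2 * r * \<rho> ^ ?n"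
          using r \<rho> \<kappa>\<epsilon> by (intro add_left_mono mult_right_mono) auto
        finally have "\<bar>e y - e x\<bar> * \<rho> ^ ?n \<le> (\<epsilon> * r) * \<rho> ^ ?n" by (simp add: field_simps)
        then show ?thesis using \<rho> by (simp add: r_def v_def)
      qed simp
    qed
  qed
  show ?thesis
    unfolding has_derivative_at_alt
  proof (intro conjI lin allI impI)
    fix \<epsilon> :: real assume "0 < \<epsilon>"
    then obtain \<delta> where \<delta>: "0 < \<delta>" "\<forall>y. norm (y - x) < \<delta> \<longrightarrow> \<bar>e y - e x\<bar> \<le> \<epsilon> * norm (y - x)"
      using main by blast
    moreover have "e y - e x = f y - f x - ?D (y - x)" for y unfolding e_def D.diff by simp
    ultimately show "\<exists>\<delta>>0. \<forall>y. norm (y - x) < \<delta> \<longrightarrow> norm (f y - f x - ?D (y - x)) \<le> \<epsilon> * norm (y - x)"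
      by auto
  qed
qed

text \<open>Rademacher's theorem, with an explicit bounded Borel derivative.\<close>

theorem lipschitz_real_valued_ae_differentiable:
  fixes f :: "'a::euclidean_space \<Rightarrow> real"
  assumes lip: "L-lipschitz_on UNIV f"
  shows "AE x in lborel. (f has_derivative (\<lambda>v. \<Sum>b\<in>Basis. dir_deriv L f b x * (v \<bullet> b))) (at x)"
proof -
  have "AE x in lborel. \<forall>b\<in>Basis. lebesgue_point (dir_deriv L f b) x"
    by (intro AE_finite_allI finite_Basis bounded_borel_lebesgue_point[where B = L] borel_measurable_dir_deriv
        lipschitz_on_continuous_on[OF lip] abs_dir_deriv_le lipschitz_on_nonneg[OF lip])
  then show ?thesis
    by eventually_elim (rule lipschitz_differentiable_at_lebesgue_point[OF lip], blast)
qed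

section \<open>Jacobian determinants with compact support\<close>

lemma norm_derivative_between_increment_bounds:
  fixes v :: "'a::real_normed_vector \<Rightarrow> 'b::real_normed_vector"
  assumes S: "open S" "x \<in> S" and der: "(v has_derivative D) (at x)"
    and v: "\<And>y. y \<in> S \<Longrightarrow> c * norm (y - x) \<le> norm (v y - v x)"
      "\<And>y. y \<in> S \<Longrightarrow> norm (v y - v x) \<le> C * norm (y - x)"
  shows "c * norm h \<le> norm (D h)" "norm (D h) \<le> C * norm h"
proof -
  interpret bounded_linear D by (rule has_derivative_bounded_linear[OF der])
  have "c * norm h \<le> norm (D h) \<and> norm (D h) \<le> C * norm h"
  proof (cases "h = 0")
    case False
    have *: "c * norm h \<le> norm (D h) + e \<and> norm (D h) \<le> C * norm h + e" if e: "0 < e" for e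
    proof -
      let ?e = "e / norm h"
      have e': "0 < ?e" using e False by simp
      obtain d where d: "d > 0" "\<And>y. norm (y - x) < d \<Longrightarrow> norm (v y - v x - D (y - x)) \<le> ?e * norm (y - x)"
        using der e' unfolding has_derivative_at_alt by blast
      obtain r where r: "r > 0" "ball x r \<subseteq> S" using S open_contains_ball by blast
      define s where "s = min d r / (2 * norm h)"
      have s: "0 < s" using d r False by (simp add: s_def)
      define y where "y = x + s *\<^sub>R h"
      have yx: "y - x = s *\<^sub>R h" "norm (y - x) = s * norm h" using s by (auto simp: y_def)
      have sm: "s * norm h < d" "s * norm h < r" using d r False by (auto simp: s_def min_def)
      have "y \<in> S" using r(2) sm yx by (auto simp: dist_norm norm_minus_commute subset_iff)
      note vy = v[OF this, unfolded yx]
      have "norm (v y - v x - s *\<^sub>R D h) \<le> ?e * (s * norm h)"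
        using d(2)[of y] sm s False by (simp add: yx scaleR)
      also have "\<dots> = s * e" using False by simp
      finally have "\<bar>norm (v y - v x) - norm (s *\<^sub>R D h)\<bar> \<le> s * e"
        using norm_triangle_ineq3 order_trans by blast
      then have "s * (c * norm h) \<le> s * (norm (D h) + e)" "s * norm (D h) \<le> s * (C * norm h + e)"
        using vy s by (auto simp: algebra_simps)
      then show ?thesis using s by simp
    qed
    show ?thesis by (intro conjI; rule field_le_epsilon) (use * in auto)
  qed (simp add: zero)
  then show "c * norm h \<le> norm (D h)" "norm (D h) \<le> C * norm h" by auto
qed

text \<open>The finite difference of order \<open>n\<close> annihilates powers of smaller degree.\<close>

lemma alternating_binomial_power_sum:
  assumes "k < n"
  shows "(\<Sum>j\<le>n. (-1) ^ j * real (n choose j) * real j ^ k) = 0"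
  using assms
proof (induction n arbitrary: k)
  case (Suc n)
  show ?case
  proof (cases k)
    case 0
    then show ?thesis using choose_alternating_sum[of "Suc n", where 'a = real] by simp
  next
    case (Suc l)
    have gen: "(-1) ^ Suc j * X * (c * z) = (- m) * ((-1) ^ j * Y * z)" if "X * c = m * Y" for X c m Y z :: real and j
    proof -
      have "(-1) ^ Suc j * X * (c * z) = - ((-1) ^ j * z * (X * c))" by simp
      then show ?thesis unfolding that by simp
    qed
    have "(\<Sum>j\<le>Suc n. (-1) ^ j * real (Suc n choose j) * real j ^ k)
      = (\<Sum>j\<le>n. (-1) ^ Suc j * real (Suc n choose Suc j) * real (Suc j) ^ k)"
      by (subst sum.atMost_Suc_shift) (simp add: Suc)
    also have "\<dots> = (\<Sum>j\<le>n. (- real (Suc n)) * ((-1) ^ j * real (n choose j) * real (Suc j) ^ l))"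
    proof (rule sum.cong[OF refl])
      fix j
      have "real (Suc n choose Suc j) * real (Suc j) = real (Suc n) * real (n choose j)"
        by (metis Suc_times_binomial mult.commute of_nat_mult)
      then show "(-1) ^ Suc j * real (Suc n choose Suc j) * real (Suc j) ^ k = (- real (Suc n)) * ((-1) ^ j * real (n choose j) * real (Suc j) ^ l)"
        using gen[of _ "real (Suc j)" "real (Suc n)" _ j "real (Suc j) ^ l"] by (simp only: Suc power_Suc)
    qed
    also have "\<dots> = (- real (Suc n)) * (\<Sum>j\<le>n. (-1) ^ j * real (n choose j) * (\<Sum>i\<le>l. real (l choose i) * real j ^ i))"
      unfolding sum_distrib_left[symmetric]
      using binomial_ring[of "real _" 1 l] by (simp add: add.commute)
    also have "(\<Sum>j\<le>n. (-1) ^ j * real (n choose j) * (\<Sum>i\<le>l. real (l choose i) * real j ^ i))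
       = (\<Sum>i\<le>l. real (l choose i) * (\<Sum>j\<le>n. (-1) ^ j * real (n choose j) * real j ^ i))"
      unfolding sum_distrib_left by (subst sum.swap) (simp add: ac_simps)
    also have "\<dots> = 0" using Suc Suc.IH \<open>k < Suc n\<close> by (intro sum.neutral) simp
    finally show ?thesis by simp
  qed
qed simp

text \<open>Finite differences extrapolate a polynomial of bounded degree to \<open>0\<close> from its values at
multiples of \<open>b\<close>, with weights that do not depend on the polynomial. An identity that is linear in
the values thus transfers from large arguments to \<open>0\<close> without any look at coefficients.\<close>

lemma poly_extrapolation_weights:
  "\<exists>a. \<forall>p :: real poly. degree p \<le> n \<longrightarrow> poly p 0 = (\<Sum>j\<in>{1..Suc n}. a j * poly p (real j * b))"
proof -
  define c where "c j = (-1) ^ j * real (Suc n choose j)" for j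
  have "poly p 0 = (\<Sum>j\<in>{1..Suc n}. - c j * poly p (real j * b))" if deg: "degree p \<le> n" for p :: "real poly"
  proof -
    have "(\<Sum>j\<le>Suc n. c j * poly p (real j * b)) = (\<Sum>j\<le>Suc n. \<Sum>k\<le>degree p. c j * (coeff p k * (real j * b) ^ k))"
      by (simp add: poly_altdef sum_distrib_left)
    also have "\<dots> = (\<Sum>k\<le>degree p. \<Sum>j\<le>Suc n. c j * (coeff p k * (real j * b) ^ k))"
      by (rule sum.swap)
    also have "\<dots> = (\<Sum>k\<le>degree p. coeff p k * b ^ k * (\<Sum>j\<le>Suc n. (-1) ^ j * real (Suc n choose j) * real j ^ k))"
      by (simp only: sum_distrib_left c_def power_mult_distrib ac_simps)
    also have "\<dots> = 0" using deg by (intro sum.neutral ballI) (subst alternating_binomial_power_sum, auto)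
    finally have "(\<Sum>j\<le>Suc n. c j * poly p (real j * b)) = 0" .
    moreover have "{..Suc n} = insert 0 {1..Suc n}" by auto
    ultimately show ?thesis by (simp add: c_def sum_negf)
  qed
  then show ?thesis by (intro exI[of _ "\<lambda>j. - c j"]) blast
qed

lemma det_mat_add_is_poly:
  fixes A :: "real^'n^'n"
  shows "\<exists>p. degree p \<le> CARD('n) \<and> (\<forall>t. det (mat t + A) = poly p t)"
proof -
  let ?f = "\<lambda>\<pi> i. [:A $ i $ \<pi> i, if i = \<pi> i then 1 else 0:]"
  let ?p = "\<Sum>\<pi> | \<pi> permutes (UNIV :: 'n set). smult (of_int (sign \<pi>)) (\<Prod>i\<in>UNIV. ?f \<pi> i)"
  have "degree ?p \<le> CARD('n)"
  proof (rule degree_sum_le)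
    fix \<pi> :: "'n \<Rightarrow> 'n"
    have "degree (smult (of_int (sign \<pi>)) (\<Prod>i\<in>UNIV. ?f \<pi> i)) \<le> degree (\<Prod>i\<in>UNIV. ?f \<pi> i)"
      by (rule degree_smult_le)
    also have "\<dots> \<le> sum (degree \<circ> ?f \<pi>) UNIV" by (rule degree_prod_sum_le) simp
    also have "\<dots> \<le> sum (\<lambda>i. 1) (UNIV :: 'n set)" by (rule sum_mono) auto
    finally show "degree (smult (of_int (sign \<pi>)) (\<Prod>i\<in>UNIV. ?f \<pi> i)) \<le> CARD('n)" by simp
  qed (simp add: finite_permutations)
  moreover have "det (mat t + A) = poly ?p t" for t
    unfolding det_def poly_sum
    by (intro sum.cong refl) (auto simp: poly_prod mat_def intro!: prod.cong)
  ultimately show ?thesis by blast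
qed

text \<open>On the segment from \<open>mat t\<close> to \<open>mat t + A\<close> no matrix is singular, so the determinant keeps its
sign.\<close>

lemma det_mat_add_pos:
  fixes A :: "real^'n^'n"
  assumes A: "\<And>h. norm (A *v h) \<le> L * norm h" and L: "0 \<le> L" "L < t"
  shows "0 < det (mat t + A)"
proof (rule ccontr)
  assume neg: "\<not> 0 < det (mat t + A)"
  let ?q = "\<lambda>s. det (mat t + s *\<^sub>R A)"
  have "continuous_on {0..1} ?q"
    unfolding det_def by (intro continuous_intros)
  moreover have "?q 1 \<le> 0" using neg by simp
  moreover have "0 \<le> ?q 0"
    using L by (subst det_diagonal) (auto simp: mat_def prod_nonneg)
  ultimately obtain s where s: "0 \<le> s" "s \<le> 1" "?q s = 0"
    using IVT2'[of ?q 1 0 0] by auto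
  then have "\<not> invertible (mat t + s *\<^sub>R A)" by (simp add: invertible_det_nz)
  then obtain h where h: "h \<noteq> 0" "(mat t + s *\<^sub>R A) *v h = 0"
    unfolding invertible_left_inverse matrix_left_invertible_ker by blast
  have "mat t *v h = t *\<^sub>R h"
    by (simp add: vec_eq_iff mat_def matrix_vector_mult_def mult_delta_left)
  then have "t *\<^sub>R h + s *\<^sub>R (A *v h) = 0"
    using h by (simp add: matrix_vector_mult_add_rdistrib scaleR_matrix_vector_assoc)
  then have "t *\<^sub>R h = - (s *\<^sub>R (A *v h))" by (simp add: eq_neg_iff_add_eq_0)
  then have "norm (t *\<^sub>R h) = norm (s *\<^sub>R (A *v h))" by simp
  then have "t * norm h = s * norm (A *v h)" using L s by simp
  also have "\<dots> \<le> 1 * (L * norm h)" using A[of h] s by (intro mult_mono) auto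
  also have "\<dots> < t * norm h" using h L by simp
  finally show False by simp
qed

abbreviation ae_derivative :: "(real^'n \<Rightarrow> real^'m) \<Rightarrow> (real^'n \<Rightarrow> real^'n^'m) \<Rightarrow> bool" where
  "ae_derivative v J \<equiv> AE x in lborel. (v has_derivative (\<lambda>h. J x *v h)) (at x)"

text \<open>The map \<open>x \<mapsto> t x + w x\<close> is injective because \<open>t\<close> exceeds the Lipschitz constant of \<open>w\<close>, and
surjective by the contraction principle. Outside the ball it is \<open>x \<mapsto> t x\<close>, so it maps the ball of
radius \<open>R\<close> onto the ball of radius \<open>t R\<close>, whose measure the change of variables formula
computes.\<close>

lemma integral_det_identity_plus_compact_perturbation:
  fixes w :: "real^'m::{finite,wellorder} \<Rightarrow> real^'m::_" and J :: "real^'m::_ \<Rightarrow> real^'m::_^'m::_"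
  assumes lip: "L-lipschitz_on UNIV w" and supp: "\<And>x. R < norm x \<Longrightarrow> w x = 0" and R: "0 < R"
    and der: "ae_derivative w J"
    and t: "L < t"
  shows "((\<lambda>x. det (mat t + J x)) has_integral t ^ CARD('m) * measure lborel (cball (0::real^'m::_) R)) (cball 0 R)"
proof -
  have L: "0 \<le> L" by (rule lipschitz_on_nonneg[OF lip])
  have t0: "0 < t" using L t by simp
  have wl: "norm (w x - w y) \<le> L * norm (x - y)" for x y
    using lipschitz_onD[OF lip, of x y] by (simp add: dist_norm)
  obtain N where N': "{x \<in> space lborel. \<not> (w has_derivative (\<lambda>h. J x *v h)) (at x)} \<subseteq> N"
    "emeasure lborel N = 0" "N \<in> sets lborel"
    using AE_E[OF der] by blast
  then have N: "N \<in> null_sets lborel" by auto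
  have Nd: "(w has_derivative (\<lambda>h. J x *v h)) (at x)" if "x \<notin> N" for x
    using N'(1) that by auto
  have negN: "negligible N" using N by (simp add: negligible_iff_null_sets null_sets_completionI)
  define S where "S = cball 0 R - N"
  have "S \<in> sets borel" using N by (auto simp: S_def null_sets_def)
  then have S: "S \<in> sets lebesgue" by auto
  define T where "T x = t *\<^sub>R x + w x" for x
  have inj: "inj T"
  proof (rule injI)
    fix x y assume "T x = T y"
    then have "t *\<^sub>R (x - y) = w y - w x" by (simp add: T_def algebra_simps)
    then have "t * norm (x - y) = norm (w y - w x)" using t0 by (metis abs_of_pos norm_scaleR)
    also have "\<dots> \<le> L * norm (x - y)" using wl[of y x] by (simp add: norm_minus_commute)
    finally have "(t - L) * norm (x - y) \<le> 0" by (simp add: algebra_simps)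
    then show "x = y" using t by (simp add: mult_le_0_iff)
  qed
  have surj: "\<exists>x. T x = y" for y
  proof -
    have "\<exists>!x. (y - w x) /\<^sub>R t = x"
    proof (rule banach_fix_type[of "L / t"])
      show "\<forall>x z. dist ((y - w x) /\<^sub>R t) ((y - w z) /\<^sub>R t) \<le> L / t * dist x z"
      proof (intro allI)
        fix x z
        have "(y - w x) /\<^sub>R t - (y - w z) /\<^sub>R t = (w z - w x) /\<^sub>R t"
          by (simp flip: scaleR_diff_right)
        then have "dist ((y - w x) /\<^sub>R t) ((y - w z) /\<^sub>R t) = norm (w z - w x) / t"
          using t0 by (simp add: dist_norm divide_inverse mult.commute)
        also have "\<dots> \<le> L * norm (z - x) / t" using wl t0 by (intro divide_right_mono) auto
        finally show "dist ((y - w x) /\<^sub>R t) ((y - w z) /\<^sub>R t) \<le> L / t * dist x z"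
          by (simp add: dist_norm norm_minus_commute)
      qed
    qed (use L t t0 in auto)
    then obtain x where "(y - w x) /\<^sub>R t = x" by blast
    then have "t *\<^sub>R ((y - w x) /\<^sub>R t) = t *\<^sub>R x" by simp
    then have "T x = y" using t0 by (simp add: T_def algebra_simps)
    then show ?thesis by blast
  qed
  have out: "T x = t *\<^sub>R x" if "R < norm x" for x using supp[OF that] by (simp add: T_def)
  have img: "T ` cball 0 R = cball 0 (t * R)"
  proof (intro equalityI subsetI)
    fix y assume "y \<in> T ` cball 0 R"
    then obtain x where x: "norm x \<le> R" "y = T x" by auto
    show "y \<in> cball 0 (t * R)"
    proof (rule ccontr)
      assume "y \<notin> cball 0 (t * R)"
      then have lt: "R < norm (y /\<^sub>R t)" using t0 by (simp add: field_simps)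
      from this have "T (y /\<^sub>R t) = T x" using out t0 x by simp
      then have eq: "y /\<^sub>R t = x" using inj by (simp add: inj_eq)
      show False using lt x(1) unfolding eq by simp
    qed
  next
    fix y :: "real^'m::_" assume y: "y \<in> cball 0 (t * R)"
    from surj[of y] obtain x where x: "T x = y" ..
    have "norm x \<le> R"
    proof (rule ccontr)
      assume "\<not> norm x \<le> R"
      then have *: "R < norm x" by simp
      have "y = t *\<^sub>R x" using out[OF *] x by (simp only:)
      then have "norm y = t * norm x" using t0 by simp
      moreover have "t * R < t * norm x" using * t0 by simp
      ultimately show False using y by simp
    qed
    then show "y \<in> T ` cball 0 R" using x by auto
  qed
  have "negligible (T ` N)"
  proof (rule negligible_locally_Lipschitz_image[OF _ negN])
    have "norm (T y - T x) \<le> (t + L) * norm (y - x)" for x y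
    proof -
      have "T y - T x = t *\<^sub>R (y - x) + (w y - w x)" by (simp add: T_def algebra_simps)
      then have "norm (T y - T x) \<le> norm (t *\<^sub>R (y - x)) + norm (w y - w x)"
        using norm_triangle_ineq[of "t *\<^sub>R (y - x)" "w y - w x"] by simp
      then show ?thesis using wl[of y x] t0 by (simp add: distrib_right)
    qed
    then show "\<exists>U B. open U \<and> x \<in> U \<and> (\<forall>y\<in>N \<inter> U. norm (T y - T x) \<le> B * norm (y - x))" for x
      by (intro exI[of _ UNIV] exI[of _ "t + L"]) auto
  qed simp
  moreover have "cball 0 (t * R) - T ` S \<subseteq> T ` N" "T ` S - cball 0 (t * R) \<subseteq> {}"
    unfolding img[symmetric] S_def by auto
  ultimately have neg: "negligible ((cball 0 (t * R) - T ` S) \<union> (T ` S - cball 0 (t * R)))"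
    by (intro negligible_Un) (auto intro: negligible_subset)
  have "T ` S \<in> lmeasurable" "measure lebesgue (T ` S) = measure lebesgue (cball (0::real^'m::_) (t * R))"
    using lmeasurable_negligible_symdiff[OF lmeasurable_cball neg] measure_negligible_symdiff[OF lmeasurable_cball neg] by auto
  moreover have derT: "(T has_derivative (\<lambda>h. (mat t + J x) *v h)) (at x within S)" if "x \<in> S" for x
  proof -
    have "mat t *v h = t *\<^sub>R h" for h :: "real^'m::_"
      by (simp add: vec_eq_iff mat_def matrix_vector_mult_def mult_delta_left)
    then show ?thesis
      using has_derivative_add[OF has_derivative_scaleR_right[OF has_derivative_ident, of t] has_derivative_at_withinI[OF Nd[of x]], of S] that
      by (simp add: T_def[abs_def] S_def matrix_vector_mult_add_rdistrib)
  qed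
  ultimately have 1: "((\<lambda>x. \<bar>det (matrix (\<lambda>h. (mat t + J x) *v h))\<bar>) has_integral measure lebesgue (cball (0::real^'m::_) (t * R))) S"
    by (intro has_measure_differentiable_image[OF S derT inj_on_subset[OF inj subset_UNIV], THEN iffD1] conjI)
  have dpos: "0 < det (mat t + J x)" if "x \<in> S" for x
  proof (rule det_mat_add_pos[OF _ L t])
    show "norm (J x *v h) \<le> L * norm h" for h
      by (rule norm_derivative_between_increment_bounds(2)[OF open_UNIV UNIV_I Nd, where c = 0]) (use that wl S_def in auto)
  qed
  have 2: "((\<lambda>x. det (mat t + J x)) has_integral measure lebesgue (cball (0::real^'m::_) (t * R))) S"
    by (rule has_integral_eq[OF _ 1]) (simp add: abs_of_pos dpos)
  have "measure lebesgue (cball (0::real^'m::_) (t * R)) = t ^ CARD('m) * measure lborel (cball (0::real^'m::_) R)"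
    using t0 R by (simp add: content_cball power_mult_distrib measure_completion)
  with 2 have 3: "((\<lambda>x. det (mat t + J x)) has_integral t ^ CARD('m) * measure lborel (cball (0::real^'m::_) R)) S" by simp
  have "{x \<in> S - cball 0 R. det (mat t + J x) \<noteq> 0} = {}" by (auto simp: S_def)
  then have n1: "negligible {x \<in> S - cball 0 R. det (mat t + J x) \<noteq> 0}" by (simp only: negligible_empty)
  have n2: "negligible {x \<in> cball 0 R - S. det (mat t + J x) \<noteq> 0}"
    by (rule negligible_subset[OF negN]) (auto simp: S_def)
  show ?thesis by (rule has_integral_spike_set_eq[OF n1 n2, THEN iffD1, OF 3])
qed

text \<open>Extrapolation from large \<open>t\<close> to \<open>t = 0\<close> in the preceding identity; on the right-hand side the
same weights are applied to the polynomial \<open>t\<^sup>n\<close>, which vanishes at \<open>0\<close>.\<close>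

lemma integral_det_compact_support_wellorder:
  fixes w :: "real^'m::{finite,wellorder} \<Rightarrow> real^'m::_" and J :: "real^'m::_ \<Rightarrow> real^'m::_^'m::_"
  assumes lip: "L-lipschitz_on UNIV w" and supp: "\<And>x. R < norm x \<Longrightarrow> w x = 0" and R: "0 < R"
    and der: "ae_derivative w J"
  shows "((\<lambda>x. det (J x)) has_integral 0) (cball 0 R)"
proof -
  let ?n = "CARD('m)"
  have L: "0 \<le> L" by (rule lipschitz_on_nonneg[OF lip])
  obtain a where a: "\<And>p :: real poly. degree p \<le> ?n \<Longrightarrow> poly p 0 = (\<Sum>j\<in>{1..Suc ?n}. a j * poly p (real j * (L + 1)))"
    using poly_extrapolation_weights[of ?n "L + 1"] by blast
  have det0: "det A = (\<Sum>j\<in>{1..Suc ?n}. a j * det (mat (real j * (L + 1)) + A))" for A :: "real^'m::_^'m::_"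
  proof -
    obtain p where p: "degree p \<le> ?n" "\<And>t. det (mat t + A) = poly p t" using det_mat_add_is_poly[of A] by blast
    have "det A = det (mat 0 + A)" by simp
    then show ?thesis using a[OF p(1)] by (simp only: p(2))
  qed
  have "((\<lambda>x. a j * det (mat (real j * (L + 1)) + J x)) has_integral a j * ((real j * (L + 1)) ^ ?n * measure lborel (cball (0::real^'m::_) R))) (cball 0 R)"
    if "j \<in> {1..Suc ?n}" for j
  proof (intro has_integral_mult_right integral_det_identity_plus_compact_perturbation[OF lip supp R der])
    have "1 * (L + 1) \<le> real j * (L + 1)" using that L by (intro mult_right_mono) auto
    then show "L < real j * (L + 1)" by simp
  qed
  then have "((\<lambda>x. \<Sum>j\<in>{1..Suc ?n}. a j * det (mat (real j * (L + 1)) + J x)) has_integral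
      (\<Sum>j\<in>{1..Suc ?n}. a j * ((real j * (L + 1)) ^ ?n * measure lborel (cball (0::real^'m::_) R)))) (cball 0 R)"
    by (intro has_integral_sum) auto
  moreover have "(\<Sum>j\<in>{1..Suc ?n}. a j * ((real j * (L + 1)) ^ ?n * measure lborel (cball (0::real^'m::_) R))) = 0"
  proof -
    have "(\<Sum>j\<in>{1..Suc ?n}. a j * (real j * (L + 1)) ^ ?n) = 0"
    proof -
      have "poly (monom 1 ?n) 0 = (\<Sum>j\<in>{1..Suc ?n}. a j * poly (monom 1 ?n) (real j * (L + 1)))"
        by (rule a) (simp add: degree_monom_eq)
      from this[symmetric] have "(\<Sum>j\<in>{1..Suc ?n}. a j * (real j * (L + 1)) ^ ?n) = 0 ^ ?n"
        by (simp only: poly_monom mult_1_left)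
      also have "(0::real) ^ ?n = 0" by (rule zero_power) simp
      finally show ?thesis .
    qed
    then show ?thesis by (simp add: mult.assoc[symmetric] flip: sum_distrib_right)
  qed
  ultimately show ?thesis by (simp only: det0[symmetric])
qed

lemma bij_betw_axis_Basis: "bij_betw (\<lambda>i::'n::finite. axis i (1::real)) UNIV Basis"
  by (auto simp: bij_betw_def inj_def axis_eq_axis Basis_vec_def)

lemma prod_Basis_vec: "(\<Prod>b\<in>Basis. g b) = (\<Prod>i\<in>UNIV. g (axis i (1::real)))"
  by (rule prod.reindex_bij_betw[OF bij_betw_axis_Basis, symmetric])

lemma sum_Basis_vec: "(\<Sum>b\<in>Basis. g b) = (\<Sum>i\<in>UNIV. g (axis i (1::real)))"
  by (rule sum.reindex_bij_betw[OF bij_betw_axis_Basis, symmetric])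

lemma has_derivative_matrix_componentwise:
  fixes v :: "real^'n \<Rightarrow> real^'m" and A :: "real^'n^'m"
  shows "(v has_derivative (\<lambda>h. A *v h)) (at x) \<longleftrightarrow>
    (\<forall>i. ((\<lambda>y. v y $ i) has_derivative (\<lambda>h. (A *v h) $ i)) (at x))"
proof -
  have "(\<forall>b\<in>Basis. P b) \<longleftrightarrow> (\<forall>i. P (axis i 1))" for P :: "real^'m \<Rightarrow> bool"
    by (auto simp: Basis_vec_def)
  then show ?thesis
    unfolding has_derivative_componentwise_within[of v] by (simp add: inner_axis)
qed

lemma lipschitz_ae_jacobian:
  fixes v :: "real^'n \<Rightarrow> real^'n"
  assumes lip: "L-lipschitz_on UNIV v"
  obtains J where "\<And>i j. (\<lambda>x. J x $ i $ j) \<in> borel_measurable borel" "\<And>x i j. \<bar>J x $ i $ j\<bar> \<le> L"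
    "ae_derivative v J"
proof -
  have lipi: "L-lipschitz_on UNIV (\<lambda>y. v y $ i)" for i
  proof (rule lipschitz_onI)
    fix x y
    have "dist (v x $ i) (v y $ i) \<le> dist (v x) (v y)" by (rule dist_vec_nth_le)
    also have "\<dots> \<le> L * dist x y" by (rule lipschitz_onD[OF lip]) auto
    finally show "dist (v x $ i) (v y $ i) \<le> L * dist x y" .
  qed (rule lipschitz_on_nonneg[OF lip])
  define J where "J x = (\<chi> i j. dir_deriv L (\<lambda>y. v y $ i) (axis j 1) x)" for x
  have "AE x in lborel. \<forall>i\<in>UNIV. ((\<lambda>y. v y $ i) has_derivative (\<lambda>h. \<Sum>b\<in>Basis. dir_deriv L (\<lambda>y. v y $ i) b x * (h \<bullet> b))) (at x)"
    by (intro AE_finite_allI lipschitz_real_valued_ae_differentiable[OF lipi]) simp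
  then have "ae_derivative v J"
  proof eventually_elim
    case (elim x)
    then show ?case
      unfolding has_derivative_matrix_componentwise
      by (simp add: sum_Basis_vec J_def matrix_vector_mult_def inner_axis)
  qed
  moreover have "(\<lambda>x. J x $ i $ j) \<in> borel_measurable borel" for i j
    unfolding J_def by (simp add: borel_measurable_dir_deriv lipschitz_on_continuous_on[OF lipi])
  moreover have "\<bar>J x $ i $ j\<bar> \<le> L" for x i j
    unfolding J_def using abs_dir_deriv_le[OF lipschitz_on_nonneg[OF lip]] by simp
  ultimately show ?thesis using that by blast
qed

lemma abs_det_le:
  fixes A :: "real^'n^'n"
  assumes "\<And>i j. \<bar>A $ i $ j\<bar> \<le> K"
  shows "\<bar>det A\<bar> \<le> fact (CARD('n)) * K ^ CARD('n)"
proof -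
  have "\<bar>det A\<bar> \<le> (\<Sum>p | p permutes (UNIV :: 'n set). \<bar>of_int (sign p) * (\<Prod>i\<in>UNIV. A $ i $ p i)\<bar>)"
    unfolding det_def by (rule sum_abs)
  also have "\<dots> \<le> (\<Sum>p | p permutes (UNIV :: 'n set). K ^ CARD('n))"
  proof (rule sum_mono)
    fix p :: "'n \<Rightarrow> 'n"
    have "\<bar>of_int (sign p) * (\<Prod>i\<in>UNIV. A $ i $ p i)\<bar> = (\<Prod>i\<in>UNIV. \<bar>A $ i $ p i\<bar>)"
      by (simp add: abs_mult abs_prod flip: of_int_abs)
    also have "\<dots> \<le> (\<Prod>i\<in>(UNIV::'n set). K)" by (rule prod_mono) (use assms in auto)
    finally show "\<bar>of_int (sign p) * (\<Prod>i\<in>UNIV. A $ i $ p i)\<bar> \<le> K ^ CARD('n)" by simp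
  qed
  also have "\<dots> = fact (CARD('n)) * K ^ CARD('n)" by (simp add: card_permutations[OF refl])
  finally show ?thesis .
qed

lemma borel_measurable_det:
  fixes J :: "'a \<Rightarrow> real^'n^'n"
  assumes [measurable]: "\<And>i j. (\<lambda>x. J x $ i $ j) \<in> borel_measurable M"
  shows "(\<lambda>x. det (J x)) \<in> borel_measurable M"
  unfolding det_def by measurable

text \<open>The change of variables formula is stated for index types with a well-order. A copy of an
arbitrary finite type, ordered by an enumeration, transfers its consequence to every dimension.\<close>

typedef ('n::finite) wo = "UNIV :: 'n set" morphisms of_wo to_wo by auto

instance wo :: (finite) finite
proof
  have "(UNIV :: 'a wo set) = to_wo ` UNIV" by (rule type_definition.univ[OF type_definition_wo])
  then show "finite (UNIV :: 'a wo set)" by (metis finite finite_imageI)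
qed

definition wo_rank :: "'n::finite wo \<Rightarrow> nat" where
  "wo_rank x = (SOME e :: 'n \<Rightarrow> nat. inj e) (of_wo x)"

lemma inj_wo_rank: "wo_rank x = wo_rank y \<longleftrightarrow> x = (y :: 'n::finite wo)"
proof -
  have "\<exists>e :: 'n \<Rightarrow> nat. inj e" using finite_imp_inj_to_nat_seg[of "UNIV :: 'n set"] by auto
  then have "inj (SOME e :: 'n \<Rightarrow> nat. inj e)" by (rule someI_ex)
  then show ?thesis by (simp add: wo_rank_def inj_eq of_wo_inject)
qed

instantiation wo :: (finite) wellorder
begin

definition less_eq_wo :: "'a wo \<Rightarrow> 'a wo \<Rightarrow> bool" where "less_eq_wo x y \<longleftrightarrow> wo_rank x \<le> wo_rank y"

definition less_wo :: "'a wo \<Rightarrow> 'a wo \<Rightarrow> bool" where "less_wo x y \<longleftrightarrow> wo_rank x < wo_rank y"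

instance
proof
  fix P :: "'a wo \<Rightarrow> bool" and a
  assume step: "\<And>x. (\<And>y. y < x \<Longrightarrow> P y) \<Longrightarrow> P x"
  show "P a"
  proof (induction a rule: measure_induct_rule[of wo_rank])
    case (less x)
    show ?case by (rule step, rule less) (simp add: less_wo_def)
  qed
qed (auto simp: less_eq_wo_def less_wo_def inj_wo_rank intro: antisym)

end

lemma bij_of_wo: "bij of_wo"
proof (rule bijI)
  show "inj of_wo" by (simp add: inj_def of_wo_inject)
  show "surj of_wo" by (rule surjI[of _ to_wo]) (simp add: to_wo_inverse)
qed

lemma det_reindex:
  fixes A :: "real^'n^'n" and f :: "'m::finite \<Rightarrow> 'n"
  assumes f: "bij f"
  shows "det (\<chi> k l. A $ f k $ f l :: real^'m^'m) = det A"
proof -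
  have fg: "f (inv f x) = x" "inv f (f y) = y" for x y
    using f by (simp_all add: bij_is_surj surj_f_inv_f bij_is_inj)
  have bf: "bij_betw f UNIV UNIV" and bg: "bij_betw (inv f) UNIV UNIV" using f bij_imp_bij_inv by auto
  have m: "map_permutation UNIV f p = f \<circ> p \<circ> inv f" for p
    using f by (auto simp: map_permutation_def fun_eq_iff restrict_id_def bij_is_surj)
  have mi: "map_permutation UNIV (inv f) q = inv f \<circ> q \<circ> f" for q
    using bg by (auto simp: map_permutation_def fun_eq_iff restrict_id_def bij_is_surj inv_inv_eq[OF f])
  have "det (\<chi> k l. A $ f k $ f l :: real^'m^'m) = (\<Sum>p | p permutes (UNIV :: 'm set). of_int (sign p) * (\<Prod>i\<in>UNIV. A $ f i $ f (p i)))"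
    by (simp add: det_def)
  also have "\<dots> = (\<Sum>q | q permutes (UNIV :: 'n set). of_int (sign q) * (\<Prod>i\<in>UNIV. A $ i $ q i))"
  proof (rule sum.reindex_bij_witness[of _ "map_permutation UNIV (inv f)" "map_permutation UNIV f"])
    fix p :: "'m \<Rightarrow> 'm" assume "p \<in> {p. p permutes UNIV}"
    then have p: "p permutes UNIV" by simp
    show "map_permutation UNIV (inv f) (map_permutation UNIV f p) = p" by (simp add: m mi fun_eq_iff fg)
    show "map_permutation UNIV f p \<in> {q. q permutes UNIV}" using map_permutation_permutes[OF bf p] by simp
    have "sign (map_permutation UNIV f p) = sign p" by (rule sign_map_permutation[OF bij_is_inj[OF f] p]) simp
    moreover have "(\<Prod>i\<in>UNIV. A $ i $ (map_permutation UNIV f p) i) = (\<Prod>i\<in>UNIV. A $ f i $ f (p i))"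
      by (subst prod.reindex_bij_betw[OF bf, symmetric]) (simp add: m fg)
    ultimately show "of_int (sign (map_permutation UNIV f p)) * (\<Prod>i\<in>UNIV. A $ i $ (map_permutation UNIV f p) i)
      = of_int (sign p) * (\<Prod>i\<in>UNIV. A $ f i $ f (p i))" by simp
  next
    fix q :: "'n \<Rightarrow> 'n" assume "q \<in> {p. p permutes UNIV}"
    then have q: "q permutes UNIV" by simp
    show "map_permutation UNIV f (map_permutation UNIV (inv f) q) = q" by (simp add: m mi fun_eq_iff fg)
    show "map_permutation UNIV (inv f) q \<in> {q. q permutes UNIV}" using map_permutation_permutes[OF bg q] by simp
  qed
  also have "\<dots> = det A" by (simp add: det_def)
  finally show ?thesis .
qed

definition reindex :: "('a::finite \<Rightarrow> 'b::finite) \<Rightarrow> real^'b \<Rightarrow> real^'a" where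
  "reindex f x = (\<chi> i. x $ f i)"

lemma reindex_nth [simp]: "reindex f x $ i = x $ f i"
  by (simp add: reindex_def)

lemma linear_reindex: "linear (reindex f)"
  by (rule linearI) (simp_all add: vec_eq_iff)

lemma borel_measurable_reindex [measurable]: "reindex f \<in> borel \<rightarrow>\<^sub>M borel"
  by (intro borel_measurable_continuous_onI linear_continuous_on linear_conv_bounded_linear[THEN iffD1] linear_reindex)

lemma norm_reindex: "bij f \<Longrightarrow> norm (reindex f x) = norm x"
  unfolding norm_vec_def L2_set_def
  using sum.reindex_bij_betw[of f UNIV UNIV "\<lambda>i. (norm (x $ i))\<^sup>2"] by simp

lemma reindex_inv: "bij f \<Longrightarrow> reindex f (reindex (inv f) x) = x" "bij f \<Longrightarrow> reindex (inv f) (reindex f y) = y"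
  by (simp_all add: vec_eq_iff bij_is_inj bij_is_surj surj_f_inv_f)

lemma lborel_distr_reindex:
  fixes f :: "'a::finite \<Rightarrow> 'b::finite"
  assumes f: "bij f"
  shows "distr lborel borel (reindex f) = lborel"
proof (rule lborel_eqI[symmetric])
  fix l u :: "real^'a" assume lu: "\<And>b. b \<in> Basis \<Longrightarrow> l \<bullet> b \<le> u \<bullet> b"
  have lu': "l $ i \<le> u $ i" for i using lu[of "axis i 1"] by (simp add: inner_axis axis_in_Basis_iff)
  have bg: "bij_betw (inv f) UNIV UNIV" using f bij_imp_bij_inv by auto
  have "reindex f -` box l u = box (reindex (inv f) l) (reindex (inv f) u)"
  proof (intro set_eqI)
    fix x :: "real^'b"
    have "(\<forall>i. l $ i < x $ f i \<and> x $ f i < u $ i) \<longleftrightarrow> (\<forall>j. l $ inv f j < x $ j \<and> x $ j < u $ inv f j)"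
      using f by (metis bij_inv_eq_iff)
    then show "x \<in> reindex f -` box l u \<longleftrightarrow> x \<in> box (reindex (inv f) l) (reindex (inv f) u)"
      by (simp add: mem_box_cart)
  qed
  then have "emeasure (distr lborel borel (reindex f)) (box l u) = emeasure lborel (box (reindex (inv f) l) (reindex (inv f) u))"
    by (subst emeasure_distr) auto
  also have "\<dots> = (\<Prod>b\<in>Basis. (reindex (inv f) u - reindex (inv f) l) \<bullet> b)"
    by (rule emeasure_lborel_box) (use lu' in \<open>auto simp: Basis_vec_def inner_axis\<close>)
  also have "(\<Prod>b\<in>Basis. (reindex (inv f) u - reindex (inv f) l) \<bullet> b) = (\<Prod>i\<in>UNIV. u $ inv f i - l $ inv f i)"
    by (simp add: prod_Basis_vec inner_axis)
  also have "\<dots> = (\<Prod>i\<in>UNIV. u $ i - l $ i)"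
    by (rule prod.reindex_bij_betw[OF bg])
  also have "\<dots> = (\<Prod>b\<in>Basis. (u - l) \<bullet> b)"
    by (simp add: prod_Basis_vec inner_axis)
  finally show "emeasure (distr lborel borel (reindex f)) (box l u) = (\<Prod>b\<in>Basis. (u - l) \<bullet> b)" .
qed simp

text \<open>Conjugation with the relabelling of the coordinates preserves all hypotheses, the determinant and
Lebesgue measure.\<close>

lemma set_integral_det_compact_support:
  fixes w :: "real^'n \<Rightarrow> real^'n" and J :: "real^'n \<Rightarrow> real^'n^'n"
  assumes lip: "L-lipschitz_on UNIV w" and supp: "\<And>x. R < norm x \<Longrightarrow> w x = 0" and R: "0 < R"
    and der: "ae_derivative w J"
    and J[measurable]: "\<And>i j. (\<lambda>x. J x $ i $ j) \<in> borel_measurable borel"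
    and K: "\<And>x i j. \<bar>J x $ i $ j\<bar> \<le> K"
  shows "(LINT x:cball 0 R|lborel. det (J x)) = 0"
proof -
  let ?f = "of_wo :: 'n wo \<Rightarrow> 'n"
  have f: "bij ?f" by (rule bij_of_wo)
  let ?g = "inv ?f"
  have g: "bij ?g" using f by (rule bij_imp_bij_inv)
  let ?w = "\<lambda>y. reindex ?f (w (reindex ?g y))"
  let ?J = "\<lambda>y. (\<chi> k l. J (reindex ?g y) $ ?f k $ ?f l) :: real^'n wo^'n wo"
  have lip': "L-lipschitz_on UNIV ?w"
  proof (rule lipschitz_onI)
    fix x y :: "real^'n wo"
    have "dist (?w x) (?w y) = dist (w (reindex ?g x)) (w (reindex ?g y))"
      unfolding dist_norm by (simp only: norm_reindex[OF f] flip: linear_diff[OF linear_reindex])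
    also have "\<dots> \<le> L * dist (reindex ?g x) (reindex ?g y)" by (rule lipschitz_onD[OF lip]) auto
    also have "dist (reindex ?g x) (reindex ?g y) = dist x y"
      unfolding dist_norm by (simp only: norm_reindex[OF g] flip: linear_diff[OF linear_reindex])
    finally show "dist (?w x) (?w y) \<le> L * dist x y" .
  qed (rule lipschitz_on_nonneg[OF lip])
  have supp': "?w y = 0" if "R < norm y" for y
    using supp[of "reindex ?g y"] that by (simp add: norm_reindex[OF g] linear_0[OF linear_reindex])
  have "AE x in distr lborel borel (reindex ?g). (w has_derivative (\<lambda>h. J x *v h)) (at x)"
    using der by (simp only: lborel_distr_reindex[OF g])
  from AE_distrD[OF _ this] have "AE y in lborel. (w has_derivative (\<lambda>h. J (reindex ?g y) *v h)) (at (reindex ?g y))"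
    by simp
  then have der': "AE y in lborel. (?w has_derivative (\<lambda>h. ?J y *v h)) (at y)"
  proof eventually_elim
    case (elim y)
    have "((\<lambda>y. w (reindex ?g y)) has_derivative (\<lambda>h. J (reindex ?g y) *v reindex ?g h)) (at y)"
      by (rule has_derivative_compose[OF linear_imp_has_derivative[OF linear_reindex] elim])
    from bounded_linear.has_derivative[OF linear_conv_bounded_linear[THEN iffD1, OF linear_reindex] this]
    have "(?w has_derivative (\<lambda>h. reindex ?f (J (reindex ?g y) *v reindex ?g h))) (at y)" .
    moreover have "reindex ?f (J (reindex ?g y) *v reindex ?g h) = ?J y *v h" for h
    proof -
      have "(\<Sum>j\<in>UNIV. A $ i $ j * h $ ?g j) = (\<Sum>l\<in>UNIV. A $ i $ ?f l * h $ l)" for A :: "real^'n^'n" and i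
        by (subst sum.reindex_bij_betw[OF f, symmetric]) (simp add: bij_is_inj[OF f])
      then show ?thesis by (simp add: vec_eq_iff matrix_vector_mult_def)
    qed
    ultimately show ?case by simp
  qed
  have hi: "((\<lambda>y. det (?J y)) has_integral 0) (cball 0 R)"
    by (rule integral_det_compact_support_wellorder[OF lip' supp' R der'])
  have dm: "(\<lambda>x. det (J x)) \<in> borel_measurable borel" by (rule borel_measurable_det[OF J])
  note [measurable] = dm
  have detJ: "det (?J y) = det (J (reindex ?g y))" for y by (rule det_reindex[OF f])
  have int: "set_integrable lborel (cball 0 R) (\<lambda>y. det (J (reindex ?g y)))"
    unfolding set_integrable_def
    by (rule integrableI_bounded_set_indicator[where B = "fact (CARD('n)) * K ^ CARD('n)"])
       (auto intro!: abs_det_le K simp: emeasure_bounded_finite[OF bounded_cball, unfolded infinity_ennreal_def])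
  have "(LINT y:cball 0 R|lborel. det (J (reindex ?g y))) = 0"
    using set_borel_integral_eq_integral(2)[OF int] hi integral_unique[OF hi] by (simp add: detJ)
  then have "(\<integral>y. indicator (cball 0 R) (reindex ?g y) *\<^sub>R det (J (reindex ?g y)) \<partial>lborel) = 0"
    by (simp add: set_lebesgue_integral_def indicator_def norm_reindex[OF g])
  then have "(\<integral>x. indicator (cball 0 R) x *\<^sub>R det (J x) \<partial>distr lborel borel (reindex ?g)) = 0"
  proof (subst integral_distr)
    have "(\<lambda>x. indicator (cball 0 R) x *\<^sub>R det (J x)) \<in> borel_measurable borel"
      by (intro borel_measurable_scaleR borel_measurable_indicator dm) simp
    then show "(\<lambda>x. indicator (cball 0 R) x *\<^sub>R det (J x)) \<in> borel_measurable borel" .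
  qed auto
  then show ?thesis unfolding lborel_distr_reindex[OF g] set_lebesgue_integral_def .
qed

section \<open>Integration by parts for Jacobian determinants\<close>

text \<open>McShane's extension: the infimum of the cones with slope \<open>L\<close> over the graph of \<open>f\<close>.\<close>

lemma lipschitz_real_extension:
  fixes f :: "'a::metric_space \<Rightarrow> real"
  assumes lip: "L-lipschitz_on S f"
  shows "\<exists>g. L-lipschitz_on UNIV g \<and> (\<forall>x\<in>S. g x = f x)"
proof (cases "S = {}")
  case True
  have "0 \<le> L" by (rule lipschitz_on_nonneg[OF lip])
  then show ?thesis using True by (intro exI[of _ "\<lambda>_. 0"]) (auto intro!: lipschitz_onI)
next
  case False
  then obtain y0 where y0: "y0 \<in> S" by blast
  have L: "0 \<le> L" by (rule lipschitz_on_nonneg[OF lip])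
  have fl: "f x \<le> f y + L * dist x y" if "x \<in> S" "y \<in> S" for x y
    using lipschitz_onD[OF lip that] by (simp add: dist_real_def abs_le_iff)
  define g where "g x = (INF y\<in>S. f y + L * dist x y)" for x
  have bdd: "bdd_below ((\<lambda>y. f y + L * dist x y) ` S)" for x
  proof (rule bdd_belowI2)
    fix y assume y: "y \<in> S"
    have "L * dist y0 y \<le> L * dist x y0 + L * dist x y"
      using mult_left_mono[OF dist_triangle3[of y0 y x] L] by (simp add: distrib_left)
    then show "f y0 - L * dist x y0 \<le> f y + L * dist x y" using fl[OF y0 y] by simp
  qed
  have eq: "g x = f x" if "x \<in> S" for x
  proof (rule antisym)
    show "g x \<le> f x" unfolding g_def using cINF_lower[OF bdd that, of x] by simp
    show "f x \<le> g x" unfolding g_def by (rule cINF_greatest[OF False]) (rule fl[OF that])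
  qed
  have le: "g x \<le> g z + L * dist x z" for x z
  proof -
    have "g x - L * dist x z \<le> g z"
      unfolding g_def[of z]
    proof (rule cINF_greatest[OF False])
      fix y assume y: "y \<in> S"
      have "g x \<le> f y + L * dist x y" unfolding g_def by (rule cINF_lower[OF bdd y])
      also have "L * dist x y \<le> L * dist x z + L * dist z y"
        using mult_left_mono[OF dist_triangle[of x y z] L] by (simp add: distrib_left)
      finally show "g x - L * dist x z \<le> f y + L * dist z y" by simp
    qed
    then show ?thesis by simp
  qed
  have "L-lipschitz_on UNIV g"
  proof (rule lipschitz_onI)
    show "dist (g x) (g y) \<le> L * dist x y" for x y
      using le[of x y] le[of y x] by (simp add: dist_real_def abs_le_iff dist_commute)
  qed (rule L)
  then show ?thesis using eq by blast
qed

lemma lipschitz_on_component: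
  fixes v :: "'a::metric_space \<Rightarrow> real^'n"
  assumes "L-lipschitz_on S v"
  shows "L-lipschitz_on S (\<lambda>x. v x $ i)"
proof (rule lipschitz_onI)
  fix x y assume "x \<in> S" "y \<in> S"
  then have "dist (v x) (v y) \<le> L * dist x y" by (rule lipschitz_onD[OF assms])
  then show "dist (v x $ i) (v y $ i) \<le> L * dist x y" using dist_vec_nth_le[of "v x" i "v y"] by simp
qed (rule lipschitz_on_nonneg[OF assms])

lemma lipschitz_on_from_components:
  fixes v :: "'a::metric_space \<Rightarrow> real^'n"
  assumes "\<And>i. L-lipschitz_on S (\<lambda>x. v x $ i)"
  shows "(real CARD('n) * L)-lipschitz_on S v"
proof (rule lipschitz_onI)
  fix x y assume xy: "x \<in> S" "y \<in> S"
  have "dist (v x) (v y) \<le> (\<Sum>i\<in>UNIV. \<bar>(v x - v y) $ i\<bar>)" unfolding dist_norm by (rule norm_le_l1_cart)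
  also have "\<dots> \<le> (\<Sum>i\<in>(UNIV::'n set). L * dist x y)"
    using lipschitz_onD[OF assms xy] by (intro sum_mono) (simp add: dist_real_def)
  finally show "dist (v x) (v y) \<le> real CARD('n) * L * dist x y" by simp
qed (use lipschitz_on_nonneg[OF assms] in simp)

lemma lipschitz_vec_extension:
  fixes v :: "'a::metric_space \<Rightarrow> real^'n"
  assumes lip: "L-lipschitz_on S v"
  shows "\<exists>w. (real CARD('n) * L)-lipschitz_on UNIV w \<and> (\<forall>x\<in>S. w x = v x)"
proof -
  have "\<forall>i. \<exists>g. L-lipschitz_on UNIV g \<and> (\<forall>x\<in>S. g x = v x $ i)"
    using lipschitz_real_extension[OF lipschitz_on_component[OF lip]] by blast
  then obtain g where g: "\<And>i. L-lipschitz_on UNIV (g i)" "\<And>i x. x \<in> S \<Longrightarrow> g i x = v x $ i" by metis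
  have "(real CARD('n) * L)-lipschitz_on UNIV (\<lambda>x. \<chi> i. g i x)"
    by (rule lipschitz_on_from_components) (simp add: g(1))
  then show ?thesis using g(2) by (intro exI[of _ "\<lambda>x. \<chi> i. g i x"]) (simp add: vec_eq_iff)
qed

text \<open>The product is Lipschitz although \<open>g\<close> may be unbounded, since \<open>g\<close> only matters on the
support of \<open>f\<close>.\<close>

lemma lipschitz_on_times_compact_support:
  fixes f g :: "'a::euclidean_space \<Rightarrow> real"
  assumes f: "A-lipschitz_on UNIV f" and g: "B-lipschitz_on UNIV g"
    and supp: "\<And>x. R < norm x \<Longrightarrow> f x = 0" and R: "0 \<le> R"
  shows "\<exists>C. C-lipschitz_on UNIV (\<lambda>x. f x * g x)"
proof -
  have A: "0 \<le> A" and B: "0 \<le> B" using f g lipschitz_on_nonneg by auto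
  have fl: "\<bar>f x - f y\<bar> \<le> A * dist x y" and gl: "\<bar>g x - g y\<bar> \<le> B * dist x y" for x y
    using lipschitz_onD[OF f, of x y] lipschitz_onD[OF g, of x y] by (auto simp: dist_real_def)
  define F where "F = A * (2 * R + 1)"
  define G where "G = \<bar>g 0\<bar> + B * R"
  obtain z :: 'a where z: "norm z = R + 1" using vector_choose_size[of "R + 1"] R by auto
  have F: "\<bar>f x\<bar> \<le> F" for x
  proof (cases "R < norm x")
    case False
    have "\<bar>f x\<bar> \<le> A * dist x z" using fl[of x z] supp[of z] z by simp
    also have "\<dots> \<le> F" unfolding F_def
      using A False z norm_triangle_ineq4[of x z] by (intro mult_left_mono) (auto simp: dist_norm)
    finally show ?thesis .
  qed (use supp A R in \<open>simp add: F_def\<close>)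
  have G: "\<bar>g x\<bar> \<le> G" if "norm x \<le> R" for x
  proof -
    have "\<bar>g x\<bar> \<le> \<bar>g 0\<bar> + B * norm x" using gl[of x 0] by simp
    also have "B * norm x \<le> B * R" using that B by (rule mult_left_mono)
    finally show ?thesis by (simp add: G_def)
  qed
  have G0: "0 \<le> G" using B R by (simp add: G_def)
  have main: "\<bar>f x * g x - f y * g y\<bar> \<le> (G * A + F * B) * dist x y" if "norm x \<le> R" for x y
  proof -
    have "f x * g x - f y * g y = g x * (f x - f y) + f y * (g x - g y)" by (simp add: algebra_simps)
    then have "\<bar>f x * g x - f y * g y\<bar> \<le> \<bar>g x\<bar> * \<bar>f x - f y\<bar> + \<bar>f y\<bar> * \<bar>g x - g y\<bar>"
      by (metis abs_mult abs_triangle_ineq)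
    also have "\<dots> \<le> G * (A * dist x y) + F * (B * dist x y)"
      using G[OF that] G0 F[of y] by (intro add_mono mult_mono fl gl) auto
    finally show ?thesis by (simp add: algebra_simps)
  qed
  have "\<bar>f x * g x - f y * g y\<bar> \<le> (G * A + F * B) * dist x y" for x y
    using main[of x y] main[of y x] supp[of x] supp[of y] A B G0 F[of x]
    by (cases "norm x \<le> R"; cases "norm y \<le> R") (auto simp: dist_commute abs_minus_commute intro!: mult_nonneg_nonneg add_nonneg_nonneg)
  moreover have "0 \<le> G * A + F * B" using G0 A B R by (simp add: F_def)
  ultimately show ?thesis by (intro exI[of _ "G * A + F * B"] lipschitz_onI) (auto simp: dist_real_def)
qed

lemma set_integrable_continuous_times_bounded:
  fixes c d :: "'a::euclidean_space \<Rightarrow> real"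
  assumes c: "continuous_on UNIV c" and d[measurable]: "d \<in> borel_measurable borel" and D: "\<And>x. \<bar>d x\<bar> \<le> D"
  shows "set_integrable lborel (cball 0 r) (\<lambda>x. c x * d x)"
proof -
  have [measurable]: "c \<in> borel_measurable borel" by (rule borel_measurable_continuous_onI[OF c])
  have "bounded (c ` cball 0 r)"
    by (intro compact_imp_bounded compact_continuous_image continuous_on_subset[OF c]) auto
  then obtain B where "\<forall>y\<in>c ` cball 0 r. norm y \<le> B" unfolding bounded_iff by blast
  then have B: "\<bar>c x\<bar> \<le> B" if "x \<in> cball 0 r" for x using that by simp
  show ?thesis
    unfolding set_integrable_def
  proof (rule integrableI_bounded_set_indicator[where B = "B * D"])
    show "AE x in lborel. x \<in> cball 0 r \<longrightarrow> norm (c x * d x) \<le> B * D"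
    proof (intro AE_I2 impI)
      fix x :: 'a assume "x \<in> cball 0 r"
      then have "\<bar>c x\<bar> \<le> B" by (rule B)
      then show "norm (c x * d x) \<le> B * D" using D[of x] by (simp add: abs_mult mult_mono')
    qed
  qed (auto simp: emeasure_bounded_finite[OF bounded_cball, unfolded infinity_ennreal_def])
qed

lemma inner_eq_of_has_derivative:
  fixes f :: "real^'n \<Rightarrow> real"
  assumes "(f has_derivative (\<lambda>h. a \<bullet> h)) (at x)" "(f has_derivative (\<lambda>h. b \<bullet> h)) (at x)"
  shows "a = b"
  using fun_cong[OF has_derivative_unique[OF assms]] by (metis vector_eq_rdot)

lemma has_derivative_matrix_rows:
  fixes v :: "real^'n \<Rightarrow> real^'m" and A :: "real^'n^'m"
  shows "(v has_derivative (\<lambda>h. A *v h)) (at x) \<longleftrightarrow> (\<forall>i. ((\<lambda>y. v y $ i) has_derivative (\<lambda>h. A $ i \<bullet> h)) (at x))"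
  by (simp add: has_derivative_matrix_componentwise matrix_vector_mul_component)

lemma has_derivative_eventually_eq:
  assumes f: "(f has_derivative D) (at x)" and ev: "\<forall>\<^sub>F y in nhds x. g y = f y"
  shows "(g has_derivative D) (at x)"
proof (rule has_derivative_transform_eventually[OF f])
  show "\<forall>\<^sub>F y in at x. f y = g y" "f x = g x"
    using ev by (auto simp: eventually_nhds_conv_at elim: eventually_mono)
qed simp

text \<open>Replace the component \<open>v $ i\<close> by \<open>\<eta> * v $ i\<close> and cut the other components off outside a
larger ball. The resulting map \<open>w\<close> has compact support, so its Jacobian determinant has integral
\<open>0\<close>, and the product rule splits this determinant into the two integrands.\<close>

lemma integral_by_parts_det:
  fixes v :: "real^'n \<Rightarrow> real^'n" and J :: "real^'n \<Rightarrow> real^'n^'n" and H :: "real^'n \<Rightarrow> real^'n"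
  assumes v: "M-lipschitz_on UNIV v" and \<eta>: "A-lipschitz_on UNIV \<eta>"
    and R: "0 < R" and supp: "\<And>x. R < norm x \<Longrightarrow> \<eta> x = 0"
    and J: "\<And>i j. (\<lambda>x. J x $ i $ j) \<in> borel_measurable borel" "\<And>x i j. \<bar>J x $ i $ j\<bar> \<le> K"
      "ae_derivative v J"
    and H: "\<And>j. (\<lambda>x. H x $ j) \<in> borel_measurable borel" "\<And>x j. \<bar>H x $ j\<bar> \<le> K"
      "AE x in lborel. (\<eta> has_derivative (\<lambda>h. H x \<bullet> h)) (at x)"
  shows "(LINT x:cball 0 (R + 2)|lborel. \<eta> x * det (J x))
    = - (LINT x:cball 0 (R + 2)|lborel. v x $ i * det (\<chi> k. if k = i then H x else J x $ k))"
proof -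
  \<comment> \<open>equal to \<open>1\<close> near the ball of radius \<open>R\<close>, so the cutoff is invisible wherever \<open>\<eta>\<close> or its derivative is not \<open>0\<close>\<close>
  define \<chi>' :: "real^'n \<Rightarrow> real" where "\<chi>' x = max 0 (min 1 (R + 2 - norm x))" for x
  have \<chi>_lip: "1-lipschitz_on UNIV \<chi>'"
  proof (rule lipschitz_onI)
    fix x y :: "real^'n"
    have "\<bar>norm x - norm y\<bar> \<le> dist x y" unfolding dist_norm by (rule norm_triangle_ineq3)
    then have "norm x \<le> norm y + dist x y" "norm y \<le> norm x + dist x y" by (auto simp: abs_le_iff)
    then show "dist (\<chi>' x) (\<chi>' y) \<le> 1 * dist x y"
      by (simp add: \<chi>'_def dist_real_def abs_le_iff) (auto simp: max_def min_def)
  qed simp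
  define w where "w x = (\<chi> k. if k = i then \<eta> x * v x $ i else \<chi>' x * v x $ k)" for x
  have "\<exists>C. C-lipschitz_on UNIV (\<lambda>x. w x $ k)" for k
  proof (cases "k = i")
    case True
    then show ?thesis
      using lipschitz_on_times_compact_support[OF \<eta> lipschitz_on_component[OF v, of i] supp] R by (simp add: w_def)
  next
    case False
    then show ?thesis
      using lipschitz_on_times_compact_support[OF \<chi>_lip lipschitz_on_component[OF v, of k], of "R + 2"] R
      by (simp add: w_def \<chi>'_def)
  qed
  then obtain C where C: "\<And>k. (C k)-lipschitz_on UNIV (\<lambda>x. w x $ k)" by metis
  have "(Max (range C))-lipschitz_on UNIV (\<lambda>x. w x $ k)" for k
    by (rule lipschitz_on_mono[OF C[of k]]) auto
  then have wlip: "(real CARD('n) * Max (range C))-lipschitz_on UNIV w" by (rule lipschitz_on_from_components)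
  have wsupp: "w x = 0" if "R + 2 < norm x" for x
    using that supp[of x] by (auto simp: w_def vec_eq_iff \<chi>'_def)
  obtain Jw where Jw: "\<And>i j. (\<lambda>x. Jw x $ i $ j) \<in> borel_measurable borel" "\<And>x i j. \<bar>Jw x $ i $ j\<bar> \<le> real CARD('n) * Max (range C)"
    "ae_derivative w Jw"
    using lipschitz_ae_jacobian[OF wlip] by blast
  have zero: "(LINT x:cball 0 (R + 2)|lborel. det (Jw x)) = 0"
    by (rule set_integral_det_compact_support[OF wlip wsupp _ Jw(3,1,2)]) (use R in auto)
  let ?JH = "\<lambda>x. (\<chi> k. if k = i then H x else J x $ k) :: real^'n^'n"
  have "AE x in lborel. det (Jw x) = \<eta> x * det (J x) + v x $ i * det (?JH x)"
    using Jw(3) J(3) H(3)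
  proof eventually_elim
    case (elim x)
    show ?case
    proof (cases "norm x < R + 1")
      case True
      have near: "\<forall>\<^sub>F y in nhds x. y \<in> ball 0 (R + 1)" using True by (intro eventually_nhds_in_open) auto
      have "Jw x $ k = (if k = i then \<eta> x *s J x $ i + v x $ i *s H x else J x $ k)" for k
      proof (rule inner_eq_of_has_derivative)
        show "((\<lambda>y. w y $ k) has_derivative (\<lambda>h. Jw x $ k \<bullet> h)) (at x)"
          using elim(1) unfolding has_derivative_matrix_rows by blast
        show "((\<lambda>y. w y $ k) has_derivative (\<lambda>h. (if k = i then \<eta> x *s J x $ i + v x $ i *s H x else J x $ k) \<bullet> h)) (at x)"
        proof (cases "k = i")
          case k: True
          have "((\<lambda>y. \<eta> y * v y $ i) has_derivative (\<lambda>h. \<eta> x * (J x $ i \<bullet> h) + (H x \<bullet> h) * v x $ i)) (at x)"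
            using elim(2,3) unfolding has_derivative_matrix_rows by (intro has_derivative_mult) auto
          then show ?thesis
            by (simp add: k w_def inner_add_left scalar_mult_eq_scaleR mult.commute)
        next
          case k: False
          have "((\<lambda>y. v y $ k) has_derivative (\<lambda>h. J x $ k \<bullet> h)) (at x)"
            using elim(2) unfolding has_derivative_matrix_rows by blast
          moreover have "\<forall>\<^sub>F y in nhds x. w y $ k = v y $ k"
            using near by eventually_elim (simp add: w_def k \<chi>'_def)
          ultimately show ?thesis
            using k by (simp add: has_derivative_eventually_eq)
        qed
      qed
      then have "Jw x = (\<chi> k. if k = i then \<eta> x *s J x $ i + v x $ i *s H x else J x $ k)" by (simp add: vec_eq_iff)
      then have "det (Jw x) = det (\<chi> k. if k = i then \<eta> x *s J x $ i else J x $ k) + det (\<chi> k. if k = i then v x $ i *s H x else J x $ k)"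
        using det_row_add[of i "\<lambda>_. \<eta> x *s J x $ i" "\<lambda>_. v x $ i *s H x" "\<lambda>k. J x $ k"] by simp
      also have "\<dots> = \<eta> x * det (\<chi> k. if k = i then J x $ i else J x $ k) + v x $ i * det (?JH x)"
        using det_row_mul[of i "\<eta> x" "\<lambda>_. J x $ i" "\<lambda>k. J x $ k"] det_row_mul[of i "v x $ i" "\<lambda>_. H x" "\<lambda>k. J x $ k"] by simp
      also have "(\<chi> k. if k = i then J x $ i else J x $ k) = J x" by (simp add: vec_eq_iff)
      finally show ?thesis .
    next
      case False
      then have x: "R < norm x" by simp
      have near: "\<forall>\<^sub>F y in nhds x. y \<in> - cball 0 R" using x by (intro eventually_nhds_in_open) auto
      have z: "((\<lambda>_. 0) has_derivative (\<lambda>h. (0::real^'n) \<bullet> h)) (at x)" by simp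
      have "\<forall>\<^sub>F y in nhds x. \<eta> y = 0" using near by eventually_elim (simp add: supp)
      then have "(\<eta> has_derivative (\<lambda>h. 0 \<bullet> h)) (at x)"
        by (rule has_derivative_eventually_eq[OF z])
      from inner_eq_of_has_derivative[OF elim(3) this] have "?JH x $ i = 0" by simp
      then have 1: "det (?JH x) = 0" by (intro det_zero_row(1)[of i]) (simp add: row_def vec_eq_iff)
      have "\<forall>\<^sub>F y in nhds x. w y $ i = 0" using near by eventually_elim (simp add: supp w_def)
      then have "((\<lambda>y. w y $ i) has_derivative (\<lambda>h. 0 \<bullet> h)) (at x)"
        by (rule has_derivative_eventually_eq[OF z])
      moreover have "((\<lambda>y. w y $ i) has_derivative (\<lambda>h. Jw x $ i \<bullet> h)) (at x)"
        using elim(1) unfolding has_derivative_matrix_rows by blast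
      ultimately have "Jw x $ i = 0" using inner_eq_of_has_derivative by blast
      then have "det (Jw x) = 0" by (intro det_zero_row(1)[of i]) (simp add: row_def vec_eq_iff)
      then show ?thesis using 1 supp[OF x] by simp
    qed
  qed
  then have ae: "AE x in lborel. indicator (cball 0 (R + 2)) x *\<^sub>R det (Jw x)
      = indicator (cball 0 (R + 2)) x *\<^sub>R (\<eta> x * det (J x) + v x $ i * det (?JH x))"
    by eventually_elim simp
  have JH: "(\<lambda>x. ?JH x $ k $ j) \<in> borel_measurable borel" "\<bar>?JH x $ k $ j\<bar> \<le> K" for x k j
    using J(1,2) H(1,2) by (cases "k = i"; simp)+
  note dm = borel_measurable_det[of J, OF J(1)] borel_measurable_det[of ?JH, OF JH(1)] borel_measurable_det[of Jw, OF Jw(1)]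
  have c: "continuous_on UNIV \<eta>" "continuous_on UNIV (\<lambda>x. v x $ i)"
    by (rule lipschitz_on_continuous_on, rule \<eta>) (rule lipschitz_on_continuous_on, rule lipschitz_on_component[OF v])
  have int1: "set_integrable lborel (cball 0 (R + 2)) (\<lambda>x. \<eta> x * det (J x))"
    by (rule set_integrable_continuous_times_bounded[OF c(1) dm(1) abs_det_le[OF J(2)]])
  have int2: "set_integrable lborel (cball 0 (R + 2)) (\<lambda>x. v x $ i * det (?JH x))"
    by (rule set_integrable_continuous_times_bounded[OF c(2) dm(2) abs_det_le[OF JH(2)]])
  have "(LINT x:cball 0 (R + 2)|lborel. det (Jw x)) = (LINT x:cball 0 (R + 2)|lborel. \<eta> x * det (J x) + v x $ i * det (?JH x))"
    unfolding set_lebesgue_integral_def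
  proof (rule integral_cong_AE[OF _ _ ae])
    show "(\<lambda>x. indicator (cball 0 (R + 2)) x *\<^sub>R det (Jw x)) \<in> borel_measurable lborel"
      using dm(3) by (intro borel_measurable_scaleR borel_measurable_indicator) auto
    show "(\<lambda>x. indicator (cball 0 (R + 2)) x *\<^sub>R (\<eta> x * det (J x) + v x $ i * det (?JH x))) \<in> borel_measurable lborel"
      using borel_measurable_continuous_onI[OF c(1)] borel_measurable_continuous_onI[OF c(2)] dm(1,2)
      by (intro borel_measurable_scaleR borel_measurable_indicator borel_measurable_add borel_measurable_times) auto
  qed
  also have "\<dots> = (LINT x:cball 0 (R + 2)|lborel. \<eta> x * det (J x)) + (LINT x:cball 0 (R + 2)|lborel. v x $ i * det (?JH x))"
    by (rule set_integral_add(2)[OF int1 int2])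
  finally show ?thesis using zero by simp
qed

section \<open>Weak convergence of Jacobian determinants\<close>

text \<open>Passing from \<open>w\<close> to \<open>v\<close> one component at a time, each step changes the integral by that of
\<open>\<eta>\<close> times the determinant of a Jacobian whose row \<open>i\<close> belongs to \<open>v $ i - w $ i\<close>. Integration by
parts replaces this by an integrand bounded by \<open>\<epsilon>\<close> times a constant.\<close>

lemma weighted_det_integral_difference_le:
  fixes v w :: "real^'n \<Rightarrow> real^'n" and Jv Jw :: "real^'n \<Rightarrow> real^'n^'n" and H :: "real^'n \<Rightarrow> real^'n"
  assumes v: "M-lipschitz_on UNIV v" and w: "M-lipschitz_on UNIV w" and \<eta>: "A-lipschitz_on UNIV \<eta>"
    and R: "0 < R" and C: "closed C" "C \<subseteq> cball 0 R" and supp: "\<And>x. x \<notin> C \<Longrightarrow> \<eta> x = 0"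
    and Jv: "\<And>i j. (\<lambda>x. Jv x $ i $ j) \<in> borel_measurable borel" "\<And>x i j. \<bar>Jv x $ i $ j\<bar> \<le> K"
      "ae_derivative v Jv"
    and Jw: "\<And>i j. (\<lambda>x. Jw x $ i $ j) \<in> borel_measurable borel" "\<And>x i j. \<bar>Jw x $ i $ j\<bar> \<le> K"
      "ae_derivative w Jw"
    and H: "\<And>j. (\<lambda>x. H x $ j) \<in> borel_measurable borel" "\<And>x j. \<bar>H x $ j\<bar> \<le> K"
      "AE x in lborel. (\<eta> has_derivative (\<lambda>h. H x \<bullet> h)) (at x)"
    and close: "\<And>x. x \<in> C \<Longrightarrow> norm (v x - w x) \<le> \<epsilon>" and \<epsilon>: "0 \<le> \<epsilon>"
  shows "\<bar>(LINT x:cball 0 (R + 2)|lborel. \<eta> x * det (Jv x)) - (LINT x:cball 0 (R + 2)|lborel. \<eta> x * det (Jw x))\<bar>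
    \<le> real CARD('n) * (\<epsilon> * (fact CARD('n) * K ^ CARD('n)) * measure lborel (cball (0::real^'n) (R + 2)))"
proof -
  let ?B = "cball 0 (R + 2) :: (real^'n) set"
  let ?I = "\<lambda>J. LINT x:?B|lborel. \<eta> x * det (J x)"
  let ?D = "fact CARD('n) * K ^ CARD('n) :: real"
  let ?c = "\<epsilon> * ?D * measure lborel ?B"
  have K: "0 \<le> K" using Jv(2) abs_ge_zero order_trans by blast
  have D: "0 \<le> ?D" using K by simp
  have c: "continuous_on UNIV \<eta>" by (rule lipschitz_on_continuous_on[OF \<eta>])
  \<comment> \<open>the components in \<open>S\<close> have been exchanged\<close>
  define JS where "JS S x = (\<chi> j. if j \<in> S then Jv x $ j else Jw x $ j)" for S x
  have JS: "(\<lambda>x. JS S x $ i $ j) \<in> borel_measurable borel" "\<bar>JS S x $ i $ j\<bar> \<le> K" for S x i j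
    using Jv(1,2) Jw(1,2) by (cases "i \<in> S"; simp add: JS_def)+
  have int: "set_integrable lborel ?B (\<lambda>x. \<eta> x * det (JS S x))" for S
    by (rule set_integrable_continuous_times_bounded[OF c borel_measurable_det[OF JS(1)] abs_det_le[OF JS(2)]])
  have step: "\<bar>?I (JS (insert i S)) - ?I (JS S)\<bar> \<le> ?c"
    if i: "i \<notin> S" for i S
  proof -
    define J' where "J' x = (\<chi> k. if k = i then Jv x $ i - Jw x $ i else JS S x $ k)" for x
    define v' where "v' x = (\<chi> k. if k = i then v x $ i - w x $ i else if k \<in> S then v x $ k else w x $ k)" for x
    have M: "0 \<le> M" by (rule lipschitz_on_nonneg[OF v])
    have "(M + M)-lipschitz_on UNIV (\<lambda>x. v' x $ k)" for k
    proof (cases "k = i")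
      case True
      then show ?thesis
        using lipschitz_on_diff[OF lipschitz_on_component[OF v, of i] lipschitz_on_component[OF w, of i]] by (simp add: v'_def)
    next
      case False
      then show ?thesis using M
          lipschitz_on_mono[OF lipschitz_on_component[OF v, of k], of UNIV "M + M"]
          lipschitz_on_mono[OF lipschitz_on_component[OF w, of k], of UNIV "M + M"]
        by (cases "k \<in> S") (simp_all add: v'_def)
    qed
    then have v'lip: "(real CARD('n) * (M + M))-lipschitz_on UNIV v'" by (rule lipschitz_on_from_components)
    have J'1: "(\<lambda>x. J' x $ k $ j) \<in> borel_measurable borel" for k j
      using Jv(1) Jw(1) JS(1) by (cases "k = i") (simp_all add: J'_def)
    have J'2: "\<bar>J' x $ k $ j\<bar> \<le> 2 * K" for x k j
      using Jv(2)[of x i j] Jw(2)[of x i j] JS(2)[of S x k j] K by (cases "k = i") (simp_all add: J'_def)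
    have J'3: "ae_derivative v' J'"
      using Jv(3) Jw(3)
    proof eventually_elim
      case (elim x)
      then show ?case
        unfolding has_derivative_matrix_rows
      proof (intro allI)
        fix k
        assume a: "\<forall>i. ((\<lambda>y. v y $ i) has_derivative (\<bullet>) (Jv x $ i)) (at x)" "\<forall>i. ((\<lambda>y. w y $ i) has_derivative (\<bullet>) (Jw x $ i)) (at x)"
        have "((\<lambda>y. v y $ i - w y $ i) has_derivative (\<lambda>h. Jv x $ i \<bullet> h - Jw x $ i \<bullet> h)) (at x)"
          using a by (intro has_derivative_diff) auto
        then show "((\<lambda>y. v' y $ k) has_derivative (\<bullet>) (J' x $ k)) (at x)"
          using a by (cases "k = i"; cases "k \<in> S") (simp_all add: v'_def J'_def JS_def inner_diff_left[abs_def])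
      qed
    qed
    have H2: "\<bar>H x $ j\<bar> \<le> 2 * K" for x j using H(2)[of x j] K by linarith
    have supp': "\<eta> x = 0" if "R < norm x" for x
    proof -
      have "x \<notin> C" using C(2) that by (auto simp: subset_iff)
      then show ?thesis by (rule supp)
    qed
    have parts: "?I J'
      = - (LINT x:?B|lborel. v' x $ i * det (\<chi> k. if k = i then H x else J' x $ k))"
      by (rule integral_by_parts_det[OF v'lip \<eta> R supp' J'1 J'2 J'3 H(1) H2 H(3)])
    let ?JH = "\<lambda>x. (\<chi> k. if k = i then H x else J' x $ k) :: real^'n^'n"
    have JH1: "(\<lambda>x. ?JH x $ k $ j) \<in> borel_measurable borel" for k j
      using J'1[of k j] H(1)[of j] by (cases "k = i") simp_all
    have JH2: "\<bar>?JH x $ k $ j\<bar> \<le> K" for x k j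
      using H(2)[of x j] JS(2)[of S x k j] by (cases "k = i") (simp_all add: J'_def)
    note JH = JH1 JH2
    have bound: "AE x in lborel. \<bar>v' x $ i * det (?JH x)\<bar> \<le> \<epsilon> * ?D"
      using H(3)
    proof eventually_elim
      case (elim x)
      show ?case
      proof (cases "x \<in> C")
        case True
        have "\<bar>v' x $ i\<bar> \<le> \<epsilon>" using close[OF True] component_le_norm_cart[of "v x - w x" i] by (simp add: v'_def)
        then show ?thesis unfolding abs_mult using abs_det_le[of "?JH x" K, OF JH(2)] by (intro mult_mono) (auto simp: \<epsilon>)
      next
        case False
        have "\<forall>\<^sub>F y in nhds x. y \<in> - C" using False C(1) by (intro eventually_nhds_in_open) auto
        then have ev: "\<forall>\<^sub>F y in nhds x. \<eta> y = 0" by eventually_elim (simp add: supp)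
        have z: "((\<lambda>_. 0) has_derivative (\<lambda>h. (0::real^'n) \<bullet> h)) (at x)" by simp
        have "(\<eta> has_derivative (\<lambda>h. 0 \<bullet> h)) (at x)"
          by (rule has_derivative_eventually_eq[OF z ev])
        from inner_eq_of_has_derivative[OF elim this] have "?JH x $ i = 0" by simp
        then have "det (?JH x) = 0" by (intro det_zero_row(1)[of i]) (simp add: row_def vec_eq_iff)
        then show ?thesis using \<epsilon> D by simp
      qed
    qed
    have cv: "continuous_on UNIV (\<lambda>x. v' x $ i)"
      by (rule lipschitz_on_continuous_on[OF lipschitz_on_component[OF v'lip]])
    have int': "set_integrable lborel ?B (\<lambda>x. v' x $ i * det (?JH x))"
      by (rule set_integrable_continuous_times_bounded[OF cv borel_measurable_det[OF JH(1)] abs_det_le[OF JH(2)]])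
    have intc: "integrable lborel (\<lambda>x. indicator ?B x *\<^sub>R (\<epsilon> * ?D))"
      by (intro integrable_scaleR_left integrable_real_indicator)
        (auto simp: emeasure_bounded_finite[OF bounded_cball, unfolded infinity_ennreal_def])
    have "\<bar>LINT x:?B|lborel. v' x $ i * det (?JH x)\<bar> \<le> (\<integral>x. norm (indicator ?B x *\<^sub>R (v' x $ i * det (?JH x))) \<partial>lborel)"
      unfolding set_lebesgue_integral_def real_norm_def[symmetric] by (rule integral_norm_bound)
    also have "\<dots> \<le> (\<integral>x. indicator ?B x *\<^sub>R (\<epsilon> * ?D) \<partial>lborel)"
    proof (rule integral_mono_AE[OF _ intc])
      show "integrable lborel (\<lambda>x. norm (indicator ?B x *\<^sub>R (v' x $ i * det (?JH x))))"
        using int' unfolding set_integrable_def by (rule integrable_norm)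
      show "AE x in lborel. norm (indicator ?B x *\<^sub>R (v' x $ i * det (?JH x))) \<le> indicator ?B x *\<^sub>R (\<epsilon> * ?D)"
        using bound by eventually_elim (simp add: indicator_def)
    qed
    also have "\<dots> = ?c" by (simp add: mult.commute)
    finally have est: "\<bar>LINT x:?B|lborel. \<eta> x * det (J' x)\<bar> \<le> ?c" unfolding parts by simp
    have "det (JS (insert i S) x) = det (J' x) + det (JS S x)" for x
    proof -
      have "JS (insert i S) x = (\<chi> k. if k = i then (Jv x $ i - Jw x $ i) + Jw x $ i else JS S x $ k)"
        by (auto simp: JS_def vec_eq_iff)
      moreover have "JS S x = (\<chi> k. if k = i then Jw x $ i else JS S x $ k)" using i by (auto simp: JS_def vec_eq_iff)
      ultimately show ?thesis
        using det_row_add[of i "\<lambda>_. Jv x $ i - Jw x $ i" "\<lambda>_. Jw x $ i" "\<lambda>k. JS S x $ k"] by (simp add: J'_def)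
    qed
    then have "?I (JS (insert i S)) = (LINT x:?B|lborel. \<eta> x * det (J' x) + \<eta> x * det (JS S x))"
      by (simp add: distrib_left)
    also have "\<dots> = ?I J' + ?I (JS S)"
      by (rule set_integral_add(2)[OF set_integrable_continuous_times_bounded[OF c borel_measurable_det[OF J'1] abs_det_le[OF J'2]] int])
    finally show ?thesis using est by simp
  qed
  have "\<bar>?I (JS S) - ?I (JS {})\<bar> \<le> real (card S) * ?c"
    if "finite S" for S
    using that
  proof (induction S)
    case (insert i S)
    have "real (card (insert i S)) * ?c = ?c + real (card S) * ?c" using insert by (simp add: distrib_right)
    then show ?case using step[OF insert(2)] insert.IH by linarith
  qed simp
  from this[of UNIV] show ?thesis by (simp add: JS_def)
qed

lemma weighted_det_integral_tendsto:
  fixes f :: "nat \<Rightarrow> real^'n \<Rightarrow> real^'n" and g :: "real^'n \<Rightarrow> real^'n"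
  assumes f: "\<And>k. M-lipschitz_on UNIV (f k)" and g: "M-lipschitz_on UNIV g" and \<eta>: "A-lipschitz_on UNIV \<eta>"
    and R: "0 < R" and C: "closed C" "C \<subseteq> cball 0 R" and supp: "\<And>x. x \<notin> C \<Longrightarrow> \<eta> x = 0"
    and F: "\<And>k i j. (\<lambda>x. F k x $ i $ j) \<in> borel_measurable borel" "\<And>k x i j. \<bar>F k x $ i $ j\<bar> \<le> K"
      "\<And>k. ae_derivative (f k) (F k)"
    and G: "\<And>i j. (\<lambda>x. G x $ i $ j) \<in> borel_measurable borel" "\<And>x i j. \<bar>G x $ i $ j\<bar> \<le> K"
      "ae_derivative g G"
    and lim: "uniform_limit C f g sequentially"
  shows "(\<lambda>k. LINT x:cball 0 (R + 2)|lborel. \<eta> x * det (F k x)) \<longlonglongrightarrow> (LINT x:cball 0 (R + 2)|lborel. \<eta> x * det (G x))"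
proof -
  let ?B = "cball 0 (R + 2) :: (real^'n) set"
  let ?I = "\<lambda>J. LINT x:?B|lborel. \<eta> x * det (J x)"
  have A: "0 \<le> A" by (rule lipschitz_on_nonneg[OF \<eta>])
  define H where "H x = (\<chi> j. dir_deriv A \<eta> (axis j 1) x)" for x
  define K' where "K' = max K A"
  have H1: "(\<lambda>x. H x $ j) \<in> borel_measurable borel" for j
    unfolding H_def by (simp add: borel_measurable_dir_deriv lipschitz_on_continuous_on[OF \<eta>])
  have H2: "\<bar>H x $ j\<bar> \<le> K'" for x j
    using abs_dir_deriv_le[OF A, of \<eta> "axis j 1" x] by (simp add: H_def K'_def)
  have H3: "AE x in lborel. (\<eta> has_derivative (\<lambda>h. H x \<bullet> h)) (at x)"
  proof -
    have "(\<Sum>b\<in>Basis. dir_deriv A \<eta> b x * (h \<bullet> b)) = H x \<bullet> h" for x h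
      by (simp add: sum_Basis_vec inner_axis) (simp add: H_def inner_vec_def)
    then show ?thesis using lipschitz_real_valued_ae_differentiable[OF \<eta>] by simp
  qed
  have F2: "\<bar>F k x $ i $ j\<bar> \<le> K'" and G2: "\<bar>G x $ i $ j\<bar> \<le> K'" for k x i j
    using F(2)[of k x i j] G(2)[of x i j] by (auto simp: K'_def)
  let ?c = "real CARD('n) * (fact CARD('n) * K' ^ CARD('n) * measure lborel ?B)"
  have c: "0 \<le> ?c" using A by (simp add: K'_def)
  show ?thesis
  proof (rule LIMSEQ_I)
    fix r :: real assume r: "0 < r"
    define \<epsilon> where "\<epsilon> = r / (?c + 1)"
    have \<epsilon>: "0 < \<epsilon>" using r c by (simp add: \<epsilon>_def)
    have "?c * \<epsilon> < r" using r c by (simp add: \<epsilon>_def field_simps)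
    from uniform_limitD[OF lim \<epsilon>] obtain N where N: "\<And>k x. N \<le> k \<Longrightarrow> x \<in> C \<Longrightarrow> dist (f k x) (g x) < \<epsilon>"
      unfolding eventually_sequentially by blast
    have "norm (?I (F k) - ?I G) < r" if "N \<le> k" for k
    proof -
      have "\<bar>?I (F k) - ?I G\<bar>
        \<le> real CARD('n) * (\<epsilon> * (fact CARD('n) * K' ^ CARD('n)) * measure lborel ?B)"
      proof (rule weighted_det_integral_difference_le[OF f g \<eta> R C supp F(1) F2 F(3) G(1) G2 G(3) H1 H2 H3])
        show "norm (f k x - g x) \<le> \<epsilon>" if "x \<in> C" for x using N[OF \<open>N \<le> k\<close> that] by (simp add: dist_norm)
      qed (use \<epsilon> in auto)
      also have "\<dots> = ?c * \<epsilon>" by simp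
      finally show ?thesis using \<open>?c * \<epsilon> < r\<close> by simp
    qed
    then show "\<exists>no. \<forall>n\<ge>no. norm (?I (F n) - ?I G) < r" by blast
  qed
qed

lemma set_integral_cball_eq_lebesgue_on:
  fixes c d :: "'a::euclidean_space \<Rightarrow> real"
  assumes m: "c \<in> borel_measurable borel" "d \<in> borel_measurable borel" and \<Omega>: "open \<Omega>"
    and supp: "\<And>x. x \<notin> C \<Longrightarrow> c x = 0" and C: "C \<subseteq> \<Omega>" "C \<subseteq> cball 0 r"
  shows "(LINT x:cball 0 r|lborel. c x * d x) = (\<integral>x. c x * d x \<partial>lebesgue_on \<Omega>)"
proof -
  have "\<Omega> \<in> sets lebesgue" using \<Omega> by auto
  then have "(\<integral>x. c x * d x \<partial>lebesgue_on \<Omega>) = (\<integral>x. indicator \<Omega> x *\<^sub>R (c x * d x) \<partial>lebesgue)"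
    by (subst integral_restrict_space) auto
  also have "\<dots> = (\<integral>x. indicator \<Omega> x *\<^sub>R (c x * d x) \<partial>lborel)"
    using m \<Omega> by (intro integral_completion borel_measurable_scaleR borel_measurable_indicator borel_measurable_times) auto
  also have "(\<lambda>x. indicator \<Omega> x *\<^sub>R (c x * d x)) = (\<lambda>x. indicator (cball 0 r) x *\<^sub>R (c x * d x))"
  proof
    fix x
    show "indicator \<Omega> x *\<^sub>R (c x * d x) = indicator (cball 0 r) x *\<^sub>R (c x * d x)"
    proof (cases "x \<in> C")
      case True
      then have "x \<in> \<Omega>" "x \<in> cball 0 r" using C by blast+
      then show ?thesis by simp
    qed (simp add: supp)
  qed
  finally show ?thesis by (simp add: set_lebesgue_integral_def)
qed

text \<open>The test functions for which the integrals converge are closed in \<open>L\<^sup>1\<close>, because the \<open>d k\<close> are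
uniformly bounded.\<close>

lemma weak_limit_L1_closed:
  fixes d :: "nat \<Rightarrow> 'a \<Rightarrow> real"
  assumes d: "\<And>k. d k \<in> borel_measurable N" "\<And>k x. \<bar>d k x\<bar> \<le> D"
    and d0: "d0 \<in> borel_measurable N" "\<And>x. \<bar>d0 x\<bar> \<le> D"
    and a: "integrable N a"
    and approx: "\<And>e. 0 < e \<Longrightarrow> \<exists>b. integrable N b \<and> (\<integral>x. \<bar>a x - b x\<bar> \<partial>N) \<le> e \<and>
      (\<lambda>k. \<integral>x. b x * d k x \<partial>N) \<longlonglongrightarrow> (\<integral>x. b x * d0 x \<partial>N)"
  shows "(\<lambda>k. \<integral>x. a x * d k x \<partial>N) \<longlonglongrightarrow> (\<integral>x. a x * d0 x \<partial>N)"
proof -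
  have D: "0 \<le> D" using d0(2) abs_ge_zero order_trans by blast
  have int: "integrable N (\<lambda>x. b x * c x)" "\<bar>\<integral>x. b x * c x \<partial>N\<bar> \<le> D * (\<integral>x. \<bar>b x\<bar> \<partial>N)"
    if b: "integrable N b" and c: "c \<in> borel_measurable N" "\<And>x. \<bar>c x\<bar> \<le> D" for b c
  proof -
    have ib: "integrable N (\<lambda>x. D * \<bar>b x\<bar>)" using b by simp
    have le: "\<bar>b x * c x\<bar> \<le> D * \<bar>b x\<bar>" for x
      using mult_right_mono[OF c(2)[of x] abs_ge_zero[of "b x"]] by (simp add: abs_mult mult.commute)
    show i: "integrable N (\<lambda>x. b x * c x)"
      by (rule Bochner_Integration.integrable_bound[OF ib]) (use b c D le in \<open>auto simp: abs_mult\<close>)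
    have "\<bar>\<integral>x. b x * c x \<partial>N\<bar> \<le> (\<integral>x. \<bar>b x * c x\<bar> \<partial>N)" by (rule integral_abs_bound)
    also have "\<dots> \<le> (\<integral>x. D * \<bar>b x\<bar> \<partial>N)" by (rule integral_mono[OF integrable_abs[OF i] ib]) (rule le)
    finally show "\<bar>\<integral>x. b x * c x \<partial>N\<bar> \<le> D * (\<integral>x. \<bar>b x\<bar> \<partial>N)" by simp
  qed
  show ?thesis
  proof (rule LIMSEQ_I)
    fix r :: real assume r: "0 < r"
    define e where "e = r / (4 * (D + 1))"
    have e: "0 < e" using r D by (simp add: e_def)
    have De: "D * e \<le> r / 4" using r D by (simp add: e_def field_simps)
    obtain b where b: "integrable N b" "(\<integral>x. \<bar>a x - b x\<bar> \<partial>N) \<le> e"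
      "(\<lambda>k. \<integral>x. b x * d k x \<partial>N) \<longlonglongrightarrow> (\<integral>x. b x * d0 x \<partial>N)" using approx[OF e] by blast
    have ab: "integrable N (\<lambda>x. a x - b x)" using a b by simp
    have diff: "\<bar>(\<integral>x. a x * c x \<partial>N) - (\<integral>x. b x * c x \<partial>N)\<bar> \<le> r / 4"
      if c: "c \<in> borel_measurable N" "\<And>x. \<bar>c x\<bar> \<le> D" for c
    proof -
      have "(\<integral>x. a x * c x \<partial>N) - (\<integral>x. b x * c x \<partial>N) = (\<integral>x. (a x - b x) * c x \<partial>N)"
        using int(1)[OF a c] int(1)[OF b(1) c] by (simp add: left_diff_distrib)
      then have "\<bar>(\<integral>x. a x * c x \<partial>N) - (\<integral>x. b x * c x \<partial>N)\<bar> \<le> D * (\<integral>x. \<bar>a x - b x\<bar> \<partial>N)"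
        using int(2)[OF ab c] by simp
      also have "\<dots> \<le> D * e" using b(2) D by (rule mult_left_mono)
      finally show ?thesis using De by simp
    qed
    obtain n where n: "\<And>k. n \<le> k \<Longrightarrow> norm ((\<integral>x. b x * d k x \<partial>N) - (\<integral>x. b x * d0 x \<partial>N)) < r / 4"
      using LIMSEQ_D[OF b(3), of "r / 4"] r by auto
    have "norm ((\<integral>x. a x * d k x \<partial>N) - (\<integral>x. a x * d0 x \<partial>N)) < r" if "n \<le> k" for k
      using n[OF that] diff[OF d(1)[of k] d(2)] diff[OF d0] r unfolding real_norm_def by linarith
    then show "\<exists>no. \<forall>k\<ge>no. norm ((\<integral>x. a x * d k x \<partial>N) - (\<integral>x. a x * d0 x \<partial>N)) < r" by blast
  qed
qed


text \<open>The functions \<open>max 0 (1 - m * infdist x K)\<close> decrease to the indicator of \<open>K\<close>.\<close>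

lemma exists_lipschitz_cutoff_of_compact:
  fixes K \<Omega> :: "'a::euclidean_space set" and e :: real
  assumes K: "compact K" "K \<noteq> {}" "K \<subseteq> \<Omega>" and \<Omega>: "open \<Omega>" and fin: "finite_measure (lebesgue_on \<Omega>)"
    and e: "0 < e"
  obtains \<eta> A C where "A-lipschitz_on UNIV \<eta>" "closed C" "C \<subseteq> \<Omega>" "\<And>x. x \<notin> C \<Longrightarrow> \<eta> x = 0"
    "\<And>x. 0 \<le> \<eta> x" "\<And>x. \<eta> x \<le> 1" "(\<integral>x. \<bar>indicator K x - \<eta> x\<bar> \<partial>lebesgue_on \<Omega>) \<le> e"
proof -
  interpret N: finite_measure "lebesgue_on \<Omega>" by (rule fin)
  obtain \<delta> where \<delta>: "0 < \<delta>" "(\<Union>x\<in>K. cball x \<delta>) \<subseteq> \<Omega>"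
    using compact_subset_open_imp_cball_epsilon_subset[OF K(1) \<Omega> K(3)] by blast
  define b where "b m x = max 0 (1 - real m * infdist x K)" for m x
  have b01: "0 \<le> b m x" "b m x \<le> 1" for m x by (auto simp: b_def infdist_nonneg)
  have blip: "(real m)-lipschitz_on UNIV (b m)" for m
  proof (rule lipschitz_onI)
    fix x y :: 'a
    have "infdist x K \<le> infdist y K + dist x y" "infdist y K \<le> infdist x K + dist x y"
      using infdist_triangle[of x K y] infdist_triangle[of y K x] by (auto simp: dist_commute)
    then have "real m * infdist x K \<le> real m * infdist y K + real m * dist x y"
      "real m * infdist y K \<le> real m * infdist x K + real m * dist x y"
      by (metis distrib_left mult_left_mono of_nat_0_le_iff)+
    then show "dist (b m x) (b m y) \<le> real m * dist x y"
      by (simp add: b_def dist_real_def abs_le_iff) (auto simp: max_def)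
  qed simp
  have bm: "b m \<in> borel_measurable (lebesgue_on \<Omega>)" for m
    using borel_measurable_continuous_onI[OF lipschitz_on_continuous_on[OF blip[of m]]]
    by (intro measurable_restrict_space1 measurable_completion) auto
  have Km: "indicator K \<in> borel_measurable (lebesgue_on \<Omega>)"
    by (intro measurable_restrict_space1 borel_measurable_indicator fmeasurableD lmeasurable_compact K(1))
  have "(\<lambda>m. \<integral>x. \<bar>indicator K x - b m x\<bar> \<partial>lebesgue_on \<Omega>) \<longlonglongrightarrow> (\<integral>x. 0 \<partial>lebesgue_on \<Omega>)"
  proof (rule integral_dominated_convergence[where w = "\<lambda>_. 2"])
    show "AE x in lebesgue_on \<Omega>. (\<lambda>m. \<bar>indicator K x - b m x\<bar>) \<longlonglongrightarrow> 0"
    proof (rule AE_I2)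
      fix x
      show "(\<lambda>m. \<bar>indicator K x - b m x\<bar>) \<longlonglongrightarrow> 0"
      proof (cases "x \<in> K")
        case True
        then show ?thesis by (simp add: b_def)
      next
        case False
        then have pos: "0 < infdist x K"
          using in_closed_iff_infdist_zero[OF compact_imp_closed[OF K(1)] K(2), of x] infdist_nonneg[of x K] by linarith
        obtain m0 where m0: "1 / infdist x K \<le> real m0" using real_arch_simple by blast
        have "\<bar>indicator K x - b m x\<bar> = 0" if "m0 \<le> m" for m
        proof -
          have "1 / infdist x K \<le> real m" using m0 that by linarith
          then have "1 \<le> real m * infdist x K" using pos by (simp add: field_simps)
          then show ?thesis using False by (simp add: b_def)
        qed
        then have "\<forall>\<^sub>F m in sequentially. \<bar>indicator K x - b m x\<bar> = 0" unfolding eventually_sequentially by blast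
        then show ?thesis by (rule tendsto_eventually)
      qed
    qed
    show "AE x in lebesgue_on \<Omega>. norm \<bar>indicator K x - b m x\<bar> \<le> 2" for m
    proof (rule AE_I2)
      fix x
      show "norm \<bar>indicator K x - b m x\<bar> \<le> 2"
        using b01[of m x] by (cases "x \<in> K") (auto simp: abs_le_iff)
    qed
  qed (auto intro!: borel_measurable_abs borel_measurable_diff bm Km)
  then have "\<forall>\<^sub>F m in sequentially. (\<integral>x. \<bar>indicator K x - b m x\<bar> \<partial>lebesgue_on \<Omega>) < e"
    using e by (intro order_tendstoD(2)[where y = 0]) auto
  moreover have "\<forall>\<^sub>F m in sequentially. 1 / \<delta> \<le> real m"
    using filterlim_real_sequentially by (simp add: filterlim_at_top)
  ultimately have "\<forall>\<^sub>F m in sequentially. (\<integral>x. \<bar>indicator K x - b m x\<bar> \<partial>lebesgue_on \<Omega>) < e \<and> 1 / \<delta> \<le> real m"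
    by eventually_elim simp
  then obtain m where m: "(\<integral>x. \<bar>indicator K x - b m x\<bar> \<partial>lebesgue_on \<Omega>) < e" "1 / \<delta> \<le> real m"
    using eventually_happens'[OF sequentially_bot] by blast
  define C where "C = {x. infdist x K \<le> \<delta>}"
  have "closed C" unfolding C_def by (intro closed_Collect_le continuous_intros)
  moreover have "C \<subseteq> \<Omega>"
  proof
    fix x assume "x \<in> C"
    obtain y where "y \<in> K" "infdist x K = dist x y" using infdist_attains_inf[OF compact_imp_closed[OF K(1)] K(2)] by blast
    then have "x \<in> cball y \<delta>" using \<open>x \<in> C\<close> by (simp add: C_def dist_commute)
    then show "x \<in> \<Omega>" using \<open>y \<in> K\<close> \<delta>(2) by blast
  qed
  moreover have "b m x = 0" if "x \<notin> C" for x
  proof -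
    have "1 \<le> real m * \<delta>" using m(2) \<delta>(1) by (simp add: field_simps)
    also have "\<dots> \<le> real m * infdist x K" using that by (intro mult_left_mono) (auto simp: C_def)
    finally show ?thesis by (simp add: b_def)
  qed
  ultimately show ?thesis using that[of "real m" "b m" C] blip b01 m(1) by auto
qed

text \<open>Three approximation steps in \<open>L\<^sup>1\<close>: indicators of compact sets by Lipschitz cutoffs, indicators of
measurable sets by those of compact subsets, and bounded functions by finite combinations of
indicators of level sets.\<close>

lemma weak_limit_bounded_test:
  fixes d :: "nat \<Rightarrow> 'a::euclidean_space \<Rightarrow> real"
  assumes \<Omega>: "open \<Omega>" "bounded \<Omega>"
    and d: "\<And>k. d k \<in> borel_measurable (lebesgue_on \<Omega>)" "\<And>k x. \<bar>d k x\<bar> \<le> D"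
    and d0: "d0 \<in> borel_measurable (lebesgue_on \<Omega>)" "\<And>x. \<bar>d0 x\<bar> \<le> D"
    and test: "\<And>\<eta> A C. A-lipschitz_on UNIV \<eta> \<Longrightarrow> closed C \<Longrightarrow> C \<subseteq> \<Omega> \<Longrightarrow> (\<And>x. x \<notin> C \<Longrightarrow> \<eta> x = 0) \<Longrightarrow>
      (\<lambda>k. \<integral>x. \<eta> x * d k x \<partial>lebesgue_on \<Omega>) \<longlonglongrightarrow> (\<integral>x. \<eta> x * d0 x \<partial>lebesgue_on \<Omega>)"
    and a: "a \<in> borel_measurable (lebesgue_on \<Omega>)" "\<And>x. \<bar>a x\<bar> \<le> B"
  shows "(\<lambda>k. \<integral>x. a x * d k x \<partial>lebesgue_on \<Omega>) \<longlonglongrightarrow> (\<integral>x. a x * d0 x \<partial>lebesgue_on \<Omega>)"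
proof -
  let ?N = "lebesgue_on \<Omega>"
  let ?conv = "\<lambda>a. (\<lambda>k. \<integral>x. a x * d k x \<partial>?N) \<longlonglongrightarrow> (\<integral>x. a x * d0 x \<partial>?N)"
  have \<Omega>m: "\<Omega> \<in> lmeasurable" using \<Omega> by (simp add: lmeasurable_open)
  have fin: "finite_measure ?N"
    by (rule finite_measure_lebesgue_on[OF \<Omega>m])
  interpret N: finite_measure ?N by (rule fin)
  have ind_m: "indicator E \<in> borel_measurable ?N" if "E \<in> sets lebesgue" for E :: "'a set"
    using that by (intro measurable_restrict_space1 borel_measurable_indicator)
  have ind_i: "integrable ?N (indicator E :: 'a \<Rightarrow> real)" if "E \<in> sets lebesgue" for E :: "'a set"
    using ind_m[OF that] by (intro N.integrable_const_bound[where B = 1]) auto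
  have lip_m: "\<eta> \<in> borel_measurable ?N" if "A-lipschitz_on UNIV \<eta>" for \<eta> :: "'a \<Rightarrow> real" and A
    using borel_measurable_continuous_onI[OF lipschitz_on_continuous_on[OF that]]
    by (intro measurable_restrict_space1 measurable_completion) auto
  have K: "?conv (indicator K)" if K: "compact K" "K \<subseteq> \<Omega>" for K
  proof (cases "K = {}")
    case False
    show ?thesis
    proof (rule weak_limit_L1_closed[OF d d0])
      show "integrable ?N (indicator K :: 'a \<Rightarrow> real)" by (intro ind_i fmeasurableD lmeasurable_compact K(1))
      fix e :: real assume e: "0 < e"
      obtain \<eta> A C where \<eta>: "A-lipschitz_on UNIV \<eta>" "closed C" "C \<subseteq> \<Omega>" "\<And>x. x \<notin> C \<Longrightarrow> \<eta> x = 0"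
        "\<And>x. 0 \<le> \<eta> x" "\<And>x. \<eta> x \<le> 1" "(\<integral>x. \<bar>indicator K x - \<eta> x\<bar> \<partial>?N) \<le> e"
        by (rule exists_lipschitz_cutoff_of_compact[OF K(1) False K(2) \<Omega>(1) fin e]) (rule that)
      have "integrable ?N \<eta>"
        using \<eta>(5,6) by (intro N.integrable_const_bound[where B = 1] lip_m[OF \<eta>(1)]) auto
      then show "\<exists>b. integrable ?N b \<and> (\<integral>x. \<bar>indicator K x - b x\<bar> \<partial>?N) \<le> e \<and> ?conv b"
        using test[OF \<eta>(1,2,3,4)] \<eta>(7) by blast
    qed
  qed simp
  have E: "?conv (indicator E)" if E: "E \<in> sets lebesgue" "E \<subseteq> \<Omega>" for E
  proof (rule weak_limit_L1_closed[OF d d0 ind_i[OF E(1)]])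
    fix e :: real assume e: "0 < e"
    obtain T where T: "closed T" "T \<subseteq> E" "E - T \<in> lmeasurable" "emeasure lebesgue (E - T) < ennreal e"
      using sets_lebesgue_inner_closed[OF E(1) e] by blast
    have "compact T" using T(1,2) E(2) \<Omega>(2) bounded_subset compact_eq_bounded_closed by blast
    have "ennreal (measure lebesgue (E - T)) < ennreal e" using T(3,4) by (simp add: emeasure_eq_measure2)
    then have "measure lebesgue (E - T) \<le> e" by (simp add: ennreal_less_iff)
    moreover have "(\<integral>x. \<bar>indicator E x - indicator T x\<bar> \<partial>?N) = measure lebesgue (E - T)"
    proof -
      have "(\<lambda>x. \<bar>indicator E x - indicator T x\<bar> :: real) = indicator (E - T)" using T(2) by (auto simp: fun_eq_iff indicator_def)
      moreover have "(\<integral>x. indicator (E - T) x \<partial>?N) = measure ?N ((E - T) \<inter> space ?N)" by simp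
      moreover have "(E - T) \<inter> space ?N = E - T" using E(2) by (auto simp: space_restrict_space)
      moreover have "measure ?N (E - T) = measure lebesgue (E - T)"
        using E \<Omega>m by (intro measure_restrict_space) auto
      ultimately show ?thesis by simp
    qed
    ultimately show "\<exists>b. integrable ?N b \<and> (\<integral>x. \<bar>indicator E x - b x\<bar> \<partial>?N) \<le> e \<and> ?conv b"
      using K[OF \<open>compact T\<close>] T(1,2) E(2) by (intro exI[of _ "indicator T"] conjI ind_i) auto
  qed
  show ?thesis
  proof (rule weak_limit_L1_closed[OF d d0])
    show "integrable ?N a" using a by (intro N.integrable_const_bound[where B = B]) auto
    fix e :: real assume e: "0 < e"
    define \<mu> where "\<mu> = measure ?N (space ?N)"
    obtain n0 :: nat where n0: "\<mu> / e \<le> real n0" using real_arch_simple by blast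
    define n where "n = Suc n0"
    have n: "0 < n" "\<mu> / e \<le> real n" using n0 by (auto simp: n_def)
    \<comment> \<open>the values of \<open>a\<close> are rounded down to multiples of \<open>1 / n\<close>, of which only those up to \<open>m / n\<close> occur\<close>
    define m where "m = \<lceil>real n * B\<rceil> + 1"
    define Ej where "Ej j = {x \<in> \<Omega>. \<lfloor>real n * a x\<rfloor> = j}" for j
    define b where "b x = (\<Sum>j\<in>{-m..m}. (of_int j / real n) * indicator (Ej j) x)" for x
    have Ej: "Ej j \<in> sets lebesgue" "Ej j \<subseteq> \<Omega>" for j
    proof -
      have "{x \<in> space ?N. \<lfloor>real n * a x\<rfloor> = j} \<in> sets ?N" using a(1) by measurable
      then show "Ej j \<in> sets lebesgue" using \<Omega>m by (simp add: Ej_def space_restrict_space sets_restrict_space_iff fmeasurableD)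
      show "Ej j \<subseteq> \<Omega>" by (auto simp: Ej_def)
    qed
    have bx: "b x = of_int \<lfloor>real n * a x\<rfloor> / real n" if x: "x \<in> \<Omega>" for x
    proof -
      have "\<bar>real n * a x\<bar> \<le> real n * B" using a(2)[of x] by (simp add: abs_mult mult_left_mono)
      then have "\<lfloor>real n * a x\<rfloor> \<in> {-m..m}" unfolding m_def by (auto simp: abs_le_iff; linarith)
      moreover have "b x = (\<Sum>j\<in>{-m..m}. if j = \<lfloor>real n * a x\<rfloor> then of_int j / real n else 0)"
        unfolding b_def using x by (intro sum.cong) (auto simp: Ej_def)
      ultimately show ?thesis by simp
    qed
    have int_b: "integrable ?N b"
      unfolding b_def by (intro Bochner_Integration.integrable_sum integrable_mult_right ind_i Ej)
    have "\<bar>a x - b x\<bar> \<le> 1 / real n" if "x \<in> space ?N" for x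
    proof -
      have "b x = of_int \<lfloor>real n * a x\<rfloor> / real n" using that by (intro bx) (simp add: space_restrict_space)
      moreover have "a x = (real n * a x) / real n" using n by simp
      ultimately have "a x - b x = (real n * a x - of_int \<lfloor>real n * a x\<rfloor>) / real n" by (simp add: diff_divide_distrib)
      moreover have "0 \<le> real n * a x - of_int \<lfloor>real n * a x\<rfloor>" "real n * a x - of_int \<lfloor>real n * a x\<rfloor> \<le> 1" by linarith+
      ultimately show ?thesis using n by (simp add: divide_right_mono)
    qed
    then have "(\<integral>x. \<bar>a x - b x\<bar> \<partial>?N) \<le> (\<integral>x. 1 / real n \<partial>?N)"
      using int_b a by (intro integral_mono integrable_abs Bochner_Integration.integrable_diff N.integrable_const_bound[where B = B and f = a]) auto
    also have "\<dots> = \<mu> / real n" by (simp add: \<mu>_def)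
    also have "\<dots> \<le> e" using n e by (simp add: field_simps)
    finally have 1: "(\<integral>x. \<bar>a x - b x\<bar> \<partial>?N) \<le> e" .
    have eq: "(\<integral>x. b x * c x \<partial>?N) = (\<Sum>j\<in>{-m..m}. (of_int j / real n) * (\<integral>x. indicator (Ej j) x * c x \<partial>?N))"
      if c: "c \<in> borel_measurable ?N" "\<And>x. \<bar>c x\<bar> \<le> D" for c
    proof -
      have i: "integrable ?N (\<lambda>x. indicator (Ej j) x * c x)" for j
      proof (rule N.integrable_const_bound[where B = D])
        show "AE x in ?N. norm (indicator (Ej j) x * c x) \<le> D"
          using c(2) order_trans[OF abs_ge_zero c(2)] by (intro AE_I2) (simp add: indicator_def)
        show "(\<lambda>x. indicator (Ej j) x * c x) \<in> borel_measurable ?N"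
          by (intro borel_measurable_times ind_m Ej c(1))
      qed
      have "(\<integral>x. b x * c x \<partial>?N) = (\<integral>x. (\<Sum>j\<in>{-m..m}. (of_int j / real n) * (indicator (Ej j) x * c x)) \<partial>?N)"
        by (simp add: b_def sum_distrib_right mult.assoc)
      also have "\<dots> = (\<Sum>j\<in>{-m..m}. (\<integral>x. (of_int j / real n) * (indicator (Ej j) x * c x) \<partial>?N))"
        by (rule Bochner_Integration.integral_sum) (intro integrable_mult_right i)
      finally show ?thesis by simp
    qed
    have "?conv b"
      unfolding eq[OF d] eq[OF d0] by (intro tendsto_sum tendsto_mult tendsto_const E Ej)
    then show "\<exists>b. integrable ?N b \<and> (\<integral>x. \<bar>a x - b x\<bar> \<partial>?N) \<le> e \<and> ?conv b" using int_b 1 by blast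
  qed
qed

section \<open>Lower semicontinuity\<close>

lemma ereal_integral_eq_integral:
  assumes f: "integrable M f"
  shows "ereal_integral M f = ereal (integral\<^sup>L M f)"
proof -
  have fin: "(\<integral>\<^sup>+x. ennreal (f x) \<partial>M) < \<infinity>" "(\<integral>\<^sup>+x. ennreal (- f x) \<partial>M) < \<infinity>"
    using f by (auto simp: real_integrable_def less_top)
  have e: "enn2ereal t = ereal (enn2real t)" if "t < \<infinity>" for t
    using that by (cases t) (auto simp: enn2ereal_ennreal)
  show ?thesis unfolding ereal_integral_def real_lebesgue_integral_def[OF f] by (simp add: e[OF fin(1)] e[OF fin(2)])
qed

lemma ereal_integral_cong_AE:
  assumes "AE x in M. f x = g x"
  shows "ereal_integral M f = ereal_integral M g"
proof -
  have "(\<integral>\<^sup>+x. ennreal (f x) \<partial>M) = (\<integral>\<^sup>+x. ennreal (g x) \<partial>M)"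
    "(\<integral>\<^sup>+x. ennreal (- f x) \<partial>M) = (\<integral>\<^sup>+x. ennreal (- g x) \<partial>M)"
    using assms by (auto intro!: nn_integral_cong_AE)
  then show ?thesis by (simp add: ereal_integral_def)
qed

lemma ereal_integral_mono_AE:
  assumes "AE x in M. f x \<le> g x"
  shows "ereal_integral M f \<le> ereal_integral M g"
  unfolding ereal_integral_def
proof (rule ereal_minus_mono)
  have "AE x in M. ennreal (f x) \<le> ennreal (g x)" using assms by eventually_elim (rule ennreal_leI)
  then show "enn2ereal (\<integral>\<^sup>+x. ennreal (f x) \<partial>M) \<le> enn2ereal (\<integral>\<^sup>+x. ennreal (g x) \<partial>M)"
    unfolding less_eq_ennreal.rep_eq[symmetric] by (rule nn_integral_mono_AE)
  have "AE x in M. ennreal (- g x) \<le> ennreal (- f x)" using assms by eventually_elim (rule ennreal_leI, simp)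
  then show "enn2ereal (\<integral>\<^sup>+x. ennreal (- g x) \<partial>M) \<le> enn2ereal (\<integral>\<^sup>+x. ennreal (- f x) \<partial>M)"
    unfolding less_eq_ennreal.rep_eq[symmetric] by (rule nn_integral_mono_AE)
qed

text \<open>The entries of the inverse are bounded by \<open>1 / c\<close>, which bounds its determinant from above.\<close>

lemma abs_det_ge:
  fixes A :: "real^'n^'n"
  assumes c: "0 < c" and A: "\<And>h. c * norm h \<le> norm (A *v h)"
  shows "1 / (fact CARD('n) * (1 / c) ^ CARD('n)) \<le> \<bar>det A\<bar>"
proof -
  have "\<forall>h. A *v h = 0 \<longrightarrow> h = 0"
  proof (intro allI impI)
    fix h assume "A *v h = 0"
    then have "c * norm h \<le> 0" using A[of h] by simp
    then show "h = 0" using c by (simp add: mult_le_0_iff)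
  qed
  then obtain B where B: "B ** A = mat 1" using matrix_left_invertible_ker[of A] by blast
  then have AB: "A ** B = mat 1" by (rule matrix_left_right_inverse[THEN iffD1])
  have "\<bar>B $ i $ j\<bar> \<le> 1 / c" for i j
  proof -
    have "c * norm (B *v axis j 1) \<le> norm (A *v (B *v axis j 1))" by (rule A)
    also have "\<dots> = 1" by (simp add: matrix_vector_mul_assoc AB)
    finally have "norm (B *v axis j 1) \<le> 1 / c" using c by (simp add: field_simps)
    moreover have "B $ i $ j = (B *v axis j 1) $ i"
      by (simp add: matrix_vector_mult_def axis_def mult_delta_right)
    ultimately show ?thesis using component_le_norm_cart[of "B *v axis j 1" i] by simp
  qed
  then have dB: "\<bar>det B\<bar> \<le> fact CARD('n) * (1 / c) ^ CARD('n)" by (rule abs_det_le)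
  have "det A * det B = 1" using AB by (metis det_mul det_I)
  then have AB1: "\<bar>det A\<bar> * \<bar>det B\<bar> = 1" by (metis abs_mult abs_one)
  then have "1 \<le> \<bar>det A\<bar> * (fact CARD('n) * (1 / c) ^ CARD('n))"
    using mult_left_mono[OF dB abs_ge_zero[of "det A"]] by simp
  moreover have "0 < (fact CARD('n) * (1 / c) ^ CARD('n) :: real)" using c by simp
  ultimately show ?thesis by (simp only: pos_divide_le_eq)
qed

lemma jacobian_eq:
  fixes f :: "real^'n \<Rightarrow> real^'m"
  assumes "(f has_derivative (\<lambda>h. A *v h)) (at x)"
  shows "jacobian f (at x) = A"
  unfolding jacobian_def frechet_derivative_at[OF assms, symmetric] by (rule matrix_of_matrix_vector_mul)

text \<open>All maps are extended to Lipschitz maps of the whole space, where Rademacher's theorem provides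
bounded Borel Jacobians; these agree with the given Jacobians almost everywhere on the open set.\<close>

lemma jacobian_determinants_converge_weakly:
  fixes \<phi> :: "nat \<Rightarrow> real^'n \<Rightarrow> real^'n" and u :: "real^'n \<Rightarrow> real^'n"
  assumes \<Omega>: "open \<Omega>" "bounded \<Omega>"
    and lip: "\<And>k. L-lipschitz_on \<Omega> (\<phi> k)" and ulip: "L-lipschitz_on \<Omega> u"
    and lim: "uniform_limit \<Omega> \<phi> u sequentially"
  obtains D d d0 where
    "\<And>k. AE x in lebesgue_on \<Omega>. \<phi> k differentiable (at x) \<and> det (jacobian (\<phi> k) (at x)) = d k x"
    "AE x in lebesgue_on \<Omega>. u differentiable (at x) \<and> det (jacobian u (at x)) = d0 x"
    "\<And>k. d k \<in> borel_measurable (lebesgue_on \<Omega>)" "\<And>k x. \<bar>d k x\<bar> \<le> D"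
    "d0 \<in> borel_measurable (lebesgue_on \<Omega>)" "\<And>x. \<bar>d0 x\<bar> \<le> D"
    "\<forall>a B. a \<in> borel_measurable (lebesgue_on \<Omega>) \<longrightarrow> (\<forall>x. \<bar>a x\<bar> \<le> B) \<longrightarrow>
      (\<lambda>k. \<integral>x. a x * d k x \<partial>lebesgue_on \<Omega>) \<longlonglongrightarrow> (\<integral>x. a x * d0 x \<partial>lebesgue_on \<Omega>)"
proof -
  define M where "M = real CARD('n) * L"
  have "\<exists>v J. M-lipschitz_on UNIV v \<and> (\<forall>x\<in>\<Omega>. v x = f x) \<and> (\<forall>i j. (\<lambda>x. J x $ i $ j) \<in> borel_measurable borel) \<and>
     (\<forall>x i j. \<bar>J x $ i $ j\<bar> \<le> M) \<and> (ae_derivative v J)"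
    if f: "L-lipschitz_on \<Omega> f" for f :: "real^'n \<Rightarrow> real^'n"
  proof -
    obtain v where v: "M-lipschitz_on UNIV v" "\<forall>x\<in>\<Omega>. v x = f x" using lipschitz_vec_extension[OF f] M_def by blast
    show ?thesis by (rule lipschitz_ae_jacobian[OF v(1)]) (use v in blast)
  qed
  note ext = this
  have "\<forall>k. \<exists>v J. M-lipschitz_on UNIV v \<and> (\<forall>x\<in>\<Omega>. v x = \<phi> k x) \<and> (\<forall>i j. (\<lambda>x. J x $ i $ j) \<in> borel_measurable borel) \<and>
     (\<forall>x i j. \<bar>J x $ i $ j\<bar> \<le> M) \<and> (ae_derivative v J)"
    using ext[OF lip] by blast
  then obtain \<Phi> F where F: "\<forall>k. M-lipschitz_on UNIV (\<Phi> k) \<and> (\<forall>x\<in>\<Omega>. \<Phi> k x = \<phi> k x) \<and> (\<forall>i j. (\<lambda>x. F k x $ i $ j) \<in> borel_measurable borel) \<and>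
     (\<forall>x i j. \<bar>F k x $ i $ j\<bar> \<le> M) \<and> (ae_derivative (\<Phi> k) (F k))"
    unfolding choice_iff by (elim exE) (rule that)
  obtain U G where U: "M-lipschitz_on UNIV U \<and> (\<forall>x\<in>\<Omega>. U x = u x) \<and> (\<forall>i j. (\<lambda>x. G x $ i $ j) \<in> borel_measurable borel) \<and>
     (\<forall>x i j. \<bar>G x $ i $ j\<bar> \<le> M) \<and> (ae_derivative U G)"
    using ext[OF ulip] by (elim exE) (rule that)
  have \<Omega>m: "\<Omega> \<in> sets lebesgue" using \<Omega>(1) by auto
  have ae: "AE x in lebesgue_on \<Omega>. f differentiable (at x) \<and> det (jacobian f (at x)) = det (J x)"
    if J: "ae_derivative v J" and v: "\<forall>x\<in>\<Omega>. v x = f x"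
    for f v :: "real^'n \<Rightarrow> real^'n" and J
  proof -
    have "AE x in lebesgue. (v has_derivative (\<lambda>h. J x *v h)) (at x)" using J by (rule AE_completion)
    then have "AE x in lebesgue_on \<Omega>. (v has_derivative (\<lambda>h. J x *v h)) (at x)"
      by (subst AE_restrict_space_iff) (use \<Omega>m in \<open>auto elim: eventually_mono\<close>)
    moreover have "AE x in lebesgue_on \<Omega>. x \<in> \<Omega>" by (rule AE_I2) simp
    ultimately show ?thesis
    proof eventually_elim
      case (elim x)
      have "\<forall>\<^sub>F y in nhds x. y \<in> \<Omega>" using elim \<Omega>(1) by (intro eventually_nhds_in_open)
      then have "\<forall>\<^sub>F y in nhds x. f y = v y" by eventually_elim (use v in auto)
      then have "(f has_derivative (\<lambda>h. J x *v h)) (at x)" by (rule has_derivative_eventually_eq[OF elim(1)])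
      then show ?case by (auto simp: jacobian_eq differentiable_def)
    qed
  qed
  define D where "D = fact CARD('n) * M ^ CARD('n)"
  have dF: "(\<lambda>x. det (F k x)) \<in> borel_measurable borel" and dG: "(\<lambda>x. det (G x)) \<in> borel_measurable borel" for k
    using F U by (auto intro: borel_measurable_det)
  have leb: "f \<in> borel_measurable (lebesgue_on \<Omega>)" if "f \<in> borel_measurable borel" for f :: "real^'n \<Rightarrow> real"
    using that by (intro measurable_restrict_space1 measurable_completion) auto
  have DF: "\<bar>det (F k x)\<bar> \<le> D" and DG: "\<bar>det (G x)\<bar> \<le> D" for k x
    unfolding D_def using F U by (auto intro: abs_det_le)
  obtain R where R: "0 < R" "\<Omega> \<subseteq> cball 0 R"
    using \<Omega>(2) unfolding bounded_pos by (auto simp: subset_iff)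
  have test: "(\<lambda>k. \<integral>x. \<eta> x * det (F k x) \<partial>lebesgue_on \<Omega>) \<longlonglongrightarrow> (\<integral>x. \<eta> x * det (G x) \<partial>lebesgue_on \<Omega>)"
    if \<eta>: "A-lipschitz_on UNIV \<eta>" "closed C" "C \<subseteq> \<Omega>" "\<And>x. x \<notin> C \<Longrightarrow> \<eta> x = 0" for \<eta> A C
  proof -
    have \<eta>m: "\<eta> \<in> borel_measurable borel"
      by (rule borel_measurable_continuous_onI[OF lipschitz_on_continuous_on[OF \<eta>(1)]])
    have CR: "C \<subseteq> cball 0 R" "C \<subseteq> cball 0 (R + 2)" using \<eta>(3) R by (auto simp: subset_iff)
    have "uniform_limit C \<phi> u sequentially" by (rule uniform_limit_on_subset[OF lim \<eta>(3)])
    then have ul: "uniform_limit C \<Phi> U sequentially"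
      by (rule uniform_limit_cong'[THEN iffD1, rotated 2]) (use F U \<eta>(3) in auto)
    have "(\<lambda>k. LINT x:cball 0 (R + 2)|lborel. \<eta> x * det (F k x)) \<longlonglongrightarrow> (LINT x:cball 0 (R + 2)|lborel. \<eta> x * det (G x))"
      by (rule weighted_det_integral_tendsto[OF _ _ \<eta>(1) R(1) \<eta>(2) CR(1) \<eta>(4) _ _ _ _ _ _ ul, where M = M and K = M])
        (use F U in auto)
    moreover have "(LINT x:cball 0 (R + 2)|lborel. \<eta> x * det (F k x)) = (\<integral>x. \<eta> x * det (F k x) \<partial>lebesgue_on \<Omega>)" for k
      by (rule set_integral_cball_eq_lebesgue_on[OF \<eta>m dF \<Omega>(1) \<eta>(4) \<eta>(3) CR(2)])
    moreover have "(LINT x:cball 0 (R + 2)|lborel. \<eta> x * det (G x)) = (\<integral>x. \<eta> x * det (G x) \<partial>lebesgue_on \<Omega>)"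
      by (rule set_integral_cball_eq_lebesgue_on[OF \<eta>m dG \<Omega>(1) \<eta>(4) \<eta>(3) CR(2)])
    ultimately show ?thesis by simp
  qed
  show ?thesis
  proof (rule that[of "\<lambda>k x. det (F k x)" "\<lambda>x. det (G x)" D])
    show "AE x in lebesgue_on \<Omega>. \<phi> k differentiable (at x) \<and> det (jacobian (\<phi> k) (at x)) = det (F k x)" for k
      using F by (intro ae[of "\<Phi> k"]) auto
    show "AE x in lebesgue_on \<Omega>. u differentiable (at x) \<and> det (jacobian u (at x)) = det (G x)"
      using U by (intro ae[of U]) auto
    show "\<forall>a B. a \<in> borel_measurable (lebesgue_on \<Omega>) \<longrightarrow> (\<forall>x. \<bar>a x\<bar> \<le> B) \<longrightarrow>
      (\<lambda>k. \<integral>x. a x * det (F k x) \<partial>lebesgue_on \<Omega>) \<longlonglongrightarrow> (\<integral>x. a x * det (G x) \<partial>lebesgue_on \<Omega>)"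
      by (intro allI impI weak_limit_bounded_test[OF \<Omega> leb[OF dF] DF leb[OF dG] DG test]) auto
  qed (rule leb[OF dF] DF leb[OF dG] DG)+
qed


theorem proposition6p1:
  fixes g h :: "real^'n \<Rightarrow> real"
    and p :: "real list \<Rightarrow> real"
    and w :: "real^'n^'n \<Rightarrow> real"
    and \<Omega> :: "(real^'n) set"
    and \<phi> :: "nat \<Rightarrow> real^'n \<Rightarrow> real^'n"
    and u :: "real^'n \<Rightarrow> real^'n"
    and L :: real
  assumes g_cont: "continuous_on pos_orthant g"
    and g_sym: "symmetric_on pos_orthant g"
    and h_def: "\<And>x. h x = g (\<chi> i. exp (x $ i))"
    and h_convex: "convex_on UNIV h"
    and p_def: "\<And>x :: real^'n. p (partial_sums x) = h x"
    and p_mono: "nonincreasing_in_each_argument_on (range (partial_sums :: real^'n \<Rightarrow> real list)) p"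
    and w_def: "\<And>F. F \<in> GL_pos \<Longrightarrow> w F = g (singular_values F)"
    and Omega_open: "open \<Omega>"
    and Omega_bounded: "bounded \<Omega>"
    and Omega_boundary: "piecewise_smooth_boundary \<Omega>"
    and phi_lipschitz: "\<And>k. lipschitz_on L \<Omega> (\<phi> k)"
    and phi_GL: "\<And>k. AE x in lebesgue_on \<Omega>.
                  \<phi> k differentiable (at x) \<and> jacobian (\<phi> k) (at x) \<in> GL_pos"
    and phi_conv: "uniform_limit \<Omega> \<phi> u sequentially"
    and u_maps: "u ` \<Omega> \<subseteq> \<Omega>"
    and u_bilip: "bi_lipschitz_on \<Omega> u"
  shows "liminf (\<lambda>k. ereal_integral (lebesgue_on \<Omega>) (\<lambda>x. w (jacobian (\<phi> k) (at x))))
           \<ge> ereal_integral (lebesgue_on \<Omega>) (\<lambda>x. w (jacobian u (at x)))"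
proof -
  let ?N = "lebesgue_on \<Omega>"
  interpret N: finite_measure ?N
    by (rule finite_measure_lebesgue_on) (simp add: lmeasurable_open Omega_open Omega_bounded)
  have "symmetric_on UNIV h"
    unfolding symmetric_on_def
  proof (intro allI impI ballI)
    fix \<pi> :: "'n \<Rightarrow> 'n" and x :: "real^'n" assume \<pi>: "\<pi> permutes UNIV"
    have "(\<chi> i. exp (x $ i)) \<in> pos_orthant" by (simp add: pos_orthant_def)
    then have "g (\<chi> i. (\<chi> j. exp (x $ j)) $ \<pi> i) = g (\<chi> i. exp (x $ i))"
      using g_sym \<pi> unfolding symmetric_on_def by blast
    then show "h (\<chi> i. x $ \<pi> i) = h x" by (simp add: h_def)
  qed
  from symmetric_convex_function_of_coordinate_sum[OF p_def p_mono this h_convex]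
  obtain f where f: "\<And>x. h x = f (\<Sum>i\<in>UNIV. x $ i)" "convex_on UNIV f" "antimono f" by blast
  define \<psi> where "\<psi> d = f (ln d)" for d
  have w_eq: "w F = \<psi> (det F)" if "0 < det F" for F
  proof -
    let ?s = "singular_values F"
    have "g ?s = h (\<chi> i. ln (?s $ i))" using prod_singular_values(2)[OF that] by (simp add: h_def)
    also have "\<dots> = f (\<Sum>i\<in>UNIV. ln (?s $ i))" by (simp add: f(1))
    also have "(\<Sum>i\<in>UNIV. ln (?s $ i)) = ln (\<Prod>i\<in>UNIV. ?s $ i)"
    proof -
      have pos: "0 < ?s $ i" for i by (rule prod_singular_values(2)[OF that])
      then have "?s $ i \<noteq> 0" for i using less_imp_neq by metis
      then show ?thesis using pos by (intro ln_prod[symmetric]) simp_all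
    qed
    finally show ?thesis using w_def[of F] that by (simp add: GL_pos_def \<psi>_def prod_singular_values(1))
  qed
  have \<psi>_anti: "\<psi> b \<le> \<psi> a" if "0 < a" "a \<le> b" for a b
    unfolding \<psi>_def by (rule antimonoD[OF f(3)]) (use that in simp)
  have conv: "convex_on {0<..} \<psi>" unfolding \<psi>_def by (rule convex_antimono_comp_ln[OF f(2,3)])
  obtain s where s: "\<And>x y. 0 < x \<Longrightarrow> 0 < y \<Longrightarrow> \<psi> y \<ge> \<psi> x + s x * (y - x)"
    "mono_on {0<..} s" "\<And>x. 0 < x \<Longrightarrow> s x \<le> 0"
    by (rule convex_antimono_slope[OF conv \<psi>_anti]; (assumption | (rule that; assumption)))
  obtain c C where c: "0 < c" and uc: "\<And>x y. x \<in> \<Omega> \<Longrightarrow> y \<in> \<Omega> \<Longrightarrow> c * dist x y \<le> dist (u x) (u y) \<and> dist (u x) (u y) \<le> C * dist x y"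
    using u_bilip unfolding bi_lipschitz_on_def by (elim exE conjE) (rule that, auto)
  define L' where "L' = max L C"
  have L: "0 \<le> L" using lipschitz_on_nonneg[OF phi_lipschitz] .
  have lip: "L'-lipschitz_on \<Omega> (\<phi> k)" for k by (rule lipschitz_on_mono[OF phi_lipschitz]) (auto simp: L'_def)
  have ulip: "L'-lipschitz_on \<Omega> u"
  proof (rule lipschitz_onI)
    fix x y assume "x \<in> \<Omega>" "y \<in> \<Omega>"
    then have "dist (u x) (u y) \<le> C * dist x y" using uc by blast
    also have "\<dots> \<le> L' * dist x y" by (intro mult_right_mono) (auto simp: L'_def)
    finally show "dist (u x) (u y) \<le> L' * dist x y" .
  qed (use L in \<open>simp add: L'_def\<close>)
  obtain D d d0 where
    dk: "\<And>k. AE x in ?N. \<phi> k differentiable (at x) \<and> det (jacobian (\<phi> k) (at x)) = d k x"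
    and du: "AE x in ?N. u differentiable (at x) \<and> det (jacobian u (at x)) = d0 x"
    and d: "\<And>k. d k \<in> borel_measurable ?N" "\<And>k x. \<bar>d k x\<bar> \<le> D"
    and d0: "d0 \<in> borel_measurable ?N" "\<And>x. \<bar>d0 x\<bar> \<le> D"
    and weak': "\<forall>a B. a \<in> borel_measurable ?N \<longrightarrow> (\<forall>x. \<bar>a x\<bar> \<le> B) \<longrightarrow>
      (\<lambda>k. \<integral>x. a x * d k x \<partial>?N) \<longlonglongrightarrow> (\<integral>x. a x * d0 x \<partial>?N)"
    by (rule jacobian_determinants_converge_weakly[OF Omega_open Omega_bounded lip ulip phi_conv]) (rule that, assumption+)
  note weak = weak'[rule_format]
  note [measurable] = d(1) d0(1)
  have D: "0 \<le> D" using d0(2) abs_ge_zero order_trans by blast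
  have dpos: "AE x in ?N. 0 < d k x" for k
    using dk[of k] phi_GL[of k] by eventually_elim (auto simp: GL_pos_def)
  have int: "integrable ?N (\<lambda>x. a x * e x)"
    if "a \<in> borel_measurable ?N" "\<And>x. \<bar>a x\<bar> \<le> B" "e \<in> borel_measurable ?N" "\<And>x. \<bar>e x\<bar> \<le> D" for a e B
  proof (rule N.integrable_const_bound[where B = "B * D"])
    show "AE x in ?N. norm (a x * e x) \<le> B * D"
      using mult_mono'[OF that(2) that(4)] by (intro AE_I2) (simp add: abs_mult)
    show "(\<lambda>x. a x * e x) \<in> borel_measurable ?N" by (intro borel_measurable_times that)
  qed
  have d0_nonneg: "AE x in ?N. 0 \<le> d0 x"
  proof -
    \<comment> \<open>test with the indicator of the set where \<open>d0\<close> is negative\<close>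
    define a where "a x = (if d0 x < 0 then 1 else 0 :: real)" for x
    have am: "a \<in> borel_measurable ?N" unfolding a_def by measurable
    have ab: "\<bar>a x\<bar> \<le> 1" for x by (simp add: a_def)
    have "0 \<le> (\<integral>x. a x * d k x \<partial>?N)" for k
      using dpos[of k] by (intro integral_nonneg_AE) (auto elim!: eventually_mono simp: a_def)
    then have "0 \<le> (\<integral>x. a x * d0 x \<partial>?N)"
      by (intro LIMSEQ_le_const[OF weak[OF am ab]]) auto
    then have "(\<integral>x. - (a x * d0 x) \<partial>?N) \<le> 0" by simp
    moreover have nn: "AE x in ?N. 0 \<le> - (a x * d0 x)" by (rule AE_I2) (simp add: a_def)
    moreover have i: "integrable ?N (\<lambda>x. - (a x * d0 x))" using int[OF am ab d0] by simp
    ultimately have "AE x in ?N. - (a x * d0 x) = 0"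
      using integral_nonneg_eq_0_iff_AE[OF i nn] integral_nonneg_AE[OF nn] by linarith
    then show ?thesis by eventually_elim (auto simp: a_def split: if_splits)
  qed
  define \<delta> where "\<delta> = 1 / (fact CARD('n) * (1 / c) ^ CARD('n))"
  have \<delta>: "0 < \<delta>" using c by (simp add: \<delta>_def)
  have "AE x in ?N. x \<in> \<Omega>" by (rule AE_I2) simp
  with du d0_nonneg have d0_ge: "AE x in ?N. \<delta> \<le> d0 x"
  proof eventually_elim
    case (elim x)
    let ?A = "jacobian u (at x)"
    have der: "(u has_derivative (\<lambda>h. ?A *v h)) (at x)"
      using elim by (simp add: jacobian_works)
    have "c * norm h \<le> norm (?A *v h)" for h
      by (rule norm_derivative_between_increment_bounds(1)[OF Omega_open _ der, where C = C])
        (use uc elim in \<open>auto simp: dist_norm\<close>)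
    from abs_det_ge[OF c this] show ?case using elim by (simp add: \<delta>_def)
  qed
  \<comment> \<open>\<open>cl\<close> changes \<open>d0\<close> on a null set only; it makes the slope and the value of \<open>\<psi>\<close> at \<open>cl (d0 x)\<close> bounded for every \<open>x\<close>\<close>
  define D1 where "D1 = max D \<delta>"
  define cl where "cl t = max \<delta> (min D1 t)" for t :: real
  have cl: "\<delta> \<le> cl t" "cl t \<le> D1" "0 < cl t" for t using \<delta> by (auto simp: cl_def D1_def)
  have cl_mono: "cl t \<le> cl t'" if "t \<le> t'" for t t' using that by (auto simp: cl_def)
  have cl_d0: "AE x in ?N. cl (d0 x) = d0 x"
    using d0_ge
  proof eventually_elim
    case (elim x)
    have "d0 x \<le> D1" using d0(2)[of x] by (simp add: D1_def abs_le_iff le_max_iff_disj)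
    then show ?case using elim by (simp add: cl_def)
  qed
  define a where "a x = - s (cl (d0 x))" for x
  have "mono (\<lambda>t. s (cl t))" using s(2) cl(3) cl_mono by (auto simp: mono_def mono_on_def)
  then have "(\<lambda>t. s (cl t)) \<in> borel_measurable borel" by (rule borel_measurable_mono)
  from measurable_compose[OF d0(1) this] have am: "a \<in> borel_measurable ?N" by (simp add: a_def[abs_def])
  have ab: "\<bar>a x\<bar> \<le> - s \<delta>" and a0: "0 \<le> a x" for x
    using s(3)[OF cl(3)[of "d0 x"]] mono_onD[OF s(2), of \<delta> "cl (d0 x)"] cl[of "d0 x"] \<delta> by (auto simp: a_def)
  define q where "q x = \<psi> (cl (d0 x))" for x
  have "mono (\<lambda>t. - \<psi> (cl t))" using \<psi>_anti[OF cl(3) cl_mono] by (auto simp: mono_def)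
  then have "(\<lambda>t. - \<psi> (cl t)) \<in> borel_measurable borel" by (rule borel_measurable_mono)
  from measurable_compose[OF d0(1) this] have "(\<lambda>x. - q x) \<in> borel_measurable ?N" by (simp add: q_def[abs_def])
  then have qm: "q \<in> borel_measurable ?N" by simp
  have qb: "\<bar>q x\<bar> \<le> max \<bar>\<psi> \<delta>\<bar> \<bar>\<psi> D1\<bar>" for x
    using \<psi>_anti[OF \<delta> cl(1)[of "d0 x"]] \<psi>_anti[OF cl(3) cl(2), of "d0 x"] by (auto simp: q_def abs_le_iff max_def)
  have qi: "integrable ?N q"
    by (rule N.integrable_const_bound[where B = "max \<bar>\<psi> \<delta>\<bar> \<bar>\<psi> D1\<bar>"]) (use qm qb in auto)
  \<comment> \<open>the supporting line of \<open>\<psi>\<close> at \<open>det Du\<close>, evaluated at \<open>det D\<phi>\<^sub>k\<close>\<close>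
  define l where "l k x = q x - a x * d k x + a x * d0 x" for k x
  have li: "integrable ?N (l k)" for k
    unfolding l_def by (intro Bochner_Integration.integrable_add Bochner_Integration.integrable_diff qi int[OF am ab] d d0)
  have "(\<integral>x. l k x \<partial>?N) = (\<integral>x. q x \<partial>?N) - (\<integral>x. a x * d k x \<partial>?N) + (\<integral>x. a x * d0 x \<partial>?N)" for k
    unfolding l_def using qi int[OF am ab d, of k] int[OF am ab d0] by simp
  moreover have "(\<lambda>k. (\<integral>x. q x \<partial>?N) - (\<integral>x. a x * d k x \<partial>?N) + (\<integral>x. a x * d0 x \<partial>?N))
      \<longlonglongrightarrow> (\<integral>x. q x \<partial>?N) - (\<integral>x. a x * d0 x \<partial>?N) + (\<integral>x. a x * d0 x \<partial>?N)"
    by (intro tendsto_intros weak[OF am ab])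
  ultimately have "(\<lambda>k. \<integral>x. l k x \<partial>?N) \<longlonglongrightarrow> (\<integral>x. q x \<partial>?N)" by simp
  then have "(\<lambda>k. ereal (\<integral>x. l k x \<partial>?N)) \<longlonglongrightarrow> ereal (\<integral>x. q x \<partial>?N)" by simp
  then have lim: "liminf (\<lambda>k. ereal (\<integral>x. l k x \<partial>?N)) = ereal (\<integral>x. q x \<partial>?N)"
    by (intro lim_imp_Liminf) auto
  have below: "ereal (\<integral>x. l k x \<partial>?N) \<le> ereal_integral ?N (\<lambda>x. w (jacobian (\<phi> k) (at x)))" for k
  proof -
    have "AE x in ?N. l k x \<le> w (jacobian (\<phi> k) (at x))"
      using dk[of k] dpos[of k] cl_d0
    proof eventually_elim
      case (elim x)
      have "\<psi> (d k x) \<ge> \<psi> (cl (d0 x)) + s (cl (d0 x)) * (d k x - cl (d0 x))"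
        by (rule s(1)[OF cl(3)]) (use elim in simp)
      moreover have "w (jacobian (\<phi> k) (at x)) = \<psi> (d k x)" using elim by (simp add: w_eq)
      ultimately show ?case using elim by (simp add: l_def a_def q_def algebra_simps)
    qed
    from ereal_integral_mono_AE[OF this] show ?thesis by (simp only: ereal_integral_eq_integral[OF li])
  qed
  have "AE x in ?N. w (jacobian u (at x)) = q x"
    using du d0_ge cl_d0 by eventually_elim (use \<delta> in \<open>simp add: w_eq q_def\<close>)
  then have "ereal_integral ?N (\<lambda>x. w (jacobian u (at x))) = ereal (\<integral>x. q x \<partial>?N)"
    using ereal_integral_cong_AE[of "\<lambda>x. w (jacobian u (at x))" q] by (simp add: ereal_integral_eq_integral[OF qi])
  also have "\<dots> = liminf (\<lambda>k. ereal (\<integral>x. l k x \<partial>?N))" by (rule lim[symmetric])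
  also have "\<dots> \<le> liminf (\<lambda>k. ereal_integral ?N (\<lambda>x. w (jacobian (\<phi> k) (at x))))"
    by (intro Liminf_mono always_eventually allI below)
  finally show ?thesis .
qed

end
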